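(* Let $c>0$ and $\gamma\in\mathbb R\setminus\{0\}$. Let $n\to\infty$ with $k=k(n)\to\infty$, $\frac kn\to c$, and let $q=q(n)=1-\frac\gamma n$. For each $n$ let $\lambda$ be a random Young diagram in the $n\times k$ rectangle distributed according to one of the two probability measures (A) $\displaystyle \mu_{n,k}(\lambda|q)=\frac{s_\lambda(1,q,\dots,q^{n-1})\,s_{\bar\lambda'}(1,q,\dots,q^{k-1})}{\prod_{i=1}^n\prod_{j=1}^k(q^{i-1}+q^{j-1})}$, (B) $\displaystyle \mu_{n,k}(\lambda|q,q^{-1})=\frac{s_\lambda(1,q,\dots,q^{n-1})\,s_{\bar\lambda'}(1,q^{-1},\dots,q^{1-k})}{\prod_{i=1}^n\prod_{j=1}^k(q^{i-1}+q^{1-j})}$, and let $f_n$ be the upper boundary of the rotated and scaled diagram $\lambda$. Then the limit shape of $f_n$ is $$f(x)=1+\int_0^x(1-2\rho(t))\,dt,\qquad x\in[0,c+1],$$ where the limit density $\rho(t)$, $0<t<c+1$, equals in case (A) $$\rho(t)=\frac1\pi\arccos\left(\mathrm{sgn}(-\gamma)\frac{e^{\gamma-\frac{\gamma t}2}}{2}\frac{1-e^{\gamma(c-1)}}{\sqrt{(1-e^{\gamma t})(1-e^{\gamma(c+1-t)})}}\right),$$ and in case (B) $$\rho(t)=\frac1\pi\arccos\left(\mathrm{sgn}(-\gamma)\frac{e^{\frac\gamma2(t-c)}}{2}\frac{1-e^{\gamma c}-e^{\gamma(c-t)}+e^{\gamma(c+1-t)}}{\sqrt{(1-e^{\gamma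 t})(1-e^{\gamma(c+1-t)})}}\right).$$ Here convergence to the limit shape is weak convergence: for every continuous compactly supported function $g:(0,c+1)\to\mathbb R$, $$\int g(x)f_n'(x)\,dx\longrightarrow\int g(x)f'(x)\,dx\quad\text{in probability as } n\to\infty .$$
   Context: $s_\mu$ denotes the Schur polynomial. For $\lambda$ with at most $n$ rows and at most $k$ columns, $\bar\lambda$ is the complement in the $n\times k$ rectangle, $\bar\lambda_i=k-\lambda_{n+1-i}$, and $\bar\lambda'$ is its conjugate (transposed) diagram. Upper boundary: put $a_i=\lambda_i+n-i\in\{0,\dots,n+k-1\}$, $i=1,\dots,n$. Rotating the diagram by $45^\circ$ and scaling by $\frac1n$, its upper boundary is the continuous piecewise-linear function $f_n$ on $[0,\frac{n+k}n]$ with $f_n(0)=1$, slope $-1$ on each interval $[\frac{a_i}n,\frac{a_i+1}n]$, $i=1,\dots,n$, and slope $+1$ on each of the remaining intervals $[\frac jn,\frac{j+1}n]$, $j\in\{0,\dots,n+k-1\}\setminus\{a_1,\dots,a_n\}$. Convention: if the argument of $\arccos$ in the formula for $\rho(t)$ is greater than $1$, then $\rho(t)=0$; if it is less than $-1$, then $\rho(t)=1$. *)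

theory Defs
  imports "HOL-Probability.Probability" "Jordan_Normal_Form.Determinant"
begin

text \<open>
  A Young diagram with at most \<open>n\<close> rows and at most \<open>k\<close> columns is the weakly decreasing list of
  its \<open>n\<close> row lengths, padded with zeros. All indices start at 0.
\<close>

definition diagrams :: "nat \<Rightarrow> nat \<Rightarrow> nat list set" where
  "diagrams n k = {l. length l = n \<and> sorted_wrt (\<ge>) l \<and> (\<forall>p\<in>set l. p \<le> k)}"

definition complement_diagram :: "nat \<Rightarrow> nat list \<Rightarrow> nat list" where
  "complement_diagram k l = map (\<lambda>p. k - p) (rev l)"

definition conjugate_diagram :: "nat \<Rightarrow> nat list \<Rightarrow> nat list" where
  "conjugate_diagram k l = map (\<lambda>j. card {i. i < length l \<and> j < l ! i}) [0..<k]"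

text \<open>
  The Schur polynomial in the \<open>length l\<close> variables \<open>x 0, x 1, \<dots>\<close>, as the bialternant
  \<open>a\<^bsub>l+\<delta>\<^esub> / a\<^bsub>\<delta>\<^esub>\<close>. The quotient of real numbers is the value of the polynomial only at pairwise
  distinct arguments; it is used here for the powers of some \<open>q > 0\<close>, \<open>q \<noteq> 1\<close>.
\<close>

definition schur :: "nat list \<Rightarrow> (nat \<Rightarrow> real) \<Rightarrow> real" where
  "schur l x = (let N = length l in
     Determinant.det (Matrix.mat N N (\<lambda>(i, j). x i ^ (l ! j + (N - Suc j)))) /
     Determinant.det (Matrix.mat N N (\<lambda>(i, j). x i ^ (N - Suc j))))"

definition mu :: "nat \<Rightarrow> nat \<Rightarrow> (nat \<Rightarrow> real) \<Rightarrow> (nat \<Rightarrow> real) \<Rightarrow> nat list \<Rightarrow> real" where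
  "mu n k x y l =
     schur l x * schur (conjugate_diagram k (complement_diagram k l)) y /
     (\<Prod>i<n. \<Prod>j<k. x i + y j)"

definition mu_A :: "nat \<Rightarrow> nat \<Rightarrow> real \<Rightarrow> nat list \<Rightarrow> real" where
  "mu_A n k q = mu n k (\<lambda>i. q ^ i) (\<lambda>j. q ^ j)"

definition mu_B :: "nat \<Rightarrow> nat \<Rightarrow> real \<Rightarrow> nat list \<Rightarrow> real" where
  "mu_B n k q = mu n k (\<lambda>i. q ^ i) (\<lambda>j. inverse q ^ j)"

definition random_diagram ::
  "'w measure \<Rightarrow> ('w \<Rightarrow> nat list) \<Rightarrow> nat \<Rightarrow> nat \<Rightarrow> (nat list \<Rightarrow> real) \<Rightarrow> bool" where
  "random_diagram M L n k p \<longleftrightarrow>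
     prob_space M \<and> L \<in> measurable M (count_space (diagrams n k)) \<and>
     distr M (count_space (diagrams n k)) L = point_measure (diagrams n k) (\<lambda>l. ennreal (p l))"

definition boundary_slope :: "nat \<Rightarrow> nat list \<Rightarrow> nat \<Rightarrow> real" where
  "boundary_slope n l j = (if \<exists>i<n. j = l ! i + (n - Suc i) then - 1 else 1)"

text \<open>
  The \<open>j\<close>-th summand contributes its slope times the length of
  \<open>[j/n, (j+1)/n] \<inter> [0, x]\<close>; see the three lemmas below.
\<close>

definition upper_boundary :: "nat \<Rightarrow> nat \<Rightarrow> nat list \<Rightarrow> real \<Rightarrow> real" where
  "upper_boundary n k l x =
     1 + (\<Sum>j<n + k. boundary_slope n l j * max 0 (min (x - real j / real n) (1 / real n)))"

lemma upper_boundary_0: "upper_boundary n k l 0 = 1"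
proof -
  have "max 0 (min (0 - real j / real n) (1 / real n)) = 0" for j
    by (simp add: max_absorb1 min.coboundedI1)
  then show ?thesis unfolding upper_boundary_def by simp
qed

lemma continuous_upper_boundary: "continuous_on S (upper_boundary n k l)"
  unfolding upper_boundary_def by (intro continuous_intros)

lemma upper_boundary_slope:
  assumes n: "n > 0" and j: "j < n + k"
    and x: "real j / real n \<le> x" "x \<le> (real j + 1) / real n"
  shows "upper_boundary n k l x =
    upper_boundary n k l (real j / real n) + boundary_slope n l j * (x - real j / real n)"
proof -
  let ?m = "\<lambda>x i. max 0 (min (x - real i / real n) (1 / real n))"
  have *: "?m x i - ?m (real j / real n) i = (if i = j then x - real j / real n else 0)" for i
  proof -
    have e: "(real j + 1) / real n = real j / real n + 1 / real n"
      by (simp add: add_divide_distrib)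
    consider "i = j" | "i < j" | "j < i" by linarith
    then show ?thesis
    proof cases
      case 1
      then show ?thesis using x e n by (auto simp: max_def min_def)
    next
      case 2
      then have "(real i + 1) / real n \<le> real j / real n"
        by (intro divide_right_mono) auto
      then have "real i / real n + 1 / real n \<le> real j / real n"
        by (simp add: add_divide_distrib)
      moreover have "0 < 1 / real n" using n by simp
      ultimately show ?thesis using x 2 unfolding max_def min_def by (smt (verit))
    next
      case 3
      then have "(real j + 1) / real n \<le> real i / real n"
        by (intro divide_right_mono) auto
      then have "real j / real n + 1 / real n \<le> real i / real n"
        by (simp add: add_divide_distrib)
      moreover have "0 < 1 / real n" using n by simp
      ultimately show ?thesis using x 3 e unfolding max_def min_def by (smt (verit))
    qed
  qed
  have "upper_boundary n k l x - upper_boundary n k l (real j / real n) =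
      (\<Sum>i<n + k. boundary_slope n l i * (?m x i - ?m (real j / real n) i))"
    unfolding upper_boundary_def by (simp add: sum_subtractf right_diff_distrib)
  also have "\<dots> = boundary_slope n l j * (x - real j / real n)"
    unfolding * using j by (simp add: if_distrib cong: if_cong)
  finally show ?thesis by simp
qed

text \<open>\<open>1/\<pi> arccos u\<close>, extended by 0 for \<open>u > 1\<close> and by 1 for \<open>u < -1\<close>.\<close>

definition arccos_density :: "real \<Rightarrow> real" where
  "arccos_density u = (if u > 1 then 0 else if u < - 1 then 1 else arccos u / pi)"

definition rho_A :: "real \<Rightarrow> real \<Rightarrow> real \<Rightarrow> real" where
  "rho_A c \<gamma> t = arccos_density
     (sgn (- \<gamma>) * (exp (\<gamma> - \<gamma> * t / 2) / 2) *
      ((1 - exp (\<gamma> * (c - 1))) /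
       sqrt ((1 - exp (\<gamma> * t)) * (1 - exp (\<gamma> * (c + 1 - t))))))"

definition rho_B :: "real \<Rightarrow> real \<Rightarrow> real \<Rightarrow> real" where
  "rho_B c \<gamma> t = arccos_density
     (sgn (- \<gamma>) * (exp (\<gamma> / 2 * (t - c)) / 2) *
      ((1 - exp (\<gamma> * c) - exp (\<gamma> * (c - t)) + exp (\<gamma> * (c + 1 - t))) /
       sqrt ((1 - exp (\<gamma> * t)) * (1 - exp (\<gamma> * (c + 1 - t))))))"

definition limit_shape :: "(real \<Rightarrow> real) \<Rightarrow> real \<Rightarrow> real" where
  "limit_shape \<rho> x = 1 + (LBINT t:{0..x}. 1 - 2 * \<rho> t)"

definition tendsto_in_prob ::
  "(nat \<Rightarrow> 'w measure) \<Rightarrow> (nat \<Rightarrow> 'w \<Rightarrow> real) \<Rightarrow> real \<Rightarrow> bool" where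
  "tendsto_in_prob M X a \<longleftrightarrow>
     (\<forall>\<epsilon>>0. (\<lambda>n. measure (M n) {\<omega>\<in>space (M n). \<bar>X n \<omega> - a\<bar> > \<epsilon>}) \<longlonglongrightarrow> 0)"

text \<open>
  Only the values of \<open>g\<close> on \<open>(0, b)\<close> are used. The derivative of a piecewise linear boundary is
  unspecified at its finitely many corners, which form a null set.
\<close>

definition has_limit_shape ::
  "real \<Rightarrow> (nat \<Rightarrow> 'w measure) \<Rightarrow> (nat \<Rightarrow> 'w \<Rightarrow> real \<Rightarrow> real) \<Rightarrow> (real \<Rightarrow> real) \<Rightarrow> bool" where
  "has_limit_shape b M F f \<longleftrightarrow>
     (\<forall>g. continuous_on {0<..<b} g \<longrightarrow>
          (\<exists>K. compact K \<and> K \<subseteq> {0<..<b} \<and> (\<forall>x\<in>{0<..<b} - K. g x = 0)) \<longrightarrow>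
          tendsto_in_prob M (\<lambda>n \<omega>. LBINT x:{0<..<b}. g x * deriv (F n \<omega>) x)
            (LBINT x:{0<..<b}. g x * deriv f x))"

end

theory Submission
  imports Defs "HOL-Complex_Analysis.Complex_Analysis"
begin

text \<open>
  The derivative of the upper boundary is \<open>-1\<close> on the cells at the positions \<open>a\<^sub>1, \<dots>, a\<^sub>n\<close> of the random
  diagram and \<open>1\<close> elsewhere. The theorem is therefore a law of large numbers: the measures that put
  mass \<open>1/n\<close> on each \<open>a\<^sub>i/n\<close> converge to the measure with density \<open>\<rho>\<close>.

  At a geometric progression a Schur polynomial is a Vandermonde product in the nodes
  \<open>x\<^sub>a = q ^ a\<close>. The positions of the conjugate complement are the complementary subset of
  \<open>{0, \<dots>, n + k - 1}\<close>, and the Vandermonde product over a complement can be expressed by the one over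
  the set itself (\<open>pair_prod_complement\<close>). So both measures have the form
  \<open>C * V(x)\<^sup>2 * \<Prod> w(a\<^sub>i)\<close>, with the Vandermonde product \<open>V\<close> of the nodes at the positions and the weight
  \<open>w a = \<eta> ^ a / \<Prod>m\<noteq>a. \<bar>q ^ a - q ^ m\<bar>\<close>, where \<open>\<eta> = 1\<close> in case (A) and \<open>\<eta> = q ^ (k - 1)\<close> in case (B)
  (\<open>mu_A_density\<close>, \<open>mu_B_density\<close>). This is an orthogonal polynomial ensemble, which has two
  consequences (\<open>ensemble_moments\<close>). First, orthonormal polynomials show that the variance of
  \<open>\<Sum>i. h(a\<^sub>i)\<close> is at most \<open>n\<close> times the square of the maximum of \<open>\<bar>h\<bar>\<close>, so by Chebyshev's inequality only
  means matter. Secondly, the generating function of \<open>w\<close> splits into explicit linear factors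
  (\<open>node_generating_function\<close>), and Andreief's identity then gives the mean of the power sum
  \<open>\<Sum>i. q ^ (m * a\<^sub>i)\<close> as an explicit sum over \<open>n\<close> terms.

  These terms are residues. Written as a contour integral, the mean divided by \<open>n\<close> tends to
  \<open>M\<^sub>m = - 1 / (m * \<gamma>)\<close> times the integral of \<open>G\<^sub>1(z) ^ m / (2 * \<pi> * \<i> * z)\<close> over a circle
  (\<open>moment_limit\<close>), for the rational function
  \<open>G\<^sub>s(z) = (\<theta> * e * z + 1) * (z - 1) / ((z - exp (- \<gamma> * s)) * (\<theta> * z + exp (\<gamma> * s)))\<close> with
  \<open>e = exp (- \<gamma> * (c + 1))\<close> and \<open>\<theta> = (lim \<eta>) / e\<close>.

  It remains to recognise \<open>M\<^sub>m\<close> as the moment \<open>\<integral> exp (- \<gamma> * m * t) * \<rho> t\<close> over \<open>0 < t < c + 1\<close>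
  (\<open>rho_moment\<close>). To this end the parameter \<open>s\<close> runs from \<open>0\<close> to \<open>1\<close>. For \<open>s = 0\<close> the pole inside the
  circle cancels, so \<open>M\<^sub>m\<close> is the integral over \<open>s\<close> of the derivative. The generating function over
  \<open>m\<close> of these derivatives is a single residue, the inverse square root of a quadratic polynomial
  (\<open>contour_density_generating\<close>). The moments of an arcsine law have a generating function of the same
  kind, by the Poisson integral, and for the right interval it is the same function
  (\<open>arcsine_moment_generating\<close>). On the other side, the derivative of the arccosine is, up to
  sign, an arcsine density, so \<open>\<rho>\<close> itself is the integral over \<open>s\<close> of the densities of these arcsine laws in the
  coordinate \<open>exp (- \<gamma> * t)\<close> (\<open>nn_integral_arcsine_parameter\<close>). Tonelli's theorem identifies the
  moments.

  Finally a continuous test function is approximated by polynomials in \<open>exp (- \<gamma> * t)\<close>, and integrals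
  against the derivative of the boundary by sums over positions (\<open>limit_shape_convergence\<close>).
\<close>

section \<open>Determinants and Vandermonde products\<close>

text \<open>
  Determinants are indexed by functions on natural numbers, so that sums over permutations and
  entrywise rewriting need no matrix carriers.
\<close>

abbreviation fdet :: "nat \<Rightarrow> (nat \<Rightarrow> nat \<Rightarrow> real) \<Rightarrow> real" where
  "fdet n f \<equiv> Determinant.det (Matrix.mat n n (\<lambda>(i, j). f i j))"

lemma fdet_leibniz:
  "fdet n f = (\<Sum>p | p permutes {..<n}. of_int (sign p) * (\<Prod>j<n. f (p j) j))"
proof -
  have "fdet n f = (\<Sum>p | p permutes {0..<n}. of_int (sign p) * (\<Prod>j<n. Matrix.mat n n (\<lambda>(i, j). f i j) $$ (p j, j)))"
    by (rule det_col) simp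
  also have "\<dots> = (\<Sum>p | p permutes {..<n}. of_int (sign p) * (\<Prod>j<n. f (p j) j))"
    unfolding atLeast0LessThan
    by (intro sum.cong refl arg_cong2[where f = "(*)"] prod.cong)
       (auto simp: permutes_in_image[of _ "{..<n}", unfolded lessThan_iff])
  finally show ?thesis .
qed

lemma fdet_cong:
  assumes "\<And>i j. i < n \<Longrightarrow> j < n \<Longrightarrow> f i j = g i j"
  shows "fdet n f = fdet n g"
  using assms by (intro arg_cong[where f = Determinant.det] eq_matI) auto

lemma fdet_transpose: "fdet n (\<lambda>i j. f j i) = fdet n f"
proof -
  have "Matrix.mat n n (\<lambda>(i, j). f j i) = transpose_mat (Matrix.mat n n (\<lambda>(i, j). f i j))"
    by (intro eq_matI) auto
  then show ?thesis by (simp add: Determinant.det_transpose[of _ n])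
qed

lemma fdet_mult:
  "fdet n f * fdet n g = fdet n (\<lambda>i j. \<Sum>l<n. f i l * g l j)"
proof -
  have "fdet n f * fdet n g = Determinant.det (Matrix.mat n n (\<lambda>(i, j). f i j) * Matrix.mat n n (\<lambda>(i, j). g i j))"
    by (rule Determinant.det_mult[symmetric, of _ n]) auto
  also have "Matrix.mat n n (\<lambda>(i, j). f i j) * Matrix.mat n n (\<lambda>(i, j). g i j)
      = Matrix.mat n n (\<lambda>(i, j). \<Sum>l<n. f i l * g l j)"
    by (intro eq_matI) (auto simp: scalar_prod_def atLeast0LessThan)
  finally show ?thesis .
qed

lemma fdet_cols: "fdet n (\<lambda>i j. f i j * c j) = fdet n f * (\<Prod>j<n. c j)"
  unfolding fdet_leibniz by (simp add: prod.distrib sum_distrib_right mult.assoc)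

lemma fdet_permute_cols:
  assumes "s permutes {..<n}"
  shows "fdet n (\<lambda>i j. f i (s j)) = of_int (sign s) * fdet n f"
proof -
  have "fdet n (\<lambda>i j. f i (s j)) = fdet n (\<lambda>i j. f j (s i))"
    by (rule fdet_transpose[symmetric])
  also have "\<dots> = Determinant.det (Matrix.mat n n (\<lambda>(i, j). Matrix.mat n n (\<lambda>(i, j). f j i) $$ (s i, j)))"
    using permutes_in_image[OF assms] by (intro arg_cong[where f = Determinant.det] eq_matI) auto
  also have "\<dots> = of_int (sign s) * fdet n (\<lambda>i j. f j i)"
    using assms by (intro det_permute_rows) (auto simp: atLeast0LessThan)
  finally show ?thesis unfolding fdet_transpose[of n f] .
qed

lemma fdet_rows: "fdet n (\<lambda>i j. c i * f i j) = (\<Prod>j<n. c j) * fdet n f"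
  using fdet_cols[of n "\<lambda>i j. f j i" c] fdet_transpose[of n f]
    fdet_transpose[of n "\<lambda>i j. c i * f i j"]
  by (metis (no_types, lifting) mult.commute fdet_cong)

text \<open>
  A polynomial of degree below \<open>n\<close> is a combination of the first \<open>n\<close> powers, so the matrix of
  values is the Vandermonde matrix times the matrix of coefficients.
\<close>

lemma fdet_poly_basis:
  assumes "\<And>j. j < n \<Longrightarrow> degree (p j) < n"
  shows "fdet n (\<lambda>i j. poly (p j) (x i)) = fdet n (\<lambda>i j. x i ^ j) * fdet n (\<lambda>l j. coeff (p j) l)"
  unfolding fdet_mult
proof (rule fdet_cong)
  fix i j assume "i < n" "j < n"
  have "poly (p j) (x i) = (\<Sum>l\<le>degree (p j). coeff (p j) l * x i ^ l)" by (rule poly_altdef)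
  also have "\<dots> = (\<Sum>l<n. coeff (p j) l * x i ^ l)"
    using assms[OF \<open>j < n\<close>] by (intro sum.mono_neutral_left) (auto simp: coeff_eq_0)
  finally show "poly (p j) (x i) = (\<Sum>l<n. x i ^ l * coeff (p j) l)" by (simp add: mult.commute)
qed

lemma fdet_lower_triangular:
  assumes "\<And>i j. i < j \<Longrightarrow> j < n \<Longrightarrow> f i j = 0"
  shows "fdet n f = (\<Prod>i<n. f i i)"
proof -
  have "fdet n f = prod_list (diag_mat (Matrix.mat n n (\<lambda>(i, j). f i j)))"
    by (rule det_lower_triangular[of n]) (use assms in auto)
  also have "diag_mat (Matrix.mat n n (\<lambda>(i, j). f i j)) = map (\<lambda>i. f i i) [0..<n]"
    by (auto simp: diag_mat_def)
  also have "prod_list \<dots> = (\<Prod>i<n. f i i)"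
    by (subst prod.list_conv_set_nth) (auto intro!: prod.cong simp: atLeast0LessThan)
  finally show ?thesis .
qed

text \<open>
  In the Newton basis \<open>\<Prod>l<j. (X - x l)\<close> the matrix of values is triangular, and so is the matrix
  of coefficients, with ones on its diagonal.
\<close>

lemma vandermonde_det: "fdet n (\<lambda>i j. x i ^ j) = (\<Prod>i<n. \<Prod>l<i. x i - x l)"
proof -
  define p where "p j = (\<Prod>l<j. [:- x l, 1:])" for j :: nat
  have deg: "degree (p j) = j" for j
    unfolding p_def by (subst degree_prod_eq_sum_degree) auto
  have lc: "coeff (p j) j = 1" for j
    using lead_coeff_prod[of "\<lambda>l. [:- x l, 1:]" "{..<j}"] deg[of j] by (simp add: p_def)
  have "fdet n (\<lambda>i j. poly (p j) (x i)) = (\<Prod>i<n. poly (p i) (x i))"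
    by (rule fdet_lower_triangular) (auto simp: p_def poly_prod)
  moreover have "fdet n (\<lambda>l j. coeff (p j) l) = 1"
  proof -
    have "fdet n (\<lambda>l j. coeff (p j) l) = fdet n (\<lambda>l j. coeff (p l) j)" by (rule fdet_transpose)
    also have "\<dots> = (\<Prod>i<n. coeff (p i) i)"
      by (rule fdet_lower_triangular) (auto simp: coeff_eq_0 deg)
    finally show ?thesis by (simp add: lc)
  qed
  ultimately show ?thesis
    using fdet_poly_basis[of n p x] deg by (simp add: p_def poly_prod)
qed

section \<open>Sums of products of two determinants\<close>

text \<open>
  All sums over \<open>n\<close>-subsets of \<open>{..<N}\<close> are first taken over ordered tuples, repetitions included:
  there the indices are independent, and a squared Vandermonde factor removes the repetitions.
\<close>

abbreviation tuples :: "nat \<Rightarrow> nat \<Rightarrow> (nat \<Rightarrow> nat) set" where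
  "tuples n N \<equiv> {..<n} \<rightarrow>\<^sub>E {..<N}"

text \<open>
  For each permutation of the Leibniz expansion the summand is a product over the positions of the
  tuple, so the sum over tuples is a product of sums over single nodes.
\<close>

lemma sum_tuples_det_prod:
  "(\<Sum>a\<in>tuples n N. fdet n (\<lambda>i j. \<phi> i (a j)) * (\<Prod>j<n. \<psi> j (a j)))
     = fdet n (\<lambda>i j. \<Sum>b<N. \<phi> i b * \<psi> j b)"
proof -
  have "(\<Sum>a\<in>tuples n N. fdet n (\<lambda>i j. \<phi> i (a j)) * (\<Prod>j<n. \<psi> j (a j)))
    = (\<Sum>p | p permutes {..<n}. \<Sum>a\<in>tuples n N. of_int (sign p) * (\<Prod>j<n. \<phi> (p j) (a j) * \<psi> j (a j)))"
    unfolding fdet_leibniz sum_distrib_right by (subst sum.swap) (simp add: prod.distrib mult.assoc)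
  also have "\<dots> = (\<Sum>p | p permutes {..<n}. of_int (sign p) * (\<Prod>j<n. \<Sum>b<N. \<phi> (p j) b * \<psi> j b))"
    by (intro sum.cong refl) (simp add: sum_distrib_left[symmetric] prod_sum_PiE)
  finally show ?thesis by (simp add: fdet_leibniz)
qed

lemma tuples_permute:
  assumes "s permutes {..<n}"
  shows "bij_betw (\<lambda>a. a \<circ> s) (tuples n N) (tuples n N)"
proof (rule bij_betw_byWitness[where f' = "\<lambda>a. a \<circ> Hilbert_Choice.inv s"])
  show "\<forall>a\<in>tuples n N. a \<circ> s \<circ> Hilbert_Choice.inv s = a"
    by (simp add: comp_assoc permutes_inv_o[OF assms])
  show "\<forall>a\<in>tuples n N. a \<circ> Hilbert_Choice.inv s \<circ> s = a"
    by (simp add: comp_assoc permutes_inv_o[OF assms])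
  have *: "a \<circ> t \<in> tuples n N" if "a \<in> tuples n N" "t permutes {..<n}" for a t
    using that permutes_in_image[OF that(2)] permutes_not_in[OF that(2)]
    by (auto simp: PiE_iff extensional_def)
  show "(\<lambda>a. a \<circ> s) ` tuples n N \<subseteq> tuples n N" using * assms by auto
  show "(\<lambda>a. a \<circ> Hilbert_Choice.inv s) ` tuples n N \<subseteq> tuples n N" using * permutes_inv[OF assms] by auto
qed

text \<open>
  Permuting the tuple carries the terms of the second expansion into one another, and the first
  determinant absorbs the sign; hence all \<open>n!\<close> terms contribute equally. The symmetric factor \<open>F\<close>
  stands for a weight and possibly a statistic of the tuple.
\<close>

lemma sum_tuples_det_det:
  assumes F: "\<And>a s. s permutes {..<n} \<Longrightarrow> F (a \<circ> s) = F a"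
  shows "(\<Sum>a\<in>tuples n N. fdet n (\<lambda>i j. \<phi> i (a j)) * fdet n (\<lambda>i j. \<psi> i (a j)) * F a)
     = fact n * (\<Sum>a\<in>tuples n N. fdet n (\<lambda>i j. \<phi> i (a j)) * (\<Prod>j<n. \<psi> j (a j)) * F a)"
proof -
  have *: "(\<Sum>a\<in>tuples n N. fdet n (\<lambda>i j. \<phi> i (a j)) * (of_int (sign p) * (\<Prod>j<n. \<psi> (p j) (a j))) * F a)
     = (\<Sum>a\<in>tuples n N. fdet n (\<lambda>i j. \<phi> i (a j)) * (\<Prod>j<n. \<psi> j (a j)) * F a)" (is "?L = ?R")
    if p: "p permutes {..<n}" for p
  proof -
    have "?L = (\<Sum>a\<in>tuples n N. fdet n (\<lambda>i j. \<phi> i ((a \<circ> p) j)) *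
        (of_int (sign p) * (\<Prod>j<n. \<psi> (p j) ((a \<circ> p) j))) * F (a \<circ> p))"
      by (rule sum.reindex_bij_betw[OF tuples_permute[OF p], symmetric])
    also have "\<dots> = ?R"
    proof (rule sum.cong[OF refl])
      fix a
      have "(\<Prod>j<n. \<psi> (p j) (a (p j))) = (\<Prod>j<n. \<psi> j (a j))"
        using prod.permute[OF p, of "\<lambda>j. \<psi> j (a j)"] by (simp add: o_def)
      moreover have "fdet n (\<lambda>i j. \<phi> i (a (p j))) = of_int (sign p) * fdet n (\<lambda>i j. \<phi> i (a j))"
        by (rule fdet_permute_cols[OF p])
      moreover have "real_of_int (sign p) * of_int (sign p) = 1"
        by (simp flip: of_int_mult)
      ultimately show "fdet n (\<lambda>i j. \<phi> i ((a \<circ> p) j)) *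
        (of_int (sign p) * (\<Prod>j<n. \<psi> (p j) ((a \<circ> p) j))) * F (a \<circ> p) =
        fdet n (\<lambda>i j. \<phi> i (a j)) * (\<Prod>j<n. \<psi> j (a j)) * F a"
        using F[OF p, of a] by (simp add: algebra_simps)
    qed
    finally show ?thesis .
  qed
  have "(\<Sum>a\<in>tuples n N. fdet n (\<lambda>i j. \<phi> i (a j)) * fdet n (\<lambda>i j. \<psi> i (a j)) * F a)
    = (\<Sum>p | p permutes {..<n}. (\<Sum>a\<in>tuples n N. fdet n (\<lambda>i j. \<phi> i (a j)) * (of_int (sign p) * (\<Prod>j<n. \<psi> (p j) (a j))) * F a))"
    by (subst sum.swap) (simp add: fdet_leibniz[of _ "\<lambda>i j. \<psi> i (_ j)"] sum_distrib_left sum_distrib_right)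
  also have "\<dots> = (\<Sum>p | p permutes {..<n}. (\<Sum>a\<in>tuples n N. fdet n (\<lambda>i j. \<phi> i (a j)) * (\<Prod>j<n. \<psi> j (a j)) * F a))"
    by (intro sum.cong refl *) simp
  also have "\<dots> = fact n * (\<Sum>a\<in>tuples n N. fdet n (\<lambda>i j. \<phi> i (a j)) * (\<Prod>j<n. \<psi> j (a j)) * F a)"
    by (simp add: card_permutations)
  finally show ?thesis .
qed

text \<open>
  Andreief's identity, the form of the Cauchy--Binet formula for a weighted sum over tuples.
\<close>

lemma andreief:
  "(\<Sum>a\<in>tuples n N. fdet n (\<lambda>i j. \<phi> i (a j)) * fdet n (\<lambda>i j. \<psi> i (a j)) * (\<Prod>j<n. w (a j)))
     = fact n * fdet n (\<lambda>i j. \<Sum>b<N. \<phi> i b * (\<psi> j b * w b))"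
proof -
  have "(\<Sum>a\<in>tuples n N. fdet n (\<lambda>i j. \<phi> i (a j)) * fdet n (\<lambda>i j. \<psi> i (a j)) * (\<Prod>j<n. w (a j)))
     = fact n * (\<Sum>a\<in>tuples n N. fdet n (\<lambda>i j. \<phi> i (a j)) * (\<Prod>j<n. \<psi> j (a j)) * (\<Prod>j<n. w (a j)))"
  proof (rule sum_tuples_det_det)
    fix a s assume s: "s permutes {..<n}"
    show "(\<Prod>j<n. w ((a \<circ> s) j)) = (\<Prod>j<n. w (a j))"
      using prod.permute[OF s, of "\<lambda>j. w (a j)"] by (simp add: o_def)
  qed
  then show ?thesis
    using sum_tuples_det_prod[where n = n and N = N and \<phi> = \<phi> and \<psi> = "\<lambda>j b. \<psi> j b * w b"]
    by (simp only: prod.distrib mult.assoc)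
qed

text \<open>
  Each term of the Leibniz expansion contains every row exactly once. A sum over columns of factors
  \<open>h (a j)\<close> can therefore be redistributed over the rows: multiplying the determinant by a power
  sum amounts to changing one row at a time.
\<close>

lemma sum_times_det:
  "(\<Sum>j<n. h (a j)) * fdet n (\<lambda>i j. \<phi> i (a j))
     = (\<Sum>i0<n. fdet n (\<lambda>i j. (if i = i0 then h (a j) else 1) * \<phi> i (a j)))"
proof -
  have *: "(\<Sum>j<n. h (a j)) = (\<Sum>i0<n. \<Prod>j<n. if p j = i0 then h (a j) else 1)" if p: "p permutes {..<n}" for p
  proof -
    have "(\<Sum>i0<n. \<Prod>j<n. if p j = i0 then h (a j) else 1) =
        (\<Sum>i0<n. \<Prod>j<n. if p j = p i0 then h (a j) else 1)"
      using sum.permute[OF p, of "\<lambda>i0. \<Prod>j<n. if p j = i0 then h (a j) else 1"] by (simp add: o_def)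
    also have "\<dots> = (\<Sum>i0<n. \<Prod>j<n. if j = i0 then h (a j) else 1)"
      by (simp add: inj_eq[OF permutes_inj[OF p]])
    also have "\<dots> = (\<Sum>j<n. h (a j))" by (intro sum.cong) auto
    finally show ?thesis by simp
  qed
  have "(\<Sum>i0<n. fdet n (\<lambda>i j. (if i = i0 then h (a j) else 1) * \<phi> i (a j))) =
    (\<Sum>p | p permutes {..<n}. (\<Sum>i0<n. of_int (sign p) * ((\<Prod>j<n. if p j = i0 then h (a j) else 1) * (\<Prod>j<n. \<phi> (p j) (a j)))))"
    unfolding fdet_leibniz by (subst sum.swap) (simp add: prod.distrib)
  also have "\<dots> = (\<Sum>p | p permutes {..<n}. of_int (sign p) * ((\<Sum>j<n. h (a j)) * (\<Prod>j<n. \<phi> (p j) (a j))))"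
    by (intro sum.cong refl) (simp add: * sum_distrib_left sum_distrib_right)
  also have "\<dots> = (\<Sum>j<n. h (a j)) * fdet n (\<lambda>i j. \<phi> i (a j))"
    unfolding fdet_leibniz by (simp add: sum_distrib_left mult_ac)
  finally show ?thesis ..
qed

section \<open>Variance in an orthogonal polynomial ensemble\<close>

text \<open>
  A permutation with nonzero contribution fixes every column that is a unit vector; with a single
  other column it is the identity.
\<close>

lemma fdet_identity_but_one:
  assumes "p < n" and "\<And>i j. i < n \<Longrightarrow> j < n \<Longrightarrow> j \<noteq> p \<Longrightarrow> f i j = (if i = j then 1 else 0)"
  shows "fdet n f = f p p"
proof -
  have "fdet n f = (\<Sum>s\<in>{id}. of_int (sign s) * (\<Prod>j<n. f (s j) j))"
    unfolding fdet_leibniz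
  proof (rule sum.mono_neutral_right)
    show "\<forall>s\<in>{s. s permutes {..<n}} - {id}. of_int (sign s) * (\<Prod>j<n. f (s j) j) = 0"
    proof
      fix s assume "s \<in> {s. s permutes {..<n}} - {id}"
      then have s: "s permutes {..<n}" "s \<noteq> id" by auto
      have "\<exists>j<n. j \<noteq> p \<and> s j \<noteq> j"
      proof (rule ccontr)
        assume "\<not> ?thesis"
        then have *: "s j = j" if "j \<noteq> p" for j
          using that permutes_not_in[OF s(1), of j] by (cases "j < n") auto
        have "s p = p"
        proof (rule ccontr)
          assume "s p \<noteq> p"
          then have "s (s p) = s p" by (rule *)
          then show False using \<open>s p \<noteq> p\<close> permutes_inj[OF s(1)] by (auto dest: injD)
        qed
        with * have "s = id" by (intro ext) (metis id_apply)
        with s show False by simp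
      qed
      then obtain j where "j < n" "j \<noteq> p" "s j \<noteq> j" by blast
      then have "f (s j) j = 0" using assms(2) permutes_in_image[OF s(1), of j] by auto
      then have "(\<Prod>j<n. f (s j) j) = 0" using \<open>j < n\<close> by (intro prod_zero) auto
      then show "of_int (sign s) * (\<Prod>j<n. f (s j) j) = 0" by simp
    qed
  qed (auto simp: finite_permutations permutes_id)
  also have "\<dots> = (\<Prod>j<n. if j = p then f p p else 1)"
  proof -
    have "f (id j) j = (if j = p then f p p else 1)" if "j < n" for j using assms(2)[of j j] that by auto
    then show ?thesis by (simp add: sign_id cong: prod.cong_simp)
  qed
  also have "\<dots> = f p p" using assms(1) by simp
  finally show ?thesis .
qed

text \<open>
  With two columns that are not unit vectors, only the identity and their transposition contribute.
\<close>

lemma fdet_identity_but_two: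
  assumes pq: "p < n" "q < n" "p \<noteq> q"
    and "\<And>i j. i < n \<Longrightarrow> j < n \<Longrightarrow> j \<noteq> p \<Longrightarrow> j \<noteq> q \<Longrightarrow> f i j = (if i = j then 1 else 0)"
  shows "fdet n f = f p p * f q q - f p q * f q p"
proof -
  let ?t = "Transposition.transpose p q"
  have "fdet n f = (\<Sum>s\<in>{id, ?t}. of_int (sign s) * (\<Prod>j<n. f (s j) j))"
    unfolding fdet_leibniz
  proof (rule sum.mono_neutral_right)
    show "\<forall>s\<in>{s. s permutes {..<n}} - {id, ?t}. of_int (sign s) * (\<Prod>j<n. f (s j) j) = 0"
    proof
      fix s assume "s \<in> {s. s permutes {..<n}} - {id, ?t}"
      then have s: "s permutes {..<n}" "s \<noteq> id" "s \<noteq> ?t" by auto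
      have "\<exists>j<n. j \<noteq> p \<and> j \<noteq> q \<and> s j \<noteq> j"
      proof (rule ccontr)
        assume "\<not> ?thesis"
        then have *: "s j = j" if "j \<noteq> p" "j \<noteq> q" for j
          using that permutes_not_in[OF s(1), of j] by (cases "j < n") auto
        then have "s permutes {p, q}" using s(1)
          by (auto simp: permutes_def)
        then have "s = id \<or> s = ?t" by (simp add: permutes_doubleton_iff)
        with s show False by simp
      qed
      then obtain j where "j < n" "j \<noteq> p" "j \<noteq> q" "s j \<noteq> j" by blast
      then have "f (s j) j = 0" using assms(4) permutes_in_image[OF s(1), of j] by auto
      then have "(\<Prod>j<n. f (s j) j) = 0" using \<open>j < n\<close> by (intro prod_zero) auto
      then show "of_int (sign s) * (\<Prod>j<n. f (s j) j) = 0" by simp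
    qed
  qed (use pq in \<open>auto simp: finite_permutations permutes_id intro!: permutes_swap_id\<close>)
  also have "\<dots> = (\<Prod>j<n. f j j) - (\<Prod>j<n. f (?t j) j)"
    using pq by (subst sum.insert) (auto simp: sign_id sign_swap_id fun_eq_iff Transposition.transpose_def)
  also have "(\<Prod>j<n. f j j) = (\<Prod>j\<in>{p, q}. f j j)"
    using pq assms(4) by (intro prod.mono_neutral_right) auto
  also have "(\<Prod>j<n. f (?t j) j) = (\<Prod>j\<in>{p, q}. f (?t j) j)"
    using pq assms(4) by (intro prod.mono_neutral_right) (auto simp: transpose_apply_other)
  finally show ?thesis using pq by simp
qed

text \<open>
  Gram--Schmidt applied to the powers. The form is definite on polynomials of degree below \<open>N\<close>,
  because such a polynomial cannot vanish at \<open>N\<close> distinct nodes.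
\<close>

lemma orthonormal_polys_exist:
  fixes x w :: "nat \<Rightarrow> real" and N :: nat
  defines "ip \<equiv> \<lambda>f g. \<Sum>b<N. w b * (poly f (x b) * poly g (x b))"
  assumes x: "inj_on x {..<N}" and w: "\<And>b. b < N \<Longrightarrow> 0 < w b" and "n \<le> N"
  shows "\<exists>\<psi>. \<forall>i<n. degree (\<psi> i) = i \<and> (\<forall>j<n. ip (\<psi> i) (\<psi> j) = (if i = j then 1 else 0))"
  using \<open>n \<le> N\<close>
proof (induction n)
  case 0
  then show ?case by simp
next
  case (Suc n)
  then obtain \<psi> where \<psi>: "\<And>i. i < n \<Longrightarrow> degree (\<psi> i) = i"
    "\<And>i j. i < n \<Longrightarrow> j < n \<Longrightarrow> ip (\<psi> i) (\<psi> j) = (if i = j then 1 else 0)" by auto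
  define m where "m = (monom 1 n :: real poly)"
  define r where "r = m - (\<Sum>i<n. Polynomial.smult (ip m (\<psi> i)) (\<psi> i))"
  have deg_sum: "degree (\<Sum>i<n. Polynomial.smult (ip m (\<psi> i)) (\<psi> i)) < n \<or> n = 0"
  proof (cases "n = 0")
    case False
    then have "degree (\<Sum>i<n. Polynomial.smult (ip m (\<psi> i)) (\<psi> i)) \<le> n - 1"
      using \<psi>(1) by (intro degree_sum_le) (auto intro!: order_trans[OF degree_smult_le])
    then show ?thesis using False by simp
  qed simp
  have c: "coeff r n = 1"
    using deg_sum by (auto simp: r_def m_def coeff_eq_0)
  have "degree r \<le> n"
    using deg_sum unfolding r_def m_def
    by (intro degree_diff_le) (auto simp: degree_monom_eq)
  then have deg: "degree r = n" using c le_degree[of r n] by simp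
  have ip_diff: "ip (f - g) h = ip f h - ip g h" for f g h
    unfolding ip_def by (simp add: algebra_simps sum_subtractf)
  have ip_sum: "ip (\<Sum>i<n. Polynomial.smult (d i) (\<psi> i)) h = (\<Sum>i<n. d i * ip (\<psi> i) h)" for d h
    unfolding ip_def sum_distrib_left by (subst sum.swap) (simp add: poly_sum sum_distrib_left sum_distrib_right mult_ac)
  have ip_orth: "ip r (\<psi> j) = 0" if "j < n" for j
  proof -
    have "ip r (\<psi> j) = ip m (\<psi> j) - (\<Sum>i<n. ip m (\<psi> i) * ip (\<psi> i) (\<psi> j))"
      unfolding r_def ip_diff ip_sum ..
    also have "(\<Sum>i<n. ip m (\<psi> i) * ip (\<psi> i) (\<psi> j)) = (\<Sum>i<n. if i = j then ip m (\<psi> i) else 0)"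
      using \<psi>(2) that by (intro sum.cong) auto
    finally show ?thesis using that by simp
  qed
  have pos: "0 < ip r r"
  proof -
    have "\<exists>b<N. poly r (x b) \<noteq> 0"
    proof (rule ccontr)
      assume "\<not> ?thesis"
      then have "x ` {..<N} \<subseteq> {z. poly r z = 0}" by auto
      moreover have "r \<noteq> 0" using c by auto
      ultimately have "card (x ` {..<N}) \<le> degree r"
        by (intro order_trans[OF card_mono card_poly_roots_bound] poly_roots_finite)
      then show False using deg Suc.prems by (simp add: card_image[OF x])
    qed
    then obtain b where "b < N" "poly r (x b) \<noteq> 0" by blast
    then have "0 < w b * (poly r (x b) * poly r (x b))"
      using w[of b] not_real_square_gt_zero[of "poly r (x b)"] by (meson mult_pos_pos)
    then show ?thesis unfolding ip_def
      using \<open>b < N\<close> w by (intro sum_pos2[of _ b]) (auto simp: less_imp_le)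
  qed
  define \<psi>' where "\<psi>' = \<psi>(n := Polynomial.smult (1 / sqrt (ip r r)) r)"
  have sm1: "ip (Polynomial.smult d f) g = d * ip f g" for d f g
    unfolding ip_def by (simp add: sum_distrib_left mult_ac)
  have sm2: "ip f g = ip g f" for f g
    unfolding ip_def by (simp add: mult_ac)
  have sm3: "ip g (Polynomial.smult d f) = d * ip g f" for d f g
    unfolding sm2[of g] sm1 ..
  have ip_orth': "ip (\<psi> j) r = 0" if "j < n" for j
    using ip_orth[OF that] unfolding sm2[of r] .
  have "degree (\<psi>' i) = i \<and> (\<forall>j<Suc n. ip (\<psi>' i) (\<psi>' j) = (if i = j then 1 else 0))" if i: "i < Suc n" for i
  proof (intro conjI allI impI)
    show "degree (\<psi>' i) = i" using i \<psi>(1) deg pos by (cases "i = n") (auto simp: \<psi>'_def)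
    fix j assume j: "j < Suc n"
    consider "i < n" "j < n" | "i = n" "j < n" | "i < n" "j = n" | "i = n" "j = n" using i j by linarith
    then show "ip (\<psi>' i) (\<psi>' j) = (if i = j then 1 else 0)"
      by cases (use \<psi>(2) ip_orth ip_orth' pos in \<open>auto simp: \<psi>'_def sm1 sm3\<close>)
  qed
  then show ?case by blast
qed

text \<open>
  Points of a projection ensemble are negatively correlated. Passing to orthonormal polynomials
  \<open>\<phi> i\<close> multiplies the Vandermonde factor by a constant. With the matrix
  \<open>H p q = \<Sum>b. \<phi> p b * \<phi> q b * w b * h b\<close> the mean of the statistic is the trace of \<open>H\<close>, and its second
  moment is \<open>\<Sum>p. H2 p\<close>, where \<open>H2\<close> is the diagonal of the same matrix for \<open>h\<^sup>2\<close>, plus the sum of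
  \<open>H p p * H q q - (H p q)\<^sup>2\<close> over \<open>p \<noteq> q\<close>. The variance is thus at most the sum of the
  \<open>H2 p \<le> B\<^sup>2\<close>. The sums \<open>S\<close> are not normalised, since the mass of the weight is never computed.
\<close>

lemma linear_statistic_variance:
  fixes x w h :: "nat \<Rightarrow> real" and n N :: nat
  defines "V \<equiv> \<lambda>a. fdet n (\<lambda>i j. x (a j) ^ i)"
  defines "S \<equiv> \<lambda>F. \<Sum>a\<in>tuples n N. (V a)\<^sup>2 * (\<Prod>j<n. w (a j)) * F a"
  assumes x: "inj_on x {..<N}" and w: "\<And>b. b < N \<Longrightarrow> 0 < w b" and "n \<le> N"
    and h: "\<And>b. b < N \<Longrightarrow> \<bar>h b\<bar> \<le> B"
  shows "S (\<lambda>_. 1) * S (\<lambda>a. (\<Sum>j<n. h (a j))\<^sup>2)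
      \<le> (S (\<lambda>a. \<Sum>j<n. h (a j)))\<^sup>2 + real n * B\<^sup>2 * (S (\<lambda>_. 1))\<^sup>2"
    and "0 < S (\<lambda>_. 1)"
proof -
  define ip where "ip = (\<lambda>f g. \<Sum>b<N. w b * (poly f (x b) * poly g (x b)))"
  obtain \<psi> where \<psi>: "\<And>i. i < n \<Longrightarrow> degree (\<psi> i) = i"
    "\<And>i j. i < n \<Longrightarrow> j < n \<Longrightarrow> ip (\<psi> i) (\<psi> j) = (if i = j then 1 else 0)"
    using orthonormal_polys_exist[where w = w, OF x _ \<open>n \<le> N\<close>] w unfolding ip_def by blast
  define c where "c = fdet n (\<lambda>l j. coeff (\<psi> j) l)"
  have Vc: "fdet n (\<lambda>i j. poly (\<psi> i) (x (a j))) = c * V a" for a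
  proof -
    have "fdet n (\<lambda>i j. poly (\<psi> i) (x (a j))) = fdet n (\<lambda>i j. poly (\<psi> j) (x (a i)))"
      by (rule fdet_transpose)
    also have "\<dots> = fdet n (\<lambda>i j. x (a i) ^ j) * c"
      unfolding c_def by (rule fdet_poly_basis) (use \<psi>(1) in auto)
    also have "fdet n (\<lambda>i j. x (a i) ^ j) = V a"
      unfolding V_def by (rule fdet_transpose)
    finally show ?thesis by simp
  qed
  define \<phi> where "\<phi> i b = poly (\<psi> i) (x b)" for i b
  define H where "H i j = (\<Sum>b<N. \<phi> i b * (\<phi> j b * w b * h b))" for i j
  define H2 where "H2 i = (\<Sum>b<N. \<phi> i b * (\<phi> i b * w b * (h b)\<^sup>2))" for i
  have orth: "(\<Sum>b<N. \<phi> i b * (\<phi> j b * w b)) = (if i = j then 1 else 0)" if "i < n" "j < n" for i j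
    using \<psi>(2)[OF that] unfolding ip_def \<phi>_def by (simp add: mult_ac)
  have expand: "c\<^sup>2 * S F = fact n * (\<Sum>a\<in>tuples n N. fdet n (\<lambda>i j. \<phi> i (a j)) * (\<Prod>j<n. \<phi> j (a j) * w (a j)) * F a)"
    if "\<And>a s. s permutes {..<n} \<Longrightarrow> F (a \<circ> s) = F a" for F
  proof -
    have "c\<^sup>2 * S F = (\<Sum>a\<in>tuples n N. fdet n (\<lambda>i j. \<phi> i (a j)) * fdet n (\<lambda>i j. \<phi> i (a j)) * ((\<Prod>j<n. w (a j)) * F a))"
      unfolding S_def \<phi>_def Vc sum_distrib_left by (simp add: power2_eq_square mult_ac)
    also have "\<dots> = fact n * (\<Sum>a\<in>tuples n N. fdet n (\<lambda>i j. \<phi> i (a j)) * (\<Prod>j<n. \<phi> j (a j)) * ((\<Prod>j<n. w (a j)) * F a))"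
    proof (rule sum_tuples_det_det)
      fix a s assume s: "s permutes {..<n}"
      show "(\<Prod>j<n. w ((a \<circ> s) j)) * F (a \<circ> s) = (\<Prod>j<n. w (a j)) * F a"
        using prod.permute[OF s, of "\<lambda>j. w (a j)"] that[OF s] by (simp add: o_def)
    qed
    finally show ?thesis by (simp add: prod.distrib mult_ac)
  qed
  have one: "c\<^sup>2 * S (\<lambda>_. 1) = fact n"
  proof -
    have "c\<^sup>2 * S (\<lambda>_. 1) = fact n * fdet n (\<lambda>i j. \<Sum>b<N. \<phi> i b * (\<phi> j b * w b))"
      using sum_tuples_det_prod[of n \<phi> "\<lambda>j b. \<phi> j b * w b" N] by (subst expand) simp_all
    also have "fdet n (\<lambda>i j. \<Sum>b<N. \<phi> i b * (\<phi> j b * w b)) = fdet n (\<lambda>i j. if i = j then 1 else 0)"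
      by (rule fdet_cong) (rule orth)
    also have "\<dots> = (\<Prod>i<n. 1)" by (subst fdet_lower_triangular) auto
    finally show ?thesis by simp
  qed
  then show pos: "0 < S (\<lambda>_. 1)"
    by (metis fact_gt_zero zero_less_mult_iff zero_le_power2 not_less)
  have sym1: "(\<Sum>j<n. h ((a \<circ> s) j)) = (\<Sum>j<n. h (a j))" if s: "s permutes {..<n}" for a s
    using sum.permute[OF s, of "\<lambda>j. h (a j)"] by (simp add: o_def)
  have first: "c\<^sup>2 * S (\<lambda>a. \<Sum>j<n. h (a j)) = fact n * (\<Sum>p<n. H p p)"
  proof -
    have "c\<^sup>2 * S (\<lambda>a. \<Sum>j<n. h (a j)) = fact n * (\<Sum>a\<in>tuples n N. fdet n (\<lambda>i j. \<phi> i (a j)) *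
        (\<Prod>j<n. \<phi> j (a j) * w (a j)) * (\<Sum>p<n. \<Prod>j<n. if j = p then h (a j) else 1))"
      by (subst expand) (simp_all only: sym1, simp)
    also have "\<dots> = fact n * (\<Sum>p<n. \<Sum>a\<in>tuples n N. fdet n (\<lambda>i j. \<phi> i (a j)) *
        (\<Prod>j<n. \<phi> j (a j) * w (a j) * (if j = p then h (a j) else 1)))"
      unfolding sum_distrib_left by (subst sum.swap) (simp add: prod.distrib mult.assoc)
    also have "\<dots> = fact n * (\<Sum>p<n. fdet n (\<lambda>i j. \<Sum>b<N. \<phi> i b * (\<phi> j b * w b * (if j = p then h b else 1))))"
      by (subst sum_tuples_det_prod) rule
    also have "\<dots> = fact n * (\<Sum>p<n. H p p)"
      by (intro arg_cong2[where f = "(*)"] sum.cong refl, subst fdet_identity_but_one)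
        (auto simp: orth H_def)
    finally show ?thesis .
  qed
  have second: "c\<^sup>2 * S (\<lambda>a. (\<Sum>j<n. h (a j))\<^sup>2)
      = fact n * (\<Sum>p<n. \<Sum>q<n. if p = q then H2 p else H p p * H q q - H p q * H q p)"
  proof -
    have "c\<^sup>2 * S (\<lambda>a. (\<Sum>j<n. h (a j))\<^sup>2) = fact n * (\<Sum>a\<in>tuples n N. fdet n (\<lambda>i j. \<phi> i (a j)) *
        (\<Prod>j<n. \<phi> j (a j) * w (a j)) * (\<Sum>p<n. \<Sum>q<n. (\<Prod>j<n. if j = p then h (a j) else 1) * (\<Prod>j<n. if j = q then h (a j) else 1)))"
      by (subst expand) (simp_all only: sym1, simp add: power2_eq_square sum_product)
    also have "\<dots> = fact n * (\<Sum>p<n. \<Sum>q<n. \<Sum>a\<in>tuples n N. fdet n (\<lambda>i j. \<phi> i (a j)) *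
        (\<Prod>j<n. \<phi> j (a j) * w (a j) * ((if j = p then h (a j) else 1) * (if j = q then h (a j) else 1))))"
      unfolding sum_distrib_left
      by (subst sum.swap, rule sum.cong[OF refl], subst sum.swap) (simp add: prod.distrib mult.assoc)
    also have "\<dots> = fact n * (\<Sum>p<n. \<Sum>q<n. fdet n (\<lambda>i j. \<Sum>b<N. \<phi> i b *
        (\<phi> j b * w b * ((if j = p then h b else 1) * (if j = q then h b else 1)))))"
      by (subst sum_tuples_det_prod) rule
    also have "\<dots> = fact n * (\<Sum>p<n. \<Sum>q<n. if p = q then H2 p else H p p * H q q - H p q * H q p)"
    proof (intro arg_cong2[where f = "(*)"] sum.cong refl)
      fix p q assume "p \<in> {..<n}" "q \<in> {..<n}"
      then show "fdet n (\<lambda>i j. \<Sum>b<N. \<phi> i b *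
          (\<phi> j b * w b * ((if j = p then h b else 1) * (if j = q then h b else 1))))
        = (if p = q then H2 p else H p p * H q q - H p q * H q p)"
        by (cases "p = q")
          (subst fdet_identity_but_one[of p] fdet_identity_but_two[of p _ q],
            auto simp: orth H_def H2_def power2_eq_square)+
    qed
    finally show ?thesis .
  qed
  have Hsym: "H p q = H q p" for p q unfolding H_def by (simp add: mult_ac)
  have H2: "H2 p \<le> B\<^sup>2" if "p < n" for p
  proof -
    have "H2 p \<le> (\<Sum>b<N. \<phi> p b * (\<phi> p b * w b) * B\<^sup>2)"
      unfolding H2_def
    proof (rule sum_mono)
      fix b assume "b \<in> {..<N}"
      then have "(h b)\<^sup>2 \<le> B\<^sup>2" "0 \<le> w b" using h[of b] w[of b] by (auto simp: abs_le_square_iff[symmetric])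
      then have "(\<phi> p b)\<^sup>2 * w b * (h b)\<^sup>2 \<le> (\<phi> p b)\<^sup>2 * w b * B\<^sup>2" by (intro mult_left_mono) auto
      then show "\<phi> p b * (\<phi> p b * w b * (h b)\<^sup>2) \<le> \<phi> p b * (\<phi> p b * w b) * B\<^sup>2"
        by (simp add: power2_eq_square mult_ac)
    qed
    also have "\<dots> = B\<^sup>2" using orth[OF that that] by (simp flip: sum_distrib_right)
    finally show ?thesis .
  qed
  have "(\<Sum>p<n. \<Sum>q<n. if p = q then H2 p else H p p * H q q - H p q * H q p)
     \<le> (\<Sum>p<n. \<Sum>q<n. (if p = q then B\<^sup>2 else 0) + H p p * H q q)"
  proof (intro sum_mono)
    fix p q assume p: "p \<in> {..<n}"
    show "(if p = q then H2 p else H p p * H q q - H p q * H q p) \<le> (if p = q then B\<^sup>2 else 0) + H p p * H q q"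
      using H2[of p] p Hsym[of q p] by (auto intro: add_increasing2)
  qed
  also have "\<dots> = real n * B\<^sup>2 + (\<Sum>p<n. H p p)\<^sup>2"
    by (simp add: sum.distrib power2_eq_square sum_product)
  finally have *: "(\<Sum>p<n. \<Sum>q<n. if p = q then H2 p else H p p * H q q - H p q * H q p)
     \<le> real n * B\<^sup>2 + (\<Sum>p<n. H p p)\<^sup>2" .
  have "(c\<^sup>2 * S (\<lambda>_. 1)) * (c\<^sup>2 * S (\<lambda>a. (\<Sum>j<n. h (a j))\<^sup>2))
      \<le> (fact n)\<^sup>2 * (real n * B\<^sup>2 + (\<Sum>p<n. H p p)\<^sup>2)"
    unfolding one second using * by (simp add: power2_eq_square mult_left_mono)
  also have "\<dots> = real n * B\<^sup>2 * (c\<^sup>2 * S (\<lambda>_. 1))\<^sup>2 + (c\<^sup>2 * S (\<lambda>a. \<Sum>j<n. h (a j)))\<^sup>2"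
    unfolding one first by (simp add: power2_eq_square algebra_simps)
  finally have "c^4 * (S (\<lambda>_. 1) * S (\<lambda>a. (\<Sum>j<n. h (a j))\<^sup>2))
      \<le> c^4 * ((S (\<lambda>a. \<Sum>j<n. h (a j)))\<^sup>2 + real n * B\<^sup>2 * (S (\<lambda>_. 1))\<^sup>2)"
    by (simp add: power2_eq_square power4_eq_xxxx algebra_simps)
  moreover have "0 < c^4" using one by (cases "c = 0") auto
  ultimately show "S (\<lambda>_. 1) * S (\<lambda>a. (\<Sum>j<n. h (a j))\<^sup>2)
      \<le> (S (\<lambda>a. \<Sum>j<n. h (a j)))\<^sup>2 + real n * B\<^sup>2 * (S (\<lambda>_. 1))\<^sup>2"
    by (simp only: mult_le_cancel_left_pos)
qed

section \<open>Exact means of power sums at geometric nodes\<close>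

text \<open>
  Moving one point of a Vandermonde product. Both sides are multiplied out, so that coinciding
  points are covered and the induction involves no division.
\<close>

lemma vandermonde_update:
  fixes y :: "nat \<Rightarrow> real"
  assumes "i0 < n"
  shows "(\<Prod>i<n. \<Prod>l<i. (y(i0 := z)) i - (y(i0 := z)) l) * (\<Prod>j\<in>{..<n} - {i0}. y i0 - y j)
    = (\<Prod>i<n. \<Prod>l<i. y i - y l) * (\<Prod>j\<in>{..<n} - {i0}. z - y j)"
  using assms
proof (induction n)
  case 0
  then show ?case by simp
next
  case (Suc n)
  show ?case
  proof (cases "i0 = n")
    case True
    then have "{..<Suc n} - {i0} = {..<n}" by auto
    moreover have "(\<Prod>i<n. \<Prod>l<i. (y(i0 := z)) i - (y(i0 := z)) l) = (\<Prod>i<n. \<Prod>l<i. y i - y l)"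
      using True by (intro prod.cong) auto
    moreover have "(\<Prod>l<n. (y(i0 := z)) n - (y(i0 := z)) l) = (\<Prod>l<n. z - y l)"
      using True by (intro prod.cong) auto
    ultimately show ?thesis using True by simp
  next
    case False
    with Suc.prems have i0: "i0 < n" by simp
    have set: "{..<Suc n} - {i0} = insert n ({..<n} - {i0})" using i0 by auto
    have split: "(\<Prod>l<n. g l) = g i0 * (\<Prod>l\<in>{..<n} - {i0}. g l)" for g :: "nat \<Rightarrow> real"
      using i0 by (subst prod.remove[of _ i0]) auto
    have e1: "(\<Prod>l<n. (y(i0 := z)) n - (y(i0 := z)) l) = (y n - z) * (\<Prod>l\<in>{..<n} - {i0}. y n - y l)"
      using False by (subst split) auto
    have e2: "(\<Prod>l<n. y n - y l) = (y n - y i0) * (\<Prod>l\<in>{..<n} - {i0}. y n - y l)"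
      by (subst split) auto
    have key: "P' * ((y n - z) * R) * ((y i0 - y n) * D0) = P * ((y n - y i0) * R) * ((z - y n) * Dz)"
      if "P' * D0 = P * Dz" for P' P R D0 Dz :: real
    proof -
      have "P' * ((y n - z) * R) * ((y i0 - y n) * D0) = (P' * D0) * ((y n - z) * (y i0 - y n) * R)" by simp
      also have "\<dots> = P * ((y n - y i0) * R) * ((z - y n) * Dz)" unfolding that by (simp add: algebra_simps)
      finally show ?thesis .
    qed
    have ins: "(\<Prod>j\<in>insert n ({..<n} - {i0}). g j) = g n * (\<Prod>j\<in>{..<n} - {i0}. g j)" for g :: "nat \<Rightarrow> real"
      by (subst prod.insert) auto
    show ?thesis
      unfolding set prod.lessThan_Suc e1 e2 ins by (rule key[OF Suc.IH[OF i0]])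
  qed
qed

text \<open>
  At the nodes \<open>q ^ b\<close> an entry \<open>(q ^ a j) ^ i\<close> of the Vandermonde matrix is also \<open>(q ^ i) ^ a j\<close>, the
  value at \<open>y i = q ^ i\<close> of the generalised Vandermonde matrix \<open>y i ^ a j\<close>. If the generating function
  of the weight at \<open>y * q ^ j\<close> is \<open>\<Omega> y\<close> times a polynomial of degree below \<open>n\<close>, then Andreief's
  identity evaluates the weighted sum of \<open>det (y i ^ a j)\<close> against the Vandermonde determinant, for
  arbitrary \<open>y\<close>, as a constant times \<open>\<Prod>i. \<Omega> (y i)\<close> times the Vandermonde product of \<open>y\<close>. By
  \<open>sum_times_det\<close>, multiplication by \<open>\<Sum>j. r ^ a j\<close> replaces one \<open>q ^ i\<close> at a time by \<open>r * q ^ i\<close>, and the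
  ratios of the two evaluations are the summands on the right.
\<close>

lemma power_sum_moment:
  fixes q r :: real and n N :: nat and w :: "nat \<Rightarrow> real" and \<Omega> :: "real \<Rightarrow> real" and p :: "nat \<Rightarrow> real poly"
  defines "V \<equiv> \<lambda>a. fdet n (\<lambda>i j. (q ^ a j) ^ i)"
  defines "S \<equiv> \<lambda>F. \<Sum>a\<in>tuples n N. (V a)\<^sup>2 * (\<Prod>j<n. w (a j)) * F a"
  assumes W: "\<And>j y. j < n \<Longrightarrow> (\<Sum>b<N. w b * (y * q ^ j) ^ b) = \<Omega> y * poly (p j) y"
    and p: "\<And>j. j < n \<Longrightarrow> degree (p j) < n"
    and q: "inj_on (\<lambda>i. q ^ i) {..<n}"
    and \<Omega>: "\<And>i. i < n \<Longrightarrow> \<Omega> (q ^ i) \<noteq> 0"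
  shows "S (\<lambda>a. \<Sum>j<n. r ^ a j) = S (\<lambda>_. 1) *
    (\<Sum>i<n. \<Omega> (r * q ^ i) / \<Omega> (q ^ i) * (\<Prod>j\<in>{..<n} - {i}. (r * q ^ i - q ^ j) / (q ^ i - q ^ j)))"
proof -
  define C where "C = fact n * fdet n (\<lambda>l j. coeff (p j) l)"
  have V_alt: "V a = fdet n (\<lambda>i j. (q ^ i) ^ a j)" for a
    unfolding V_def by (rule fdet_cong) (simp flip: power_mult add: mult.commute)
  have general: "(\<Sum>a\<in>tuples n N. fdet n (\<lambda>i j. y i ^ a j) * V a * (\<Prod>j<n. w (a j)))
      = C * ((\<Prod>i<n. \<Omega> (y i)) * (\<Prod>i<n. \<Prod>l<i. y i - y l))" for y
  proof -
    have "(\<Sum>a\<in>tuples n N. fdet n (\<lambda>i j. y i ^ a j) * V a * (\<Prod>j<n. w (a j)))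
       = fact n * fdet n (\<lambda>i j. \<Sum>b<N. y i ^ b * ((q ^ j) ^ b * w b))"
      unfolding V_alt by (rule andreief)
    also have "fdet n (\<lambda>i j. \<Sum>b<N. y i ^ b * ((q ^ j) ^ b * w b)) = fdet n (\<lambda>i j. \<Omega> (y i) * poly (p j) (y i))"
      by (rule fdet_cong) (simp flip: W add: power_mult_distrib mult_ac)
    also have "\<dots> = (\<Prod>i<n. \<Omega> (y i)) * fdet n (\<lambda>i j. poly (p j) (y i))" by (rule fdet_rows)
    also have "fdet n (\<lambda>i j. poly (p j) (y i)) = fdet n (\<lambda>i j. y i ^ j) * fdet n (\<lambda>l j. coeff (p j) l)"
      by (rule fdet_poly_basis) (rule p)
    also have "fdet n (\<lambda>i j. y i ^ j) = (\<Prod>i<n. \<Prod>l<i. y i - y l)" by (rule vandermonde_det)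
    finally show ?thesis by (simp add: C_def mult_ac)
  qed
  define y where "y i = q ^ i" for i :: nat
  have S1: "S (\<lambda>_. 1) = C * ((\<Prod>i<n. \<Omega> (y i)) * (\<Prod>i<n. \<Prod>l<i. y i - y l))"
    unfolding general[symmetric] S_def y_def by (simp add: V_alt power2_eq_square)
  have "S (\<lambda>a. \<Sum>j<n. r ^ a j) = (\<Sum>a\<in>tuples n N. ((\<Sum>j<n. r ^ a j) * V a) * V a * (\<Prod>j<n. w (a j)))"
    unfolding S_def by (simp add: power2_eq_square mult_ac)
  also have "\<dots> = (\<Sum>a\<in>tuples n N. (\<Sum>i0<n. fdet n (\<lambda>i j. (y(i0 := r * q ^ i0)) i ^ a j)) * V a * (\<Prod>j<n. w (a j)))"
  proof (intro sum.cong refl arg_cong2[where f = "(*)"])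
    fix a
    have "(\<Sum>j<n. r ^ a j) * V a = (\<Sum>i0<n. fdet n (\<lambda>i j. (if i = i0 then r ^ a j else 1) * (q ^ i) ^ a j))"
      unfolding V_alt by (rule sum_times_det[where h = "\<lambda>b. r ^ b" and \<phi> = "\<lambda>i b. (q ^ i) ^ b"])
    also have "\<dots> = (\<Sum>i0<n. fdet n (\<lambda>i j. (y(i0 := r * q ^ i0)) i ^ a j))"
      by (intro sum.cong refl fdet_cong) (auto simp: y_def power_mult_distrib)
    finally show "(\<Sum>j<n. r ^ a j) * V a = (\<Sum>i0<n. fdet n (\<lambda>i j. (y(i0 := r * q ^ i0)) i ^ a j))" .
  qed
  also have "\<dots> = (\<Sum>i0<n. \<Sum>a\<in>tuples n N. fdet n (\<lambda>i j. (y(i0 := r * q ^ i0)) i ^ a j) * V a * (\<Prod>j<n. w (a j)))"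
    unfolding sum_distrib_right by (rule sum.swap)
  also have "\<dots> = (\<Sum>i0<n. S (\<lambda>_. 1) * (\<Omega> (r * q ^ i0) / \<Omega> (q ^ i0) * (\<Prod>j\<in>{..<n} - {i0}. (r * q ^ i0 - q ^ j) / (q ^ i0 - q ^ j))))"
  proof (rule sum.cong[OF refl])
    fix i0 assume "i0 \<in> {..<n}"
    then have i0: "i0 < n" by simp
    have nz: "(\<Prod>j\<in>{..<n} - {i0}. y i0 - y j) \<noteq> 0"
      using q i0 by (auto simp: y_def inj_on_def)
    let ?y = "y(i0 := r * q ^ i0)"
    have vdm: "(\<Prod>i<n. \<Prod>l<i. ?y i - ?y l) = (\<Prod>i<n. \<Prod>l<i. y i - y l) *
        (\<Prod>j\<in>{..<n} - {i0}. (r * q ^ i0 - q ^ j) / (q ^ i0 - q ^ j))"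
      using vandermonde_update[OF i0, of y "r * q ^ i0"] nz
      by (simp only: prod_dividef y_def) (simp add: field_simps)
    have "(\<Prod>i<n. \<Omega> (?y i)) = \<Omega> (r * q ^ i0) * (\<Prod>i\<in>{..<n} - {i0}. \<Omega> (y i))"
      using i0 by (subst prod.remove[of _ i0]) auto
    moreover have "(\<Prod>i<n. \<Omega> (y i)) = \<Omega> (q ^ i0) * (\<Prod>i\<in>{..<n} - {i0}. \<Omega> (y i))"
      using i0 by (subst prod.remove[of _ i0]) (auto simp: y_def)
    ultimately show "(\<Sum>a\<in>tuples n N. fdet n (\<lambda>i j. ?y i ^ a j) * V a * (\<Prod>j<n. w (a j)))
      = S (\<lambda>_. 1) * (\<Omega> (r * q ^ i0) / \<Omega> (q ^ i0) * (\<Prod>j\<in>{..<n} - {i0}. (r * q ^ i0 - q ^ j) / (q ^ i0 - q ^ j)))"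
      unfolding general S1 vdm using \<Omega>[OF i0] by (simp add: field_simps)
  qed
  finally show ?thesis by (simp add: sum_distrib_left)
qed

section \<open>Diagrams as sets of positions\<close>

text \<open>
  The numbers \<open>\<lambda>\<^sub>i + n - i\<close> of the diagram, in decreasing order; restricted to \<open>{..<n}\<close> so that the
  function is one of the tuples.
\<close>

definition row_positions :: "nat \<Rightarrow> nat list \<Rightarrow> nat \<Rightarrow> nat" where
  "row_positions n l = (\<lambda>j\<in>{..<n}. l ! j + (n - Suc j))"

lemma diagrams_nth:
  assumes "l \<in> diagrams n k"
  shows "length l = n" "\<And>i. i < n \<Longrightarrow> l ! i \<le> k" "\<And>i j. i \<le> j \<Longrightarrow> j < n \<Longrightarrow> l ! j \<le> l ! i"
proof -
  show len: "length l = n" and "\<And>i. i < n \<Longrightarrow> l ! i \<le> k" using assms by (auto simp: diagrams_def)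
  show "l ! j \<le> l ! i" if "i \<le> j" "j < n" for i j
    using that assms len by (cases "i = j") (auto simp: diagrams_def sorted_wrt_iff_nth_less)
qed

lemma finite_diagrams: "finite (diagrams n k)"
proof (rule finite_subset)
  show "diagrams n k \<subseteq> {l. set l \<subseteq> {..k} \<and> length l = n}" by (auto simp: diagrams_def)
qed (rule finite_lists_length_eq, simp)

lemma row_positions_less:
  assumes "l \<in> diagrams n k" "i < j" "j < n"
  shows "row_positions n l j < row_positions n l i"
  using diagrams_nth(3)[OF assms(1), of i j] assms by (auto simp: row_positions_def)

lemma row_positions_tuple:
  assumes "l \<in> diagrams n k"
  shows "row_positions n l \<in> tuples n (n + k)"
proof -
  have "l ! j + (n - Suc j) < n + k" if "j < n" for j using diagrams_nth(2)[OF assms that] that by linarith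
  then show ?thesis by (auto simp: row_positions_def)
qed

lemma row_positions_inj: "l \<in> diagrams n k \<Longrightarrow> inj_on (row_positions n l) {..<n}"
  using row_positions_less[of l n k] by (intro inj_onI) (metis lessThan_iff less_irrefl linorder_neqE_nat)

lemma row_positions_determine:
  assumes "l \<in> diagrams n k" "l' \<in> diagrams n k"
    "row_positions n l ` {..<n} = row_positions n l' ` {..<n}"
  shows "l = l'"
proof -
  have srt: "sorted_wrt (<) (rev (map (row_positions n m) [0..<n]))" if "m \<in> diagrams n k" for m
    using row_positions_less[OF that] unfolding sorted_wrt_rev by (auto simp: sorted_wrt_iff_nth_less)
  have "rev (map (row_positions n l) [0..<n]) = rev (map (row_positions n l') [0..<n])"
    by (rule strict_sorted_equal[OF srt[OF assms(2)] srt[OF assms(1)]])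
      (use assms(3) in \<open>simp add: atLeast0LessThan\<close>)
  then have eq: "row_positions n l j = row_positions n l' j" if "j < n" for j
    using that by auto
  have "l ! j = l' ! j" if "j < n" for j using eq[OF that] that by (simp add: row_positions_def)
  then show ?thesis
    using diagrams_nth(1)[OF assms(1)] diagrams_nth(1)[OF assms(2)] by (auto simp: list_eq_iff_nth_eq)
qed

text \<open>
  Sort the tuple decreasingly and subtract the staircase \<open>n - 1, \<dots>, 0\<close>.
\<close>

lemma row_positions_exist:
  assumes a: "a \<in> tuples n (n + k)" and inj: "inj_on a {..<n}"
  shows "\<exists>l\<in>diagrams n k. row_positions n l ` {..<n} = a ` {..<n}"
proof -
  define xs where "xs = rev (sorted_list_of_set (a ` {..<n}))"
  have len: "length xs = n" using inj by (simp add: xs_def card_image)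
  have set: "set xs = a ` {..<n}" by (simp add: xs_def)
  have dec: "xs ! j < xs ! i" if "i < j" "j < n" for i j
  proof -
    have "sorted_wrt (>) xs" unfolding xs_def sorted_wrt_rev by simp
    then show ?thesis using that len by (simp add: sorted_wrt_iff_nth_less)
  qed
  have gap: "xs ! j + d \<le> xs ! i" if "j = i + d" "j < n" for i j d
    using that
  proof (induction d arbitrary: j)
    case (Suc d)
    then have "xs ! (i + d) + d \<le> xs ! i" by simp
    moreover have "xs ! j < xs ! (i + d)" using Suc.prems by (intro dec) auto
    ultimately show ?case by simp
  qed simp
  have lo: "n - Suc j \<le> xs ! j" if "j < n" for j
    using gap[of "n - 1" j "n - Suc j"] that by simp
  have hi: "xs ! j + j < n + k" if "j < n" for j
  proof -
    have "xs ! 0 < n + k" using len set a that nth_mem[of 0 xs] by fastforce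
    then show ?thesis using gap[of j 0 j] that by simp
  qed
  define l where "l = map (\<lambda>j. xs ! j - (n - Suc j)) [0..<n]"
  have "l \<in> diagrams n k"
    unfolding diagrams_def sorted_wrt_iff_nth_less
  proof (intro CollectI conjI allI impI ballI)
    show "length l = n" by (simp add: l_def)
    show "l ! j \<le> l ! i" if "i < j" "j < length l" for i j
      using gap[of j i "j - i"] lo[of j] that by (simp add: l_def)
    fix p assume "p \<in> set l"
    then obtain j where "j < n" "p = xs ! j - (n - Suc j)" by (auto simp: l_def)
    then show "p \<le> k" using hi[of j] by linarith
  qed
  moreover have "row_positions n l j = xs ! j" if "j < n" for j
    using lo[OF that] that by (simp add: row_positions_def l_def)
  then have "row_positions n l ` {..<n} = a ` {..<n}"
    using set len by (auto simp: set_conv_nth)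
  ultimately show ?thesis by blast
qed

text \<open>
  An injective tuple lists the positions of exactly one diagram in exactly one order.
\<close>

lemma bij_betw_diagrams_perms:
  "bij_betw (\<lambda>(l, s). row_positions n l \<circ> s) (diagrams n k \<times> {s. s permutes {..<n}})
     {a \<in> tuples n (n + k). inj_on a {..<n}}"
  unfolding bij_betw_def
proof
  have img: "(row_positions n l \<circ> s) ` {..<n} = row_positions n l ` {..<n}" if "s permutes {..<n}" for l s
    using permutes_image[OF that] by (metis image_comp)
  show "inj_on (\<lambda>(l, s). row_positions n l \<circ> s) (diagrams n k \<times> {s. s permutes {..<n}})"
  proof (rule inj_onI, clarsimp)
    fix l s l' s'
    assume l: "l \<in> diagrams n k" "l' \<in> diagrams n k" and s: "s permutes {..<n}" "s' permutes {..<n}"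
      and eq: "row_positions n l \<circ> s = row_positions n l' \<circ> s'"
    then have ll: "l = l'" by (metis img row_positions_determine)
    have "s j = s' j" for j
    proof (cases "j < n")
      case True
      then have "s j \<in> {..<n}" "s' j \<in> {..<n}" using permutes_in_image[OF s(1)] permutes_in_image[OF s(2)] by auto
      moreover have "row_positions n l (s j) = row_positions n l (s' j)" using eq ll by (metis comp_apply)
      ultimately show ?thesis using row_positions_inj[OF l(1)] by (auto dest: inj_onD)
    qed (use permutes_not_in[OF s(1)] permutes_not_in[OF s(2)] in auto)
    then show "l = l' \<and> s = s'" using ll by auto
  qed
  show "(\<lambda>(l, s). row_positions n l \<circ> s) ` (diagrams n k \<times> {s. s permutes {..<n}})
     = {a \<in> tuples n (n + k). inj_on a {..<n}}" (is "?L = ?R")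
  proof
    show "?L \<subseteq> ?R"
    proof (clarsimp, intro conjI)
      fix l s assume l: "l \<in> diagrams n k" and s: "s permutes {..<n}"
      show "row_positions n l \<circ> s \<in> tuples n (n + k)"
        using bij_betwE[OF tuples_permute[OF s]] row_positions_tuple[OF l] by blast
      show "inj_on (row_positions n l \<circ> s) {..<n}"
        using s row_positions_inj[OF l] by (intro comp_inj_on) (auto simp: permutes_image permutes_inj_on)
    qed
    show "?R \<subseteq> ?L"
    proof
      fix a assume "a \<in> ?R"
      then have a: "a \<in> tuples n (n + k)" "inj_on a {..<n}" by auto
      then obtain l where l: "l \<in> diagrams n k" "row_positions n l ` {..<n} = a ` {..<n}"
        using row_positions_exist by blast
      define s where "s j = (if j < n then the_inv_into {..<n} (row_positions n l) (a j) else j)" for j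
      note inj = row_positions_inj[OF l(1)]
      have sn: "s j < n" "row_positions n l (s j) = a j" if "j < n" for j
      proof -
        have "a j \<in> row_positions n l ` {..<n}" using l(2) that by auto
        then show "s j < n" "row_positions n l (s j) = a j"
          using the_inv_into_into[OF inj, of "a j" "{..<n}"] f_the_inv_into_f[OF inj, of "a j"] that
          by (auto simp: s_def)
      qed
      have "inj_on s {..<n}"
        using a(2) sn by (intro inj_onI) (metis inj_onD lessThan_iff)
      then have "bij_betw s {..<n} {..<n}"
        using sn(1) by (simp add: bij_betw_def) (intro card_subset_eq, auto simp: card_image)
      then have s: "s permutes {..<n}" by (rule bij_imp_permutes) (simp add: s_def)
      have "a = row_positions n l \<circ> s"
      proof
        fix j show "a j = (row_positions n l \<circ> s) j"
        proof (cases "j < n")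
          case False
          then have "a j = undefined" using a(1) by (auto simp: PiE_iff extensional_def)
          then show ?thesis using False by (simp add: s_def row_positions_def)
        next
          case True
          show ?thesis using sn(2)[OF True] by simp
        qed
      qed
      then show "a \<in> ?L" using l(1) s by (intro image_eqI[of _ _ "(l, s)"]) auto
    qed
  qed
qed

text \<open>
  This passes between the tuples, where determinantal identities hold, and the diagrams, where the
  probability lives.
\<close>

lemma sum_tuples_diagrams:
  assumes "\<And>a s. s permutes {..<n} \<Longrightarrow> F (a \<circ> s) = F a"
    and "\<And>a. \<not> inj_on a {..<n} \<Longrightarrow> F a = (0 :: real)"
  shows "(\<Sum>a\<in>tuples n (n + k). F a) = fact n * (\<Sum>l\<in>diagrams n k. F (row_positions n l))"
proof -
  have "(\<Sum>a\<in>tuples n (n + k). F a) = (\<Sum>a\<in>{a \<in> tuples n (n + k). inj_on a {..<n}}. F a)"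
    using assms(2) by (intro sum.mono_neutral_right) (auto intro: finite_PiE)
  also have "\<dots> = (\<Sum>(l, s)\<in>diagrams n k \<times> {s. s permutes {..<n}}. F (row_positions n l \<circ> s))"
    using sum.reindex_bij_betw[OF bij_betw_diagrams_perms, of F, symmetric] by (simp add: case_prod_unfold)
  also have "\<dots> = (\<Sum>l\<in>diagrams n k. \<Sum>s\<in>{s. s permutes {..<n}}. F (row_positions n l \<circ> s))"
    by (rule sum.cartesian_product[symmetric])
  also have "\<dots> = fact n * (\<Sum>l\<in>diagrams n k. F (row_positions n l))"
    by (simp add: assms(1) card_permutations sum_distrib_left)
  finally show ?thesis .
qed

lemma conjugate_complement_nth:
  assumes "l \<in> diagrams n k" "j < k"
  shows "conjugate_diagram k (complement_diagram k l) ! j = card {i. i < n \<and> l ! i < k - j}"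
proof -
  have len: "length l = n" by (rule diagrams_nth(1)[OF assms(1)])
  have "conjugate_diagram k (complement_diagram k l) ! j = card {i. i < n \<and> j < k - l ! (n - Suc i)}"
  proof -
    have "{i. i < n \<and> j < map (\<lambda>p. k - p) (rev l) ! i} = {i. i < n \<and> j < k - l ! (n - Suc i)}"
      using len by (auto simp: rev_nth)
    then show ?thesis using assms(2) len by (simp add: conjugate_diagram_def complement_diagram_def)
  qed
  also have "\<dots> = card {i. i < n \<and> l ! i < k - j}"
  proof (rule bij_betw_same_card[of "\<lambda>i. n - Suc i"], rule bij_betw_byWitness[where f' = "\<lambda>i. n - Suc i"])
    have eq: "j < k - m \<longleftrightarrow> m < k - j" for m by arith
    show "(\<lambda>i. n - Suc i) ` {i. i < n \<and> j < k - l ! (n - Suc i)} \<subseteq> {i. i < n \<and> l ! i < k - j}"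
      unfolding eq by auto
    show "(\<lambda>i. n - Suc i) ` {i. i < n \<and> l ! i < k - j} \<subseteq> {i. i < n \<and> j < k - l ! (n - Suc i)}"
      unfolding eq by (auto simp: Suc_diff_Suc)
  qed auto
  finally show ?thesis .
qed

lemma conjugate_complement_diagram:
  assumes "l \<in> diagrams n k"
  shows "conjugate_diagram k (complement_diagram k l) \<in> diagrams k n"
  unfolding diagrams_def sorted_wrt_iff_nth_less
proof (intro CollectI conjI allI impI ballI)
  let ?m = "conjugate_diagram k (complement_diagram k l)"
  show len: "length ?m = k" by (simp add: conjugate_diagram_def)
  show "?m ! j \<le> ?m ! i" if "i < j" "j < length ?m" for i j
    using that unfolding len
    by (simp add: conjugate_complement_nth[OF assms]) (intro card_mono, auto)
  fix p assume "p \<in> set ?m"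
  then obtain j where "j < k" "p = ?m ! j" using len by (auto simp: in_set_conv_nth)
  moreover have "card {i. i < n \<and> l ! i < k - j} \<le> card {..<n}" by (intro card_mono) auto
  ultimately show "p \<le> n" by (simp add: conjugate_complement_nth[OF assms])
qed

text \<open>
  The boundary of a diagram is a lattice path of \<open>n + k\<close> steps. Its steps in one direction are the
  positions of the diagram, those in the other direction the positions of the conjugate complement.
  In the proof a common position would make the number \<open>card ?S\<close> of rows shorter than \<open>k - j\<close> too
  large or too small; the two disjoint sets then fill \<open>{..<n + k}\<close> by their sizes.
\<close>

lemma conjugate_complement_positions:
  assumes l: "l \<in> diagrams n k"
  shows "row_positions k (conjugate_diagram k (complement_diagram k l)) ` {..<k}
    = {..<n + k} - row_positions n l ` {..<n}"
proof (rule card_subset_eq)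
  let ?m = "conjugate_diagram k (complement_diagram k l)"
  note m = conjugate_complement_diagram[OF l]
  show "row_positions k ?m ` {..<k} \<subseteq> {..<n + k} - row_positions n l ` {..<n}"
  proof
    fix b assume "b \<in> row_positions k ?m ` {..<k}"
    then obtain j where j: "j < k" "b = row_positions k ?m j" by auto
    have "b < n + k" using row_positions_tuple[OF m] j by (auto simp: add.commute)
    moreover have "b \<noteq> row_positions n l i" if i: "i < n" for i
    proof
      let ?S = "{i. i < n \<and> l ! i < k - j}"
      assume "b = row_positions n l i"
      then have eq: "card ?S + (k - Suc j) = l ! i + (n - Suc i)"
        using j i by (simp add: row_positions_def conjugate_complement_nth[OF l])
      show False
      proof (cases "l ! i < k - j")
        case True
        then have "l ! i' < k - j" if "i \<le> i'" "i' < n" for i'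
          using diagrams_nth(3)[OF l that] by simp
        then have "{i..<n} \<subseteq> ?S" by auto
        then have "card {i..<n} \<le> card ?S" by (intro card_mono) auto
        then show False using True eq i j by simp
      next
        case False
        then have "\<not> l ! i' < k - j" if "i' \<le> i" for i'
          using diagrams_nth(3)[OF l that i] by simp
        then have "?S \<subseteq> {Suc i..<n}" by (auto simp: Suc_le_eq linorder_not_le[symmetric])
        then have "card ?S \<le> card {Suc i..<n}" by (intro card_mono) auto
        then show False using False eq i j by simp
      qed
    qed
    ultimately show "b \<in> {..<n + k} - row_positions n l ` {..<n}" by auto
  qed
  have "row_positions n l ` {..<n} \<subseteq> {..<n + k}" using row_positions_tuple[OF l] by auto
  then show "card (row_positions k ?m ` {..<k}) = card ({..<n + k} - row_positions n l ` {..<n})"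
    by (simp add: card_Diff_subset card_image[OF row_positions_inj[OF l]] card_image[OF row_positions_inj[OF m]])
qed simp

section \<open>The two measures as orthogonal polynomial ensembles\<close>

text \<open>
  At a geometric progression the bialternants are themselves Vandermonde determinants, in the nodes
  \<open>t ^ a\<close>. The factors of numerator and denominator agree in sign, because both position sequences
  decrease; absolute values make the numerator a function of the set of positions.
\<close>

lemma schur_geometric:
  fixes t :: real
  assumes l: "l \<in> diagrams n k" and t: "0 < t" "t \<noteq> 1"
  shows "schur l (\<lambda>i. t ^ i) = (\<Prod>i<n. \<Prod>h<i. \<bar>t ^ row_positions n l i - t ^ row_positions n l h\<bar>)
     / (\<Prod>i<n. \<Prod>h<i. \<bar>t ^ (n - Suc i) - t ^ (n - Suc h)\<bar>)"
proof -
  have sgn: "sgn (t ^ a - t ^ b) = (if t < 1 then 1 else -1)" if "a < b" for a b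
    using that t power_strict_decreasing[of a b t] power_strict_increasing[of a b t]
    by (cases "t < 1") simp_all
  have "schur l (\<lambda>i. t ^ i) = fdet n (\<lambda>i j. (t ^ row_positions n l j) ^ i) / fdet n (\<lambda>i j. (t ^ (n - Suc j)) ^ i)"
    unfolding schur_def Let_def diagrams_nth(1)[OF l]
    by (intro arg_cong2[where f = "(/)"] fdet_cong) (auto simp: row_positions_def simp flip: power_mult intro: arg_cong2[where f = power])
  also have "\<dots> = (\<Prod>i<n. \<Prod>h<i. t ^ row_positions n l i - t ^ row_positions n l h)
      / (\<Prod>i<n. \<Prod>h<i. t ^ (n - Suc i) - t ^ (n - Suc h))"
    by (subst (1 2) fdet_transpose) (simp add: vandermonde_det)
  also have "\<dots> = (\<Prod>i<n. \<Prod>h<i. \<bar>t ^ row_positions n l i - t ^ row_positions n l h\<bar>)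
     / (\<Prod>i<n. \<Prod>h<i. \<bar>t ^ (n - Suc i) - t ^ (n - Suc h)\<bar>)"
    unfolding prod_dividef[symmetric]
  proof (intro prod.cong refl)
    fix i h assume "i \<in> {..<n}" "h \<in> {..<i}"
    then have "row_positions n l i < row_positions n l h" "n - Suc i < n - Suc h"
      using row_positions_less[OF l] by auto
    then have "sgn (t ^ row_positions n l i - t ^ row_positions n l h) = sgn (t ^ (n - Suc i) - t ^ (n - Suc h))"
      by (simp add: sgn)
    moreover have "x / y = \<bar>x\<bar> / \<bar>y\<bar>" if "sgn x = sgn y" for x y :: real
      using that by (auto simp: sgn_if abs_if split: if_splits)
    ultimately
    show "(t ^ row_positions n l i - t ^ row_positions n l h) / (t ^ (n - Suc i) - t ^ (n - Suc h))
      = \<bar>t ^ row_positions n l i - t ^ row_positions n l h\<bar> / \<bar>t ^ (n - Suc i) - t ^ (n - Suc h)\<bar>"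
      by blast
  qed
  finally show ?thesis .
qed

text \<open>
  Each unordered pair occurs twice among the ordered pairs.
\<close>

lemma vandermonde_square:
  fixes y :: "nat \<Rightarrow> real"
  shows "(\<Prod>i<n. \<Prod>h<i. \<bar>y i - y h\<bar>)\<^sup>2 = (\<Prod>i<n. \<Prod>j\<in>{..<n} - {i}. \<bar>y i - y j\<bar>)"
proof (induction n)
  case (Suc n)
  have "(\<Prod>i<Suc n. \<Prod>j\<in>{..<Suc n} - {i}. \<bar>y i - y j\<bar>)
     = (\<Prod>i<n. \<bar>y i - y n\<bar> * (\<Prod>j\<in>{..<n} - {i}. \<bar>y i - y j\<bar>)) * (\<Prod>j<n. \<bar>y n - y j\<bar>)"
  proof -
    have "{..<Suc n} - {i} = insert n ({..<n} - {i})" if "i < n" for i using that by auto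
    moreover have "{..<Suc n} - {n} = {..<n}" by auto
    ultimately show ?thesis by simp
  qed
  then show ?case
    by (simp add: Suc[symmetric] prod.distrib power2_eq_square abs_minus_commute[of "y n"])
qed simp

text \<open>
  The square of the Vandermonde product of the nodes \<open>y a\<close>, as a product over ordered pairs: it
  depends on the set of indices and not on an enumeration.
\<close>

definition pair_prod :: "(nat \<Rightarrow> real) \<Rightarrow> nat set \<Rightarrow> real" where
  "pair_prod y S = (\<Prod>a\<in>S. \<Prod>b\<in>S - {a}. \<bar>y a - y b\<bar>)"

lemma vandermonde_pair_prod:
  fixes a :: "nat \<Rightarrow> nat"
  assumes "inj_on a {..<n}"
  shows "(\<Prod>i<n. \<Prod>h<i. \<bar>y (a i) - y (a h)\<bar>)\<^sup>2 = pair_prod y (a ` {..<n})"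
proof -
  have "pair_prod y (a ` {..<n}) = (\<Prod>i<n. \<Prod>b\<in>a ` {..<n} - {a i}. \<bar>y (a i) - y b\<bar>)"
    unfolding pair_prod_def by (subst prod.reindex[OF assms]) simp
  also have "\<dots> = (\<Prod>i<n. \<Prod>j\<in>{..<n} - {i}. \<bar>y (a i) - y (a j)\<bar>)"
  proof (rule prod.cong[OF refl])
    fix i assume "i \<in> {..<n}"
    then have "a ` {..<n} - {a i} = a ` ({..<n} - {i})" using assms by (auto dest: inj_onD)
    moreover have "inj_on a ({..<n} - {i})" using assms by (rule inj_on_subset) auto
    ultimately show "(\<Prod>b\<in>a ` {..<n} - {a i}. \<bar>y (a i) - y b\<bar>) = (\<Prod>j\<in>{..<n} - {i}. \<bar>y (a i) - y (a j)\<bar>)"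
      by (simp add: prod.reindex)
  qed
  finally show ?thesis unfolding vandermonde_square[of "\<lambda>i. y (a i)"] ..
qed

text \<open>
  Split the ordered pairs of distinct elements of \<open>U\<close> according to membership in \<open>A\<close>. The pairs
  inside \<open>A\<close> and the mixed pairs starting in \<open>A\<close> make up the factor that is squared.
\<close>

lemma pair_prod_complement:
  assumes "finite U" "A \<subseteq> U"
  shows "pair_prod y (U - A) * (\<Prod>a\<in>A. \<Prod>m\<in>U - {a}. \<bar>y a - y m\<bar>)\<^sup>2 = pair_prod y U * pair_prod y A"
proof -
  define X where "X = (\<Prod>a\<in>A. \<Prod>b\<in>U - A. \<bar>y a - y b\<bar>)"
  have fin: "finite A" using assms finite_subset by blast
  have A: "(\<Prod>a\<in>A. \<Prod>m\<in>U - {a}. \<bar>y a - y m\<bar>) = pair_prod y A * X"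
    unfolding pair_prod_def X_def prod.distrib[symmetric]
  proof (rule prod.cong[OF refl])
    fix a assume "a \<in> A"
    then have "U - {a} = (A - {a}) \<union> (U - A)" using assms by auto
    then show "(\<Prod>m\<in>U - {a}. \<bar>y a - y m\<bar>) = (\<Prod>b\<in>A - {a}. \<bar>y a - y b\<bar>) * (\<Prod>b\<in>U - A. \<bar>y a - y b\<bar>)"
      using assms fin by (simp only:) (rule prod.union_disjoint, auto)
  qed
  have B: "(\<Prod>a\<in>U - A. \<Prod>m\<in>U - {a}. \<bar>y a - y m\<bar>) = pair_prod y (U - A) * X"
  proof -
    have "X = (\<Prod>b\<in>U - A. \<Prod>a\<in>A. \<bar>y b - y a\<bar>)"
      unfolding X_def by (subst prod.swap) (simp add: abs_minus_commute)
    moreover have "(\<Prod>m\<in>U - {a}. \<bar>y a - y m\<bar>) = (\<Prod>b\<in>U - A - {a}. \<bar>y a - y b\<bar>) * (\<Prod>b\<in>A. \<bar>y a - y b\<bar>)"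
      if "a \<in> U - A" for a
    proof -
      have "U - {a} = (U - A - {a}) \<union> A" using that assms by auto
      then show ?thesis using assms fin by (simp only:) (rule prod.union_disjoint, auto)
    qed
    ultimately show ?thesis unfolding pair_prod_def by (simp add: prod.distrib)
  qed
  have "pair_prod y U = (\<Prod>a\<in>A. \<Prod>m\<in>U - {a}. \<bar>y a - y m\<bar>) * (\<Prod>a\<in>U - A. \<Prod>m\<in>U - {a}. \<bar>y a - y m\<bar>)"
    using assms prod.subset_diff[of A U "\<lambda>a. \<Prod>m\<in>U - {a}. \<bar>y a - y m\<bar>"]
    by (simp add: pair_prod_def mult.commute)
  then show ?thesis unfolding A B by (simp add: power2_eq_square)
qed

lemma inj_power:
  fixes t :: real
  assumes "0 < t" "t \<noteq> 1"
  shows "inj (\<lambda>i. t ^ i)"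
proof (rule injI)
  fix i j :: nat assume "t ^ i = t ^ j"
  moreover have "t ^ a \<noteq> t ^ b" if "a < b" for a b
  proof -
    have "t ^ b < t ^ a \<or> t ^ a < t ^ b"
      using that assms by (cases "t < 1") auto
    then show ?thesis by (metis less_irrefl)
  qed
  ultimately show "i = j" by (metis nat_neq_iff)
qed

text \<open>
  The absolute value at the root \<open>t ^ b\<close> of the derivative of the polynomial with roots
  \<open>t ^ 0, \<dots>, t ^ (N - 1)\<close>.
\<close>

abbreviation node_dist :: "real \<Rightarrow> nat \<Rightarrow> nat \<Rightarrow> real" where
  "node_dist t N b \<equiv> \<Prod>m\<in>{..<N} - {b}. \<bar>t ^ b - t ^ m\<bar>"

lemma node_dist_pos:
  fixes t :: real
  assumes "0 < t" "t \<noteq> 1"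
  shows "0 < node_dist t N b"
  using inj_power[OF assms] by (intro prod_pos) (auto dest: injD)

text \<open>
  The squared Vandermonde determinant of the nodes \<open>t ^ a\<close> at the positions of \<open>l\<close>, times the
  one-point weight \<open>\<eta> ^ a / node_dist t (n + k) a\<close> of each of them: an orthogonal polynomial ensemble
  up to the factor \<open>C\<close>.
\<close>

abbreviation vandermonde_weight :: "real \<Rightarrow> real \<Rightarrow> real \<Rightarrow> nat \<Rightarrow> nat \<Rightarrow> nat list \<Rightarrow> real" where
  "vandermonde_weight C t \<eta> n k l \<equiv> C * (fdet n (\<lambda>i j. (t ^ row_positions n l j) ^ i))\<^sup>2 *
    (\<Prod>j<n. \<eta> ^ row_positions n l j / node_dist t (n + k) (row_positions n l j))"

text \<open>
  The hypothesis says that the second Schur numerator is the Vandermonde product of the complementary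
  nodes \<open>t ^ b\<close>, up to a constant and a factor \<open>\<eta>\<close> to the power of each position. By
  \<open>pair_prod_complement\<close> that product is the Vandermonde product of the positions themselves divided
  by their \<open>node_dist\<close>; together with the first Schur numerator this gives the square.
\<close>

lemma mu_density_of_dual_factor:
  fixes t s :: real
  assumes t: "0 < t" "t \<noteq> 1" and s: "0 < s" "s \<noteq> 1" and c: "0 < c"
    and B: "\<And>l. l \<in> diagrams n k \<Longrightarrow>
      (let b = row_positions k (conjugate_diagram k (complement_diagram k l)) in
        (\<Prod>i<k. \<Prod>h<i. \<bar>s ^ b i - s ^ b h\<bar>)
        = c * (\<Prod>j<n. \<eta> ^ row_positions n l j) * sqrt (pair_prod (\<lambda>b. t ^ b) ({..<n + k} - row_positions n l ` {..<n})))"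
  shows "\<exists>C>0. \<forall>l\<in>diagrams n k. mu n k (\<lambda>i. t ^ i) (\<lambda>j. s ^ j) l =
    vandermonde_weight C t \<eta> n k l"
proof -
  define dn where "dn = (\<Prod>i<n. \<Prod>h<i. \<bar>t ^ (n - Suc i) - t ^ (n - Suc h)\<bar>)"
  define dk where "dk = (\<Prod>i<k. \<Prod>h<i. \<bar>s ^ (k - Suc i) - s ^ (k - Suc h)\<bar>)"
  define Z where "Z = (\<Prod>i<n. \<Prod>j<k. t ^ i + s ^ j)"
  define U where "U = pair_prod (\<lambda>b. t ^ b) {..<n + k}"
  have "0 < dn" unfolding dn_def using inj_power[OF t] by (intro prod_pos) (auto dest!: injD)
  have "0 < dk" unfolding dk_def using inj_power[OF s] by (intro prod_pos) (auto dest!: injD)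
  have "0 < Z" unfolding Z_def using t s by (intro prod_pos ballI add_pos_pos) auto
  have "0 < U" unfolding U_def pair_prod_def by (intro prod_pos ballI node_dist_pos t)
  define C where "C = c * sqrt U / (dn * dk * Z)"
  have "0 < C" unfolding C_def using c \<open>0 < dn\<close> \<open>0 < dk\<close> \<open>0 < Z\<close> \<open>0 < U\<close> by auto
  moreover have "mu n k (\<lambda>i. t ^ i) (\<lambda>j. s ^ j) l =
    vandermonde_weight C t \<eta> n k l"
    if l: "l \<in> diagrams n k" for l
  proof -
    define a where "a = row_positions n l"
    define v where "v = (\<Prod>i<n. \<Prod>h<i. \<bar>t ^ a i - t ^ a h\<bar>)"
    define D where "D = (\<Prod>j<n. node_dist t (n + k) (a j))"
    have inj: "inj_on a {..<n}" unfolding a_def by (rule row_positions_inj[OF l])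
    have sub: "a ` {..<n} \<subseteq> {..<n + k}" unfolding a_def using row_positions_tuple[OF l] by auto
    have "0 < D" unfolding D_def by (intro prod_pos ballI node_dist_pos t)
    have "0 \<le> v" unfolding v_def by (intro prod_nonneg) auto
    have v2: "v\<^sup>2 = pair_prod (\<lambda>b. t ^ b) (a ` {..<n})"
      unfolding v_def by (rule vandermonde_pair_prod[OF inj])
    have "pair_prod (\<lambda>b. t ^ b) ({..<n + k} - a ` {..<n}) * D\<^sup>2 = U * v\<^sup>2"
      using pair_prod_complement[OF _ sub, of "\<lambda>b. t ^ b"] unfolding v2 U_def D_def
      by (simp add: prod.reindex[OF inj])
    then have "pair_prod (\<lambda>b. t ^ b) ({..<n + k} - a ` {..<n}) = U * (v / D)\<^sup>2"
      using \<open>0 < D\<close> by (simp add: field_simps)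
    then have sq: "sqrt (pair_prod (\<lambda>b. t ^ b) ({..<n + k} - a ` {..<n})) = sqrt U * (v / D)"
      using \<open>0 \<le> v\<close> \<open>0 < D\<close> by (simp add: real_sqrt_mult)
    have f: "(fdet n (\<lambda>i j. (t ^ a j) ^ i))\<^sup>2 = v\<^sup>2"
    proof -
      have "fdet n (\<lambda>i j. (t ^ a j) ^ i) = fdet n (\<lambda>i j. (t ^ a i) ^ j)" by (rule fdet_transpose)
      also have "\<dots> = (\<Prod>i<n. \<Prod>h<i. t ^ a i - t ^ a h)" by (rule vandermonde_det)
      finally have "\<bar>fdet n (\<lambda>i j. (t ^ a j) ^ i)\<bar> = v" by (simp add: v_def abs_prod)
      then show ?thesis by (metis power2_abs)
    qed
    have "mu n k (\<lambda>i. t ^ i) (\<lambda>j. s ^ j) l = (v / dn) *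
        ((c * (\<Prod>j<n. \<eta> ^ a j) * (sqrt U * (v / D))) / dk) / Z"
      unfolding mu_def schur_geometric[OF l t] schur_geometric[OF conjugate_complement_diagram[OF l] s]
      using B[OF l] unfolding Let_def a_def[symmetric] sq by (simp add: v_def a_def dn_def dk_def Z_def)
    also have "\<dots> = C * v\<^sup>2 * (\<Prod>j<n. \<eta> ^ a j / node_dist t (n + k) (a j))"
      unfolding prod_dividef D_def[symmetric] C_def by (simp add: power2_eq_square mult_ac)
    finally show ?thesis unfolding f[symmetric] unfolding a_def .
  qed
  ultimately show ?thesis by blast
qed

lemma mu_A_density:
  assumes t: "0 < t" "t \<noteq> 1"
  shows "\<exists>C>0. \<forall>l\<in>diagrams n k. mu_A n k t l =
    vandermonde_weight C t 1 n k l"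
  unfolding mu_A_def
proof (rule mu_density_of_dual_factor[OF t t, where c = 1], unfold Let_def)
  show "0 < (1 :: real)" by simp
  fix l assume l: "l \<in> diagrams n k"
  let ?b = "row_positions k (conjugate_diagram k (complement_diagram k l))"
  have "(\<Prod>i<k. \<Prod>h<i. \<bar>t ^ ?b i - t ^ ?b h\<bar>) = sqrt (pair_prod (\<lambda>b. t ^ b) (?b ` {..<k}))"
    unfolding vandermonde_pair_prod[OF row_positions_inj[OF conjugate_complement_diagram[OF l]], symmetric]
    by (simp add: prod_nonneg)
  then show "(\<Prod>i<k. \<Prod>h<i. \<bar>t ^ ?b i - t ^ ?b h\<bar>) = 1 * (\<Prod>j<n. 1 ^ row_positions n l j) *
      sqrt (pair_prod (\<lambda>b. t ^ b) ({..<n + k} - row_positions n l ` {..<n}))"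
    by (simp add: conjugate_complement_positions[OF l])
qed

text \<open>
  One has \<open>\<bar>1/x - 1/y\<bar> = \<bar>x - y\<bar> / (x * y)\<close>, and each node is in \<open>2 * (card S - 1)\<close> ordered pairs.
\<close>

lemma pair_prod_inverse:
  fixes t :: real
  assumes t: "0 < t" and "finite S"
  shows "pair_prod (\<lambda>b. inverse t ^ b) S = pair_prod (\<lambda>b. t ^ b) S * ((\<Prod>b\<in>S. inverse t ^ b) ^ (card S - 1))\<^sup>2"
proof -
  have d: "\<bar>inverse t ^ a - inverse t ^ b\<bar> = \<bar>t ^ a - t ^ b\<bar> * (inverse t ^ a * inverse t ^ b)" for a b
  proof -
    have "inverse t ^ a - inverse t ^ b = (t ^ b - t ^ a) * (inverse t ^ a * inverse t ^ b)"
      using t by (simp add: field_simps)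
    then show ?thesis using t by (simp add: abs_mult abs_minus_commute)
  qed
  have "pair_prod (\<lambda>b. inverse t ^ b) S = pair_prod (\<lambda>b. t ^ b) S *
     ((\<Prod>a\<in>S. \<Prod>b\<in>S - {a}. inverse t ^ a) * (\<Prod>a\<in>S. \<Prod>b\<in>S - {a}. inverse t ^ b))"
    unfolding pair_prod_def d prod.distrib ..
  also have "(\<Prod>a\<in>S. \<Prod>b\<in>S - {a}. inverse t ^ b) = (\<Prod>a\<in>S. \<Prod>b\<in>S. if b = a then 1 else inverse t ^ b)"
    using \<open>finite S\<close> by (intro prod.cong refl prod.mono_neutral_cong_left) auto
  also have "\<dots> = (\<Prod>b\<in>S. \<Prod>a\<in>S. if b = a then 1 else inverse t ^ b)" by (rule prod.swap)
  also have "\<dots> = (\<Prod>b\<in>S. \<Prod>a\<in>S - {b}. inverse t ^ b)"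
    using \<open>finite S\<close> by (intro prod.cong refl prod.mono_neutral_cong_right) auto
  also have "\<dots> = (\<Prod>b\<in>S. (inverse t ^ b) ^ (card S - 1))"
    using \<open>finite S\<close> by (intro prod.cong) (auto simp: card_Diff_singleton)
  finally show ?thesis
    using \<open>finite S\<close> by (simp add: card_Diff_singleton prod_power_distrib power2_eq_square cong: prod.cong)
qed

text \<open>
  Inverting the parameter of the second Schur polynomial multiplies its numerator by the product of
  \<open>t ^ - b\<close> over the complementary positions \<open>b\<close>, to the power \<open>k - 1\<close>; up to a constant this is
  \<open>t ^ ((k - 1) * a)\<close> for every position \<open>a\<close> of the diagram.
\<close>

lemma mu_B_density:
  assumes t: "0 < t" "t \<noteq> 1"
  shows "\<exists>C>0. \<forall>l\<in>diagrams n k. mu_B n k t l =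
    vandermonde_weight C t (t ^ (k - 1)) n k l"
  unfolding mu_B_def
proof (rule mu_density_of_dual_factor[OF t], unfold Let_def)
  show "0 < inverse t" "inverse t \<noteq> 1" using t by auto
  define c where "c = (\<Prod>m<n + k. inverse t ^ m) ^ (k - 1)"
  show "0 < c" unfolding c_def using t by (intro zero_less_power prod_pos) auto
  fix l assume l: "l \<in> diagrams n k"
  let ?a = "row_positions n l" and ?b = "row_positions k (conjugate_diagram k (complement_diagram k l))"
  note injb = row_positions_inj[OF conjugate_complement_diagram[OF l]]
  note inja = row_positions_inj[OF l]
  have sub: "?a ` {..<n} \<subseteq> {..<n + k}" using row_positions_tuple[OF l] by auto
  have cardB: "card (?b ` {..<k}) = k" by (simp add: card_image[OF injb])
  have compl: "(\<Prod>b\<in>?b ` {..<k}. inverse t ^ b) = (\<Prod>m<n + k. inverse t ^ m) * (\<Prod>j<n. t ^ ?a j)"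
  proof -
    have "(\<Prod>m<n + k. inverse t ^ m) = (\<Prod>b\<in>?b ` {..<k}. inverse t ^ b) * (\<Prod>a\<in>?a ` {..<n}. inverse t ^ a)"
      unfolding conjugate_complement_positions[OF l] using sub by (intro prod.subset_diff) auto
    also have "(\<Prod>a\<in>?a ` {..<n}. inverse t ^ a) = inverse (\<Prod>j<n. t ^ ?a j)"
      by (simp add: prod.reindex[OF inja] power_inverse prod_inversef[symmetric, unfolded o_def])
    finally show ?thesis using t by (simp add: field_simps)
  qed
  have "(\<Prod>i<k. \<Prod>h<i. \<bar>inverse t ^ ?b i - inverse t ^ ?b h\<bar>) = sqrt (pair_prod (\<lambda>b. inverse t ^ b) (?b ` {..<k}))"
    unfolding vandermonde_pair_prod[OF injb, symmetric] by (simp add: prod_nonneg)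
  also have "\<dots> = sqrt (pair_prod (\<lambda>b. t ^ b) (?b ` {..<k})) * (\<Prod>b\<in>?b ` {..<k}. inverse t ^ b) ^ (k - 1)"
    using t by (simp add: pair_prod_inverse cardB real_sqrt_mult prod_nonneg)
  also have "(\<Prod>b\<in>?b ` {..<k}. inverse t ^ b) ^ (k - 1) = c * (\<Prod>j<n. (t ^ (k - 1)) ^ ?a j)"
  proof -
    have "(\<Prod>j<n. t ^ ?a j) ^ (k - 1) = (\<Prod>j<n. (t ^ (k - 1)) ^ ?a j)"
      unfolding prod_power_distrib by (intro prod.cong refl) (simp flip: power_mult add: mult.commute)
    then show ?thesis unfolding compl c_def power_mult_distrib by simp
  qed
  finally show "(\<Prod>i<k. \<Prod>h<i. \<bar>inverse t ^ ?b i - inverse t ^ ?b h\<bar>) =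
      c * (\<Prod>j<n. (t ^ (k - 1)) ^ ?a j) * sqrt (pair_prod (\<lambda>b. t ^ b) ({..<n + k} - ?a ` {..<n}))"
    by (simp add: conjugate_complement_positions[OF l])
qed

section \<open>The generating function of the one-point weight\<close>

lemma lagrange_interpolation:
  fixes x :: "nat \<Rightarrow> 'a :: field" and f :: "'a poly"
  assumes x: "inj_on x {..<n}" and f: "degree f < n"
  shows "f = (\<Sum>i<n. Polynomial.smult (poly f (x i) / (\<Prod>j\<in>{..<n} - {i}. x i - x j)) (\<Prod>j\<in>{..<n} - {i}. [:- x j, 1:]))"
proof -
  define P where "P i = (\<Prod>j\<in>{..<n} - {i}. x i - x j)" for i
  define L where "L i = (\<Prod>j\<in>{..<n} - {i}. [:- x j, 1:])" for i
  have nz: "P i \<noteq> 0" if "i < n" for i using x that by (auto simp: P_def inj_on_def)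
  have deg: "degree (L i) = n - 1" if "i < n" for i
    using that unfolding L_def by (subst degree_prod_eq_sum_degree) auto
  define p where "p = (\<Sum>i<n. Polynomial.smult (poly f (x i) / P i) (L i))"
  have "f = p"
  proof (rule poly_eqI_degree)
    fix y assume "y \<in> x ` {..<n}"
    then obtain a where a: "a < n" "y = x a" by auto
    have "poly (L b) (x a) = (if b = a then P a else 0)" if "b < n" for b
      using a(1) that by (auto simp: L_def P_def poly_prod)
    then have "poly p y = (\<Sum>b<n. if b = a then poly f (x a) / P a * P a else 0)"
      unfolding p_def poly_sum a(2) by (intro sum.cong) auto
    also have "\<dots> = poly f y" using a nz by simp
    finally show "poly f y = poly p y" ..
  next
    have "degree p \<le> n - 1" unfolding p_def
      using deg by (intro degree_sum_le) (auto intro: order_trans[OF degree_smult_le])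
    then show "degree p < card (x ` {..<n})" using f by (simp add: card_image[OF x])
    show "degree f < card (x ` {..<n})" using f by (simp add: card_image[OF x])
  qed
  then show ?thesis unfolding p_def P_def L_def .
qed

text \<open>
  The left-hand side is the coefficient of degree \<open>N - 1\<close> in the Lagrange interpolation of \<open>X ^ j\<close>.
\<close>

lemma divided_difference_power:
  fixes x :: "nat \<Rightarrow> real"
  assumes x: "inj_on x {..<N}" and j: "Suc j < N"
  shows "(\<Sum>b<N. x b ^ j / (\<Prod>m\<in>{..<N} - {b}. x b - x m)) = 0"
proof -
  define L where "L b = (\<Prod>m\<in>{..<N} - {b}. [:- x m, 1:])" for b
  have lc: "coeff (L b) (N - 1) = 1" if "b < N" for b
  proof -
    have "degree (L b) = N - 1"
      using that unfolding L_def by (subst degree_prod_eq_sum_degree) auto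
    then show ?thesis
      using lead_coeff_prod[of "\<lambda>m. [:- x m, 1:]" "{..<N} - {b}"] by (simp add: L_def)
  qed
  have deg: "degree (monom (1::real) j) < N" using j by (simp add: degree_monom_eq)
  have "0 = coeff (monom (1::real) j) (N - 1)" using j by simp
  also have "\<dots> = (\<Sum>b<N. x b ^ j / (\<Prod>m\<in>{..<N} - {b}. x b - x m) * coeff (L b) (N - 1))"
    by (subst lagrange_interpolation[OF x deg]) (simp add: coeff_sum poly_monom L_def)
  also have "\<dots> = (\<Sum>b<N. x b ^ j / (\<Prod>m\<in>{..<N} - {b}. x b - x m))"
    using lc by (intro sum.cong) auto
  finally show ?thesis ..
qed

text \<open>
  The products \<open>\<Prod>m. t ^ b - t ^ m\<close> alternate in sign with \<open>b\<close>, so the absolute values disappear when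
  \<open>z\<close> is replaced by \<open>-z\<close>. The resulting polynomial \<open>f\<close> of degree at most \<open>N - 1\<close> has at \<open>t ^ j\<close> the
  value \<open>\<Sum>b. (t ^ b) ^ j / \<Prod>m. (t ^ b - t ^ m)\<close>, a divided difference that vanishes for
  \<open>j < N - 1\<close>. All its roots are therefore known.
\<close>

lemma node_generating_function:
  fixes t \<eta> :: real
  assumes t: "0 < t" "t \<noteq> 1" and N: "2 \<le> N"
  shows "\<exists>K. \<forall>z. (\<Sum>b<N. \<eta> ^ b / node_dist t N b * z ^ b) = K * (\<Prod>l<N - 1. 1 + \<eta> * z / t ^ l)"
proof -
  define P where "P b = (\<Prod>m\<in>{..<N} - {b}. t ^ b - t ^ m)" for b
  define \<epsilon> :: real where "\<epsilon> = (if t < 1 then 1 else (- 1) ^ (N - 1))"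
  note inj = inj_power[OF t]
  have sgnP: "1 / node_dist t N b = \<epsilon> * (- 1) ^ b / P b" if b: "b < N" for b
  proof -
    have Peq: "P b = (\<Prod>m\<in>{..<b}. t ^ b - t ^ m) * (\<Prod>m\<in>{Suc b..<N}. t ^ b - t ^ m)" (is "_ = ?l * ?u")
      and Deq: "node_dist t N b = (\<Prod>m\<in>{..<b}. \<bar>t ^ b - t ^ m\<bar>) * (\<Prod>m\<in>{Suc b..<N}. \<bar>t ^ b - t ^ m\<bar>)" (is "_ = ?l' * ?u'")
    proof -
      have "{..<N} - {b} = {..<b} \<union> {Suc b..<N}" using b by auto
      moreover have "{..<b} \<inter> {Suc b..<N} = {}" by auto
      ultimately show "P b = ?l * ?u" "node_dist t N b = ?l' * ?u'"
        unfolding P_def by (simp_all add: prod.union_disjoint)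
    qed
    have less: "t < 1 \<Longrightarrow> i < j \<Longrightarrow> t ^ j < t ^ i" "\<not> t < 1 \<Longrightarrow> i < j \<Longrightarrow> t ^ i < t ^ j" for i j
      using t power_strict_decreasing[of i j t] power_strict_increasing[of i j t] by auto
    have neg: "(\<Prod>m\<in>S. f m) = (- 1) ^ card S * (\<Prod>m\<in>S. - f m)" for S and f :: "nat \<Rightarrow> real"
      by (simp add: prod_uminus flip: mult.assoc power_add)
    have "P b = \<epsilon> * (- 1) ^ b * node_dist t N b"
    proof (cases "t < 1")
      case True
      then have "?l = (- 1) ^ b * ?l'"
        using less(1) by (subst neg) (auto intro!: prod.cong simp: abs_if)
      moreover have "?u = ?u'"
      proof (rule prod.cong[OF refl])
        fix m assume "m \<in> {Suc b..<N}"
        then show "t ^ b - t ^ m = \<bar>t ^ b - t ^ m\<bar>" using less(1)[OF True, of b m] by simp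
      qed
      ultimately show ?thesis unfolding Peq Deq using True by (simp add: \<epsilon>_def)
    next
      case False
      then have u: "?u = (- 1) ^ (N - Suc b) * ?u'"
        using less(2) by (subst neg) (auto intro!: prod.cong simp: abs_if)
      have "?l = ?l'"
      proof (rule prod.cong[OF refl])
        fix m assume "m \<in> {..<b}"
        then show "t ^ b - t ^ m = \<bar>t ^ b - t ^ m\<bar>" using less(2)[OF False, of m b] by simp
      qed
      moreover have "(- 1 :: real) ^ (N - 1) * (- 1) ^ b = (- 1) ^ (N - Suc b)"
      proof -
        have "N - 1 + b = (N - Suc b) + 2 * b" using b by simp
        then show ?thesis unfolding power_add[symmetric] by (simp only:) (simp add: power_add)
      qed
      ultimately show ?thesis unfolding Peq Deq u using False by (simp add: \<epsilon>_def)
    qed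
    moreover have "\<epsilon> * (- 1) ^ b * (\<epsilon> * (- 1) ^ b) = 1"
      by (simp add: \<epsilon>_def flip: power_add power_mult_distrib)
    moreover have "1 / d = x / p" if "p = x * d" "x * x = 1" for d x p :: real
      using that by (cases "x = 0") auto
    ultimately show ?thesis by blast
  qed
  define f where "f = (\<Sum>b<N. monom (1 / P b) b)"
  have pf: "poly f z = (\<Sum>b<N. z ^ b / P b)" for z
    unfolding f_def poly_sum by (simp add: poly_monom)
  define g where "g = (\<Prod>l<N - 1. [:- (t ^ l), 1:])"
  have degg: "degree g = N - 1" unfolding g_def by (subst degree_prod_eq_sum_degree) auto
  have lcg: "coeff g (N - 1) = 1"
    using lead_coeff_prod[of "\<lambda>l. [:- (t ^ l), 1:]" "{..<N - 1}"] degg by (simp add: g_def)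
  define c where "c = coeff f (N - 1)"
  have "f - Polynomial.smult c g = 0"
  proof (rule poly_eqI_degree)
    have "inj_on (\<lambda>l. t ^ l) {..<N - 1}" using inj by (rule inj_on_subset) auto
    then have card: "card ((\<lambda>l. t ^ l) ` {..<N - 1}) = N - 1" by (simp add: card_image)
    have "degree f \<le> N - 1" unfolding f_def
      by (intro degree_sum_le) (auto intro: order_trans[OF degree_monom_le])
    then have "degree (f - Polynomial.smult c g) \<le> N - 1"
      using degg by (intro degree_diff_le) (auto intro: order_trans[OF degree_smult_le])
    moreover have "coeff (f - Polynomial.smult c g) (N - 1) = 0" using lcg by (simp add: c_def)
    ultimately have "degree (f - Polynomial.smult c g) < N - 1"
      using N by (metis degree_0 diff_gt_0_iff_gt eq_zero_or_degree_less less_le_trans numeral_2_eq_2 Suc_le_lessD zero_less_diff One_nat_def)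
    then show "degree (f - Polynomial.smult c g) < card ((\<lambda>l. t ^ l) ` {..<N - 1})"
      unfolding card .
    show "degree (0 :: real poly) < card ((\<lambda>l. t ^ l) ` {..<N - 1})" using N unfolding card by simp
    fix y assume "y \<in> (\<lambda>l. t ^ l) ` {..<N - 1}"
    then obtain j where j: "j < N - 1" "y = t ^ j" by auto
    have "poly f y = (\<Sum>b<N. (t ^ b) ^ j / (\<Prod>m\<in>{..<N} - {b}. t ^ b - t ^ m))"
      unfolding pf P_def j(2) by (simp flip: power_mult add: mult.commute)
    also have "\<dots> = 0"
      by (rule divided_difference_power) (use j inj in \<open>auto intro: inj_on_subset\<close>)
    finally show "poly (f - Polynomial.smult c g) y = poly 0 y"
      using j by (auto simp: g_def poly_prod)
  qed
  then have fg: "poly f z = c * (\<Prod>l<N - 1. z - t ^ l)" for z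
    by (simp add: g_def poly_prod)
  have "(\<Sum>b<N. \<eta> ^ b / node_dist t N b * z ^ b) = (\<epsilon> * c * (\<Prod>l<N - 1. - (t ^ l))) * (\<Prod>l<N - 1. 1 + \<eta> * z / t ^ l)" for z
  proof -
    have "(\<Sum>b<N. \<eta> ^ b / node_dist t N b * z ^ b) = (\<Sum>b<N. \<eta> ^ b * z ^ b * (1 / node_dist t N b))" by simp
    also have "\<dots> = (\<Sum>b<N. \<epsilon> * ((- \<eta> * z) ^ b / P b))"
      using sgnP by (intro sum.cong refl) (simp add: power_mult_distrib power_minus[of "\<eta> * z"] power_minus[of "\<eta>"])
    also have "\<dots> = \<epsilon> * poly f (- \<eta> * z)" by (simp add: pf sum_distrib_left)
    also have "\<dots> = \<epsilon> * c * ((\<Prod>l<N - 1. - (t ^ l)) * (\<Prod>l<N - 1. 1 + \<eta> * z / t ^ l))"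
    proof -
      have "- \<eta> * z - t ^ l = - (t ^ l) * (1 + \<eta> * z / t ^ l)" for l using t by (simp add: field_simps)
      then show ?thesis unfolding fg prod.distrib[symmetric] by (simp add: mult.assoc)
    qed
    finally show ?thesis by simp
  qed
  then show ?thesis by blast
qed

section \<open>Mean and variance for random diagrams\<close>

text \<open>
  The factors shared by the generating functions of the weight at
  \<open>y, y * q, \<dots>, y * q ^ (n - 1)\<close>.
\<close>

definition omega :: "real \<Rightarrow> real \<Rightarrow> nat \<Rightarrow> real \<Rightarrow> real" where
  "omega q \<eta> k y = (\<Prod>e<k. 1 + \<eta> * y / q ^ e)"

text \<open>
  The total mass \<open>1\<close> eliminates both the constant \<open>C\<close> and the unnormalised sum of the weight, so that
  \<open>power_sum_moment\<close> and \<open>linear_statistic_variance\<close> become an exact mean and a variance bound.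
\<close>

lemma ensemble_moments:
  fixes q \<eta> C :: real and pr :: "nat list \<Rightarrow> real"
  assumes q: "0 < q" "q \<noteq> 1" and nk: "0 < n" "0 < k" and \<eta>: "0 < \<eta>"
    and pr: "\<And>l. l \<in> diagrams n k \<Longrightarrow> pr l = vandermonde_weight C q \<eta> n k l"
    and total: "(\<Sum>l\<in>diagrams n k. pr l) = 1"
  shows "(\<Sum>l\<in>diagrams n k. pr l * (\<Sum>j<n. r ^ row_positions n l j)) =
      (\<Sum>i<n. omega q \<eta> k (r * q ^ i) / omega q \<eta> k (q ^ i) * (\<Prod>j\<in>{..<n} - {i}. (r * q ^ i - q ^ j) / (q ^ i - q ^ j)))"
    and "(\<And>b. b < n + k \<Longrightarrow> \<bar>h b\<bar> \<le> B) \<Longrightarrow>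
      (\<Sum>l\<in>diagrams n k. pr l * (\<Sum>j<n. h (row_positions n l j))\<^sup>2)
      \<le> (\<Sum>l\<in>diagrams n k. pr l * (\<Sum>j<n. h (row_positions n l j)))\<^sup>2 + real n * B\<^sup>2"
proof -
  define N where "N = n + k"
  define w where "w b = \<eta> ^ b / node_dist q N b" for b
  define V where "V a = fdet n (\<lambda>i j. (q ^ a j) ^ i)" for a
  define S where "S F = (\<Sum>a\<in>tuples n N. (V a)\<^sup>2 * (\<Prod>j<n. w (a j)) * F a)" for F
  define E where "E F = (\<Sum>l\<in>diagrams n k. pr l * F (row_positions n l))" for F
  have wpos: "0 < w b" for b unfolding w_def using node_dist_pos[OF q] \<eta> by simp
  have injN: "inj_on (\<lambda>b. q ^ b) {..<M}" for M using inj_power[OF q] by (rule inj_on_subset) auto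
  have C: "C \<noteq> 0" using total pr by (auto simp: sum.neutral)
  have S_E: "C * S F = fact n * E F" if "\<And>a s. s permutes {..<n} \<Longrightarrow> F (a \<circ> s) = F a" for F
  proof -
    have "S F = fact n * (\<Sum>l\<in>diagrams n k. (V (row_positions n l))\<^sup>2 * (\<Prod>j<n. w (row_positions n l j)) * F (row_positions n l))"
      unfolding S_def N_def
    proof (rule sum_tuples_diagrams)
      fix a s assume s: "s permutes {..<n}"
      have "(V (a \<circ> s))\<^sup>2 = (V a)\<^sup>2"
        using fdet_permute_cols[OF s, of "\<lambda>i b. (q ^ a b) ^ i"]
        by (simp add: V_def power_mult_distrib flip: of_int_power) (simp add: sign_def)
      moreover have "(\<Prod>j<n. w ((a \<circ> s) j)) = (\<Prod>j<n. w (a j))"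
        using prod.permute[OF s, of "\<lambda>j. w (a j)"] by (simp add: o_def)
      ultimately show "(V (a \<circ> s))\<^sup>2 * (\<Prod>j<n. w ((a \<circ> s) j)) * F (a \<circ> s) = (V a)\<^sup>2 * (\<Prod>j<n. w (a j)) * F a"
        using that[OF s] by simp
    next
      fix a :: "nat \<Rightarrow> nat" assume "\<not> inj_on a {..<n}"
      then obtain i h where "i < n" "h < i" "a i = a h"
        unfolding inj_on_def by (metis lessThan_iff nat_neq_iff)
      then have "(\<Prod>i<n. \<Prod>h<i. q ^ a i - q ^ a h) = 0" by (intro prod_zero bexI[of _ i] bexI[of _ h]) auto
      moreover have "V a = fdet n (\<lambda>i j. (q ^ a i) ^ j)" unfolding V_def by (rule fdet_transpose)
      ultimately have "V a = 0" using vandermonde_det[of n "\<lambda>i. q ^ a i"] by simp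
      then show "(V a)\<^sup>2 * (\<Prod>j<n. w (a j)) * F a = 0" by simp
    qed
    then have "C * S F = fact n * (\<Sum>l\<in>diagrams n k. C * ((V (row_positions n l))\<^sup>2 * (\<Prod>j<n. w (row_positions n l j)) * F (row_positions n l)))"
      by (simp add: sum_distrib_left mult_ac)
    also have "\<dots> = fact n * E F" unfolding E_def
      by (rule arg_cong[where f = "\<lambda>x. fact n * x"], rule sum.cong[OF refl])
        (simp add: pr V_def w_def N_def mult.assoc)
    finally show ?thesis .
  qed
  have S1: "C * S (\<lambda>_. 1) = fact n" using total by (subst S_E) (simp_all add: E_def)
  have sym: "(\<Sum>j<n. g ((a \<circ> s) j)) = (\<Sum>j<n. g (a j))" if s: "s permutes {..<n}" for a s and g :: "nat \<Rightarrow> real"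
    using sum.permute[OF s, of "\<lambda>j. g (a j)"] by (simp add: o_def)
  show "(\<Sum>l\<in>diagrams n k. pr l * (\<Sum>j<n. r ^ row_positions n l j)) =
      (\<Sum>i<n. omega q \<eta> k (r * q ^ i) / omega q \<eta> k (q ^ i) * (\<Prod>j\<in>{..<n} - {i}. (r * q ^ i - q ^ j) / (q ^ i - q ^ j)))" (is "_ = ?R")
  proof -
    obtain K where K: "\<And>z. (\<Sum>b<N. \<eta> ^ b / node_dist q N b * z ^ b) = K * (\<Prod>l<N - 1. 1 + \<eta> * z / q ^ l)"
      using node_generating_function[OF q, of N \<eta>] nk unfolding N_def by auto
    \<comment> \<open>At \<open>y * q ^ j\<close> the factors with \<open>l = j, \<dots>, j + k - 1\<close> form \<open>omega\<close>, whatever \<open>j\<close> is; the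
       \<open>n - 1\<close> remaining ones form a polynomial in \<open>y\<close>.\<close>
    define R where "R j = {..<N - 1} - {j..<j + k}" for j
    define p where "p j = Polynomial.smult K (\<Prod>l\<in>R j. [:1, \<eta> * q ^ j / q ^ l:])" for j
    have "S (\<lambda>a. \<Sum>j<n. r ^ a j) = S (\<lambda>_. 1) * ?R"
      unfolding S_def V_def
    proof (rule power_sum_moment)
      show "inj_on (\<lambda>i. q ^ i) {..<n}" by (rule injN)
      show "omega q \<eta> k (q ^ i) \<noteq> 0" for i
      proof -
        have "0 < 1 + \<eta> * q ^ i / q ^ e" for e using q \<eta> by (intro add_pos_pos) auto
        then show ?thesis unfolding omega_def by (simp add: less_imp_neq[symmetric])
      qed
      fix j assume j: "j < n"
      have sub: "{j..<j + k} \<subseteq> {..<N - 1}" using j by (auto simp: N_def)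
      have "degree (\<Prod>l\<in>R j. [:1, \<eta> * q ^ j / q ^ l:]) \<le> (\<Sum>l\<in>R j. degree [:1, \<eta> * q ^ j / q ^ l:])"
        using degree_prod_sum_le[of "R j" "\<lambda>l. [:1, \<eta> * q ^ j / q ^ l:]"] by (simp add: R_def o_def)
      also have "\<dots> \<le> (\<Sum>l\<in>R j. 1)"
        by (intro sum_mono order_trans[OF degree_pCons_le]) simp
      finally have "degree (p j) \<le> (\<Sum>l\<in>R j. 1)"
        unfolding p_def by (rule order_trans[OF degree_smult_le])
      also have "\<dots> = N - 1 - k" unfolding R_def using sub by (simp add: card_Diff_subset)
      finally show "degree (p j) < n" using nk by (simp add: N_def)
      fix y
      have "(\<Prod>l<N - 1. 1 + \<eta> * (y * q ^ j) / q ^ l)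
          = (\<Prod>l\<in>R j. 1 + \<eta> * (y * q ^ j) / q ^ l) * (\<Prod>l\<in>{j..<j + k}. 1 + \<eta> * (y * q ^ j) / q ^ l)"
        unfolding R_def using sub by (intro prod.subset_diff) auto
      also have "(\<Prod>l\<in>{j..<j + k}. 1 + \<eta> * (y * q ^ j) / q ^ l) = omega q \<eta> k y"
      proof -
        have "(\<Prod>l\<in>{j..<j + k}. 1 + \<eta> * (y * q ^ j) / q ^ l) = (\<Prod>e\<in>{0..<k}. 1 + \<eta> * (y * q ^ j) / q ^ (e + j))"
          using prod.shift_bounds_nat_ivl[of "\<lambda>l. 1 + \<eta> * (y * q ^ j) / q ^ l" 0 j k] by (simp add: add.commute)
        also have "\<dots> = omega q \<eta> k y"
          unfolding omega_def atLeast0LessThan using q by (intro prod.cong) (auto simp: power_add)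
        finally show ?thesis .
      qed
      finally show "(\<Sum>b<N. w b * (y * q ^ j) ^ b) = omega q \<eta> k y * poly (p j) y"
        unfolding w_def K by (simp add: p_def poly_prod mult_ac)
    qed
    then have "fact n * E (\<lambda>a. \<Sum>j<n. r ^ a j) = fact n * ?R"
      using S1 by (subst S_E[symmetric]) (simp_all add: sym[of _ "\<lambda>b. r ^ b", unfolded o_def] o_def mult.assoc[symmetric])
    then show ?thesis by (simp add: E_def)
  qed
  assume h: "\<And>b. b < n + k \<Longrightarrow> \<bar>h b\<bar> \<le> B"
  have "S (\<lambda>_. 1) * S (\<lambda>a. (\<Sum>j<n. h (a j))\<^sup>2)
      \<le> (S (\<lambda>a. \<Sum>j<n. h (a j)))\<^sup>2 + real n * B\<^sup>2 * (S (\<lambda>_. 1))\<^sup>2"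
    unfolding S_def V_def by (rule linear_statistic_variance(1)) (use injN wpos h in \<open>auto simp: N_def\<close>)
  then have "C\<^sup>2 * (S (\<lambda>_. 1) * S (\<lambda>a. (\<Sum>j<n. h (a j))\<^sup>2))
      \<le> C\<^sup>2 * ((S (\<lambda>a. \<Sum>j<n. h (a j)))\<^sup>2 + real n * B\<^sup>2 * (S (\<lambda>_. 1))\<^sup>2)"
    by (intro mult_left_mono) auto
  then have main: "(C * S (\<lambda>_. 1)) * (C * S (\<lambda>a. (\<Sum>j<n. h (a j))\<^sup>2))
      \<le> (C * S (\<lambda>a. \<Sum>j<n. h (a j)))\<^sup>2 + real n * B\<^sup>2 * (C * S (\<lambda>_. 1))\<^sup>2"
    by (simp add: power2_eq_square algebra_simps)
  have e2: "C * S (\<lambda>a. (\<Sum>j<n. h (a j))\<^sup>2) = fact n * E (\<lambda>a. (\<Sum>j<n. h (a j))\<^sup>2)"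
    by (rule S_E) (simp only: sym)
  have e1: "C * S (\<lambda>a. \<Sum>j<n. h (a j)) = fact n * E (\<lambda>a. \<Sum>j<n. h (a j))"
    by (rule S_E) (simp only: sym)
  have "(fact n)\<^sup>2 * E (\<lambda>a. (\<Sum>j<n. h (a j))\<^sup>2) \<le> (fact n)\<^sup>2 * ((E (\<lambda>a. \<Sum>j<n. h (a j)))\<^sup>2 + real n * B\<^sup>2)"
    using main unfolding S1 e1 e2 by (simp add: power2_eq_square algebra_simps)
  then show "(\<Sum>l\<in>diagrams n k. pr l * (\<Sum>j<n. h (row_positions n l j))\<^sup>2)
      \<le> (\<Sum>l\<in>diagrams n k. pr l * (\<Sum>j<n. h (row_positions n l j)))\<^sup>2 + real n * B\<^sup>2"
    unfolding E_def by (simp add: mult_le_cancel_left_pos)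
qed

section \<open>Arcsine laws and the limit density\<close>

text \<open>
  The scaling limit depends on \<open>\<gamma>\<close>, on the length \<open>T = c + 1\<close> of the interval, and on a number \<open>\<theta>\<close>
  that distinguishes the two measures. The coordinate \<open>u t = exp (- \<gamma> * t)\<close> is the limit of the
  node \<open>q ^ a\<close> as \<open>a / n\<close> tends to \<open>t\<close>, and \<open>e = u T\<close>.

  The parameter \<open>s\<close> is an auxiliary one; the ensemble corresponds to \<open>s = 1\<close>. For \<open>0 < s < T\<close> the
  quadratic polynomial \<open>Q s\<close> is positive between the two points \<open>centre s \<plusminus> radius s\<close>, and \<open>arcsine s\<close>
  is the density, with respect to \<open>t\<close>, of the arcsine law on the interval between them in the
  coordinate \<open>u t\<close>.
\<close>

locale limit_curve =
  fixes \<gamma> T \<theta> :: real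
  assumes gamma: "\<gamma> \<noteq> 0" and T: "1 < T" and theta: "0 < \<theta>"
begin

definition u :: "real \<Rightarrow> real" where "u t = exp (- \<gamma> * t)"
definition e :: real where "e = exp (- \<gamma> * T)"
definition D :: "real \<Rightarrow> real" where "D s = exp (\<gamma> * s) - \<theta> * exp (- \<gamma> * s)"
definition S :: "real \<Rightarrow> real" where "S s = exp (\<gamma> * s) + \<theta> * exp (- \<gamma> * s)"
definition centre :: "real \<Rightarrow> real" where
  "centre s = (2 * \<theta> * (1 + e) + D s * (1 - \<theta> * e)) / (S s)\<^sup>2"
definition radius :: "real \<Rightarrow> real" where
  "radius s = sqrt ((centre s)\<^sup>2 - (1 + \<theta> * e)\<^sup>2 / (S s)\<^sup>2)"
definition Q :: "real \<Rightarrow> real \<Rightarrow> real" where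
  "Q s y = 4 * \<theta> * (1 - y) * (y - e) - (y * D s - (1 - \<theta> * e))\<^sup>2"
definition arcsine :: "real \<Rightarrow> real \<Rightarrow> real" where
  "arcsine s t = (if Q s (u t) > 0 then \<bar>\<gamma>\<bar> * u t * S s / (pi * sqrt (Q s (u t))) else 0)"

lemma e_pos: "0 < e" by (simp add: e_def)
lemma u_pos: "0 < u t" by (simp add: u_def)
lemma S_pos: "0 < S s" unfolding S_def using theta by (intro add_pos_pos) auto

lemma S_D: "(S s)\<^sup>2 = (D s)\<^sup>2 + 4 * \<theta>"
proof -
  have "exp (\<gamma> * s) * exp (- \<gamma> * s) = 1" by (simp flip: exp_add)
  moreover have "(x + \<theta> * y)\<^sup>2 = (x - \<theta> * y)\<^sup>2 + 4 * \<theta> * (x * y)" for x y :: real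
    by (simp add: power2_eq_square algebra_simps)
  ultimately show ?thesis by (simp add: S_def D_def)
qed

lemma same_sign_factors:
  assumes t: "0 < t" "t < T"
  shows "0 < (1 - u t) * (1 - e / u t)"
proof -
  have eu: "e / u t = exp (- \<gamma> * (T - t))" by (simp add: e_def u_def algebra_simps flip: exp_diff)
  show ?thesis
  proof (cases "0 < \<gamma>")
    case True
    then show ?thesis using t unfolding eu unfolding u_def by (intro mult_pos_pos) auto
  next
    case False
    then have "\<gamma> < 0" using gamma by simp
    then show ?thesis using t unfolding eu unfolding u_def
      by (intro mult_neg_neg) (auto simp: mult_less_0_iff)
  qed
qed

lemma inside_pos:
  assumes "0 < t" "t < T"
  shows "0 < (1 - u t) * (u t - e)"
proof -
  have "0 < u t * ((1 - u t) * (1 - e / u t))"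
    using same_sign_factors[of t] assms by (intro mult_pos_pos[OF u_pos]) auto
  moreover have "u t * ((1 - u t) * (1 - e / u t)) = (1 - u t) * (u t - e)"
    using u_pos[of t] by (simp add: field_simps)
  ultimately show ?thesis by simp
qed

lemma outside_nonpos:
  assumes "t \<le> 0 \<or> T \<le> t"
  shows "(1 - u t) * (u t - e) \<le> 0"
proof (cases "0 < \<gamma>")
  case True
  from assms show ?thesis
  proof
    assume "t \<le> 0"
    then have "1 \<le> u t" "e \<le> 1" using True T by (auto simp: u_def e_def mult_nonneg_nonpos)
    then show ?thesis by (intro mult_nonpos_nonneg) auto
  next
    assume "T \<le> t"
    then have "u t \<le> e" "e \<le> 1" using True T by (auto simp: u_def e_def)
    then show ?thesis by (intro mult_nonneg_nonpos) auto
  qed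
next
  case False
  then have g: "\<gamma> < 0" using gamma by simp
  from assms show ?thesis
  proof
    assume "t \<le> 0"
    then have "u t \<le> 1" "1 \<le> e" using g T by (auto simp: u_def e_def mult_nonpos_nonpos mult_nonpos_nonneg)
    then show ?thesis by (intro mult_nonneg_nonpos) auto
  next
    assume "T \<le> t"
    then have "e \<le> u t" "1 \<le> e" using g T by (auto simp: u_def e_def mult_nonpos_nonneg)
    then show ?thesis by (intro mult_nonpos_nonneg) auto
  qed
qed

text \<open>
  Everything rests on the identity
  \<open>centre s * (S s)\<^sup>2 - (1 + \<theta> * e) * S s = 2 * \<theta> * (1 - u s) * (1 - e / u s)\<close>, whose right-hand side is
  positive because \<open>u s\<close> lies strictly between \<open>1\<close> and \<open>e\<close>.
\<close>

lemma centre_bounds: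
  assumes "0 < s" "s < T"
  shows "1 + \<theta> * e < centre s * S s" "0 < centre s" "0 < radius s"
    "(radius s)\<^sup>2 = (centre s)\<^sup>2 - (1 + \<theta> * e)\<^sup>2 / (S s)\<^sup>2" "0 < centre s - radius s"
proof -
  have "2 * \<theta> * (1 + e) + D s * (1 - \<theta> * e) - (1 + \<theta> * e) * S s = 2 * \<theta> * ((1 - u s) * (1 - e / u s))"
  proof -
    have "S s = 1 / u s + \<theta> * u s" "D s = 1 / u s - \<theta> * u s"
      by (simp_all add: S_def D_def u_def exp_minus field_simps)
    moreover have "2 * \<theta> * (1 + e) + (x - \<theta> * y) * (1 - \<theta> * e) - (1 + \<theta> * e) * (x + \<theta> * y)
        = 2 * \<theta> * ((1 - y) * (1 - e * x))" if "x * y = 1" for x y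
    proof -
      have "(1 - y) * (1 - e * x) = 1 - y - e * x + e * (x * y)" by (simp add: algebra_simps)
      then show ?thesis unfolding that by (simp add: algebra_simps)
    qed
    from this[of "1 / u s" "u s"] have "2 * \<theta> * (1 + e) + (1 / u s - \<theta> * u s) * (1 - \<theta> * e)
        - (1 + \<theta> * e) * (1 / u s + \<theta> * u s) = 2 * \<theta> * ((1 - u s) * (1 - e / u s))"
      using u_pos[of s] by simp
    ultimately show ?thesis by simp
  qed
  also have "\<dots> > 0" using same_sign_factors[of s] assms theta by simp
  finally have "(1 + \<theta> * e) * S s < centre s * (S s)\<^sup>2" using S_pos[of s] by (simp add: centre_def)
  then show b: "1 + \<theta> * e < centre s * S s" using S_pos[of s] by (simp add: power2_eq_square)
  have pos: "0 < 1 + \<theta> * e" using theta e_pos by (intro add_pos_pos) auto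
  then have "0 < centre s * S s" using b by linarith
  then show c: "0 < centre s" using S_pos[of s] by (simp add: zero_less_mult_iff)
  have "(1 + \<theta> * e)\<^sup>2 < (centre s * S s)\<^sup>2" using b pos by (intro power_strict_mono) auto
  then have lt: "(1 + \<theta> * e)\<^sup>2 / (S s)\<^sup>2 < (centre s)\<^sup>2"
    using S_pos[of s] by (simp add: field_simps power_mult_distrib)
  then show "0 < radius s" by (simp add: radius_def)
  show eq: "(radius s)\<^sup>2 = (centre s)\<^sup>2 - (1 + \<theta> * e)\<^sup>2 / (S s)\<^sup>2" using lt by (simp add: radius_def)
  have "0 < (1 + \<theta> * e)\<^sup>2 / (S s)\<^sup>2" using pos S_pos[of s] by (intro divide_pos_pos zero_less_power)
  then have "(radius s)\<^sup>2 < (centre s)\<^sup>2" using eq by linarith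
  then show "0 < centre s - radius s" using c by (simp add: power2_less_imp_less)
qed

lemma Q_factor:
  assumes "0 < s" "s < T"
  shows "Q s y = (S s)\<^sup>2 * ((radius s)\<^sup>2 - (y - centre s)\<^sup>2)"
proof -
  have c: "centre s * (S s)\<^sup>2 = 2 * \<theta> * (1 + e) + D s * (1 - \<theta> * e)"
    using S_pos[of s] by (simp add: centre_def)
  have "(S s)\<^sup>2 * ((radius s)\<^sup>2 - (y - centre s)\<^sup>2)
      = - (1 + \<theta> * e)\<^sup>2 + 2 * y * (centre s * (S s)\<^sup>2) - y\<^sup>2 * (S s)\<^sup>2"
    unfolding centre_bounds(4)[OF assms] using S_pos[of s]
    by (simp add: field_simps power2_eq_square)
  also have "\<dots> = Q s y"
    unfolding c unfolding S_D Q_def by (simp add: power2_eq_square algebra_simps)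
  finally show ?thesis ..
qed

text \<open>
  Under \<open>y = centre s + sgn \<gamma> * radius s * cos x\<close> the arcsine law becomes uniform on \<open>[0, \<pi>]\<close>. The
  sign makes \<open>t = - ln y / \<gamma>\<close> an increasing function of \<open>x\<close>.
\<close>

definition arcsine_moment :: "nat \<Rightarrow> real \<Rightarrow> real" where
  "arcsine_moment m s = integral {0..pi} (\<lambda>x. (centre s + sgn \<gamma> * radius s * cos x) ^ m) / pi"

lemma arcsine_node_pos:
  assumes "0 < s" "s < T"
  shows "0 < centre s + sgn \<gamma> * radius s * cos x"
proof -
  have "\<bar>sgn \<gamma> * cos x\<bar> \<le> 1" using gamma by (simp add: abs_mult sgn_if)
  then have "- 1 \<le> sgn \<gamma> * cos x" by linarith
  then have "radius s * (- 1) \<le> radius s * (sgn \<gamma> * cos x)"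
    using centre_bounds(3)[OF assms] by (intro mult_left_mono) auto
  then show ?thesis using centre_bounds(5)[OF assms] by (simp add: mult_ac)
qed

lemma borel_measurable_arcsine [measurable]: "arcsine s \<in> borel_measurable borel"
  unfolding arcsine_def Q_def u_def by measurable

lemma arcsine_nonneg: "0 \<le> arcsine s t"
  unfolding arcsine_def using u_pos S_pos by (auto intro!: divide_nonneg_nonneg mult_nonneg_nonneg simp: less_imp_le)

lemma nn_integral_arcsine:
  assumes s: "0 < s" "s < T"
  shows "(\<integral>\<^sup>+t. ennreal (u t ^ m * arcsine s t) \<partial>lborel) = ennreal (arcsine_moment m s)"
proof -
  define g where "g x = - ln (centre s + sgn \<gamma> * radius s * cos x) / \<gamma>" for x
  define g' where "g' x = radius s * sin x / (\<bar>\<gamma>\<bar> * (centre s + sgn \<gamma> * radius s * cos x))" for x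
  note pos = arcsine_node_pos[OF s]
  have ug: "u (g x) = centre s + sgn \<gamma> * radius s * cos x" for x
    using pos[of x] gamma by (simp add: u_def g_def)
  have der: "(g has_real_derivative g' x) (at x)" for x
  proof -
    have "(g has_real_derivative - ((sgn \<gamma> * radius s * - sin x) / (centre s + sgn \<gamma> * radius s * cos x)) / \<gamma>) (at x)"
      unfolding g_def using pos[of x] gamma by (auto intro!: derivative_eq_intros)
    moreover have "- ((sgn \<gamma> * radius s * - sin x) / (centre s + sgn \<gamma> * radius s * cos x)) / \<gamma> = g' x"
      unfolding g'_def using gamma by (cases "0 < \<gamma>") (simp_all add: mult_ac)
    ultimately show ?thesis by simp
  qed
  have cont: "continuous_on {0..pi} g'" unfolding g'_def
    using pos gamma by (intro continuous_intros ballI) (metis abs_0_eq less_irrefl mult_eq_0_iff abs_zero abs_eq_0_iff)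
  have nonneg: "0 \<le> g' x" if "x \<in> {0..pi}" for x
    unfolding g'_def using that pos[of x] centre_bounds(3)[OF s]
    by (intro divide_nonneg_nonneg mult_nonneg_nonneg sin_ge_zero) auto
  have supp: "t \<in> {g 0..g pi}" if "Q s (u t) > 0" for t
  proof -
    have "(u t - centre s)\<^sup>2 < (radius s)\<^sup>2"
      using that S_pos[of s] unfolding Q_factor[OF s] by (simp add: zero_less_mult_iff)
    then have "\<bar>u t - centre s\<bar> < radius s"
      using centre_bounds(3)[OF s] power_less_imp_less_base[of "\<bar>u t - centre s\<bar>" 2 "radius s"] by simp
    then have lu: "ln (centre s - radius s) < ln (u t)" "ln (u t) < ln (centre s + radius s)"
      using centre_bounds(5)[OF s] u_pos[of t] by (auto simp: ln_less_cancel_iff)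
    have ut: "ln (u t) = - \<gamma> * t" by (simp add: u_def)
    show ?thesis using lu gamma unfolding ut g_def
      by (cases "0 < \<gamma>") (auto simp: field_simps sgn_if)
  qed
  have "(\<integral>\<^sup>+t. ennreal (u t ^ m * arcsine s t) \<partial>lborel)
      = (\<integral>\<^sup>+t. ennreal (u t ^ m * arcsine s t * indicator {g 0..g pi} t) \<partial>lborel)"
    by (intro nn_integral_cong) (use supp in \<open>auto simp: arcsine_def indicator_def\<close>)
  also have "\<dots> = (\<integral>\<^sup>+x. ennreal (u (g x) ^ m * arcsine s (g x) * g' x * indicator {0..pi} x) \<partial>lborel)"
    by (rule nn_integral_substitution[OF _ der cont nonneg])
      (auto simp: set_borel_measurable_def u_def)
  also have "\<dots> = (\<integral>\<^sup>+x. ennreal (indicator {0..pi} x * ((centre s + sgn \<gamma> * radius s * cos x) ^ m / pi)) \<partial>lborel)"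
  proof (rule nn_integral_cong_AE)
    have "AE x in lborel. x \<noteq> 0 \<and> x \<noteq> pi" by (intro AE_conjI AE_lborel_singleton)
    then show "AE x in lborel. ennreal (u (g x) ^ m * arcsine s (g x) * g' x * indicator {0..pi} x)
       = ennreal (indicator {0..pi} x * ((centre s + sgn \<gamma> * radius s * cos x) ^ m / pi))"
    proof eventually_elim
      case (elim x)
      show ?case
      proof (cases "x \<in> {0..pi}")
        case True
        then have sx: "0 < sin x" using elim by (intro sin_gt_zero) auto
        have rs: "0 < radius s * sin x" using sx centre_bounds(3)[OF s] by simp
        have "(radius s)\<^sup>2 - (u (g x) - centre s)\<^sup>2 = (radius s * sin x)\<^sup>2"
          unfolding ug power_mult_distrib sin_squared_eq using gamma by (simp add: power_mult_distrib sgn_if algebra_simps)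
        then have Q: "Q s (u (g x)) = (S s * (radius s * sin x))\<^sup>2"
          unfolding Q_factor[OF s] by (simp add: power_mult_distrib)
        moreover have "sqrt (Q s (u (g x))) = S s * (radius s * sin x)"
          unfolding Q using rs S_pos[of s] by (intro real_sqrt_unique) auto
        moreover have "0 < Q s (u (g x))" unfolding Q using mult_pos_pos[OF S_pos[of s] rs] by (rule zero_less_power)
        ultimately have "arcsine s (g x) = \<bar>\<gamma>\<bar> * u (g x) / (pi * (radius s * sin x))"
          using S_pos[of s] by (simp add: arcsine_def)
        then have "arcsine s (g x) * g' x = 1 / pi"
          using rs pos[of x] gamma sx centre_bounds(3)[OF s] by (simp add: g'_def ug)
        then show ?thesis using True by (simp add: ug mult.assoc)
      qed simp
    qed
  qed
  also have "\<dots> = ennreal (arcsine_moment m s)"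
  proof (rule nn_integral_has_integral_lebesgue)
    show "0 \<le> (centre s + sgn \<gamma> * radius s * cos x) ^ m / pi" for x
      using pos[of x] by simp
    have "continuous_on {0..pi} (\<lambda>x. (centre s + sgn \<gamma> * radius s * cos x) ^ m)"
      by (intro continuous_intros)
    then have "((\<lambda>x. (centre s + sgn \<gamma> * radius s * cos x) ^ m) has_integral pi * arcsine_moment m s) {0..pi}"
      unfolding arcsine_moment_def by (simp add: integrable_continuous_real integrable_integral)
    from has_integral_divide[OF this, of pi]
    show "((\<lambda>x. (centre s + sgn \<gamma> * radius s * cos x) ^ m / pi) has_integral arcsine_moment m s) {0..pi}" by simp
  qed
  finally show ?thesis .
qed

lemma arcsine_moment_nonneg:
  assumes s: "0 < s" "s < T"
  shows "0 \<le> arcsine_moment m s"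
  unfolding arcsine_moment_def
  using arcsine_node_pos[OF s] by (intro divide_nonneg_nonneg integral_nonneg integrable_continuous_real continuous_intros)
    (auto intro!: zero_le_power less_imp_le)

end

lemma arccos_density_cont: "continuous_on UNIV arccos_density"
proof -
  have eq: "arccos_density x = arccos (max (- 1) (min 1 x)) / pi" for x
    by (auto simp: arccos_density_def max_def min_def)
  show ?thesis unfolding eq
    by (intro continuous_intros) (auto simp: max_def min_def)
qed

lemma arccos_density_bounds: "0 \<le> arccos_density x" "arccos_density x \<le> 1"
  by (auto simp: arccos_density_def arccos_lbound arccos_ubound)

text \<open>
  Clipping costs differentiability only at \<open>\<plusminus>1\<close>; elsewhere the derivative is minus an arcsine density,
  or zero.
\<close>

lemma DERIV_arccos_density:
  assumes "\<bar>x\<bar> \<noteq> 1"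
  shows "(arccos_density has_real_derivative (if \<bar>x\<bar> < 1 then - 1 / (pi * sqrt (1 - x\<^sup>2)) else 0)) (at x)"
proof -
  consider "\<bar>x\<bar> < 1" | "x > 1" | "x < - 1" using assms by linarith
  then show ?thesis
  proof cases
    case 1
    have "((\<lambda>x. arccos x / pi) has_real_derivative inverse (- sqrt (1 - x\<^sup>2)) / pi) (at x)"
      by (intro DERIV_cdivide DERIV_arccos) (use 1 in auto)
    moreover have "eventually (\<lambda>y. arccos_density y = arccos y / pi) (nhds x)"
    proof -
      have "eventually (\<lambda>y. y \<in> {-1<..<1}) (nhds x)" using 1 by (intro eventually_nhds_in_open) auto
      then show ?thesis by eventually_elim (auto simp: arccos_density_def)
    qed
    ultimately have "(arccos_density has_real_derivative inverse (- sqrt (1 - x\<^sup>2)) / pi) (at x)"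
      by (subst DERIV_cong_ev[OF refl _ refl]) auto
    then show ?thesis using 1 by (simp add: divide_inverse mult_ac)
  next
    case 2
    have "eventually (\<lambda>y. y \<in> {1<..}) (nhds x)" using 2 by (intro eventually_nhds_in_open) auto
    then have "eventually (\<lambda>y. arccos_density y = 0) (nhds x)"
      by eventually_elim (auto simp: arccos_density_def)
    then have "(arccos_density has_real_derivative 0) (at x)"
      by (subst DERIV_cong_ev[OF refl _ refl]) auto
    then show ?thesis using 2 by simp
  next
    case 3
    have "eventually (\<lambda>y. y \<in> {..<-1}) (nhds x)" using 3 by (intro eventually_nhds_in_open) auto
    then have "eventually (\<lambda>y. arccos_density y = 1) (nhds x)"
      by eventually_elim (auto simp: arccos_density_def)
    then have "(arccos_density has_real_derivative 0) (at x)"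
      by (subst DERIV_cong_ev[OF refl _ refl]) auto
    then show ?thesis using 3 by simp
  qed
qed

lemma poisson_integral:
  fixes A B :: real
  assumes AB: "\<bar>B\<bar> < A"
  shows "((\<lambda>x. 1 / (A - B * cos x)) has_integral pi / sqrt (A\<^sup>2 - B\<^sup>2)) {0..pi}"
proof -
  define w where "w = sqrt (A\<^sup>2 - B\<^sup>2)"
  have sq: "B\<^sup>2 < A\<^sup>2" using AB by (metis abs_ge_zero power2_abs power_strict_mono zero_less_numeral)
  then have w: "0 < w" "w\<^sup>2 = A\<^sup>2 - B\<^sup>2" by (simp_all add: w_def)
  have A: "0 < A" using AB by linarith
  define r where "r = B / (A + w)"
  have r1: "r * (A + w) = B" using A w by (simp add: r_def)
  have r2: "r\<^sup>2 * (A + w) = A - w"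
  proof -
    have "(r\<^sup>2 * (A + w)) * (A + w) = (A - w) * (A + w)"
    proof -
      have "(r\<^sup>2 * (A + w)) * (A + w) = (r * (A + w))\<^sup>2" by (simp add: power2_eq_square)
      also have "\<dots> = (A - w) * (A + w)" unfolding r1 using w(2) by (simp add: power2_eq_square algebra_simps)
      finally show ?thesis .
    qed
    then show ?thesis using A w by simp
  qed
  have rlt: "\<bar>r\<bar> < 1" unfolding r_def using AB w A by (simp add: abs_divide)
  have den: "0 < 1 - r * cos x" for x
  proof -
    have "\<bar>r * cos x\<bar> \<le> \<bar>r\<bar> * 1" unfolding abs_mult by (intro mult_left_mono) auto
    then show ?thesis using rlt by linarith
  qed
  have ABpos: "0 < A - B * cos x" for x
  proof -
    have "\<bar>B * cos x\<bar> \<le> \<bar>B\<bar> * 1" unfolding abs_mult by (intro mult_left_mono) auto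
    then show ?thesis using AB by linarith
  qed
  \<comment> \<open>The Fourier form of the primitive: it is smooth on all of \<open>[0, \<pi>]\<close>, whereas the half-angle
     substitution is singular at \<open>\<pi>\<close>.\<close>
  define F where "F x = (x + 2 * arctan (r * sin x / (1 - r * cos x))) / w" for x
  have der: "(F has_vector_derivative 1 / (A - B * cos x)) (at x within {0..pi})" for x
  proof -
    define d where "d = 1 - r * cos x"
    have d: "0 < d" using den by (simp add: d_def)
    define n where "n = r * cos x * d - (r * sin x) * (r * sin x)"
    have inner: "((\<lambda>x. r * sin x / (1 - r * cos x)) has_real_derivative n / (d * d)) (at x)"
      using d unfolding n_def d_def by (auto intro!: derivative_eq_intros)
    have arc: "((\<lambda>x. arctan (r * sin x / (1 - r * cos x))) has_real_derivative inverse (1 + (r * sin x / d)\<^sup>2) * (n / (d * d))) (at x)"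
      using DERIV_chain2[OF DERIV_arctan inner] by (simp add: d_def)
    have "(F has_real_derivative (1 + 2 * (inverse (1 + (r * sin x / d)\<^sup>2) * (n / (d * d)))) / w) (at x)"
      unfolding F_def by (rule DERIV_cdivide[OF DERIV_add[OF DERIV_ident DERIV_cmult[OF arc]]])
    moreover have "(1 + 2 * (inverse (1 + (r * sin x / d)\<^sup>2) * (n / (d * d)))) / w = 1 / (A - B * cos x)"
    proof -
      define k where "k = d * d + (r * sin x) * (r * sin x)"
      have k: "0 < k" unfolding k_def using d by (intro add_pos_nonneg) auto
      have nk: "inverse (1 + (r * sin x / d)\<^sup>2) * (n / (d * d)) = n / k"
      proof -
        have "1 + (r * sin x / d)\<^sup>2 = k / (d * d)" using d by (simp add: k_def power2_eq_square field_simps)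
        then show ?thesis using d k by simp
      qed
      have rs: "(r * sin x) * (r * sin x) = r\<^sup>2 * (1 - (cos x)\<^sup>2)"
        unfolding sin_squared_eq[symmetric] by (simp add: power2_eq_square)
      have kn: "k + 2 * n = 1 - r\<^sup>2" "k = 1 + r\<^sup>2 - 2 * r * cos x"
        unfolding k_def n_def rs d_def by (simp_all add: power2_eq_square algebra_simps)
      have "k * (A + w) = (A + w) + r\<^sup>2 * (A + w) - 2 * (r * (A + w)) * cos x"
        unfolding kn by (simp add: algebra_simps)
      then have kA: "k * (A + w) = 2 * (A - B * cos x)" unfolding r1 r2 by (simp add: algebra_simps)
      have rA: "(1 - r\<^sup>2) * (A + w) = 2 * w" using r2 by (simp add: algebra_simps)
      have "(1 + 2 * (n / k)) / w = ((k + 2 * n) * (A + w)) / (k * (A + w)) / w"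
      proof -
        have "1 + 2 * (n / k) = (k + 2 * n) / k" using k by (simp add: field_simps)
        also have "\<dots> = ((k + 2 * n) * (A + w)) / (k * (A + w))" using A w by simp
        finally show ?thesis by simp
      qed
      also have "\<dots> = 1 / (A - B * cos x)"
      proof -
        have "2 * w / (2 * z) / w = 1 / z" for z using w by simp
        then show ?thesis unfolding kn(1) rA kA .
      qed
      finally show ?thesis unfolding nk .
    qed
    ultimately have "(F has_real_derivative 1 / (A - B * cos x)) (at x)" by simp
    then show ?thesis
      by (simp add: has_real_derivative_iff_has_vector_derivative has_vector_derivative_at_within)
  qed
  have "((\<lambda>x. 1 / (A - B * cos x)) has_integral F pi - F 0) {0..pi}"
    by (rule fundamental_theorem_of_calculus) (use der in auto)
  then show ?thesis by (simp add: F_def w_def)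
qed

lemma powser_coeff_unique:
  fixes a b :: "nat \<Rightarrow> real"
  assumes "0 < \<delta>" and a: "\<And>v. \<bar>v\<bar> < \<delta> \<Longrightarrow> (\<lambda>m. a m * v ^ m) sums f v"
    and b: "\<And>v. \<bar>v\<bar> < \<delta> \<Longrightarrow> (\<lambda>m. b m * v ^ m) sums f v"
  shows "a m = b m"
proof (rule ccontr)
  assume ne: "a m \<noteq> b m"
  have c: "(\<lambda>m. (a m - b m) * (v - 0) ^ m) sums 0" if "\<bar>v\<bar> < \<delta>" for v
    using sums_diff[OF a[OF that] b[OF that]] by (simp add: algebra_simps)
  have "(\<lambda>m. (a m - b m) * 0 ^ m) sums (a 0 - b 0)" by (rule powser_sums_zero)
  then have "a 0 = b 0" using c[of 0] \<open>0 < \<delta>\<close> sums_unique2 by fastforce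
  then have "0 < m" using ne by (cases m) auto
  obtain s where s: "0 < s" "\<And>z. z \<in> cball (0::real) s - {0} \<Longrightarrow> (\<lambda>_. 0 :: real) z \<noteq> 0"
    by (rule powser_0_nonzero[of \<delta> 0 "\<lambda>m. a m - b m" "\<lambda>_. 0" m])
      (use \<open>0 < \<delta>\<close> c ne \<open>0 < m\<close> in auto)
  show False using s(2)[of s] s(1) by auto
qed

context limit_curve
begin

text \<open>
  For \<open>s = 1\<close> this is the argument of the arccosine in both densities of the theorem, in the
  coordinate \<open>u t\<close>; as a function of \<open>s\<close> it decreases, starting from a value \<open>\<ge> 1\<close> at \<open>s = 0\<close>.
\<close>

definition h :: "real \<Rightarrow> real \<Rightarrow> real" where
  "h s t = - sgn \<gamma> * (u t * D s - (1 - \<theta> * e)) / (2 * sqrt (\<theta> * ((1 - u t) * (u t - e))))"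

definition rho :: "real \<Rightarrow> real" where "rho t = arccos_density (h 1 t)"

lemma DERIV_D: "(D has_real_derivative \<gamma> * S s) (at s)"
  unfolding D_def S_def by (auto intro!: derivative_eq_intros simp: algebra_simps)

text \<open>
  The density is a mixture of arcsine densities. Since \<open>Q s (u t)\<close> is a positive multiple of
  \<open>1 - (h s t)\<^sup>2\<close>, the chain rule makes \<open>arcsine s t\<close> the \<open>s\<close>-derivative of \<open>arccos_density (h s t)\<close>,
  except at the at most two parameters where \<open>h s t = \<plusminus>1\<close>. At \<open>s = 0\<close> the inequality of arithmetic
  and geometric means gives \<open>h 0 t \<ge> 1\<close>, so that the primitive starts at \<open>0\<close>.
\<close>

lemma nn_integral_arcsine_parameter:
  assumes t: "0 < t" "t < T"
  shows "(\<integral>\<^sup>+s. ennreal (arcsine s t) * indicator {0..1} s \<partial>lborel) = ennreal (rho t)"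
proof -
  define R where "R = sqrt (\<theta> * ((1 - u t) * (u t - e)))"
  have R2: "R\<^sup>2 = \<theta> * ((1 - u t) * (u t - e))" "0 < R"
    using inside_pos[OF t] theta by (simp_all add: R_def)
  have h_def': "h s t = - sgn \<gamma> * (u t * D s - (1 - \<theta> * e)) / (2 * R)" for s by (simp add: h_def R_def)
  have sg: "sgn \<gamma> * \<gamma> = \<bar>\<gamma>\<bar>" "(sgn \<gamma>)\<^sup>2 = 1" using gamma by (auto simp: sgn_if)
  have dh: "((\<lambda>s. h s t) has_real_derivative - (\<bar>\<gamma>\<bar> * u t * S s / (2 * R))) (at s)" for s
  proof -
    have "((\<lambda>s. h s t) has_real_derivative - sgn \<gamma> * (u t * (\<gamma> * S s)) / (2 * R)) (at s)"
      unfolding h_def' using R2(2) by (auto intro!: derivative_eq_intros DERIV_D)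
    moreover have "- sgn \<gamma> * (u t * (\<gamma> * S s)) / (2 * R) = - (\<bar>\<gamma>\<bar> * u t * S s / (2 * R))"
    proof -
      have "sgn \<gamma> * (u t * (\<gamma> * S s)) = (sgn \<gamma> * \<gamma>) * u t * S s" by simp
      then show ?thesis unfolding sg(1) by simp
    qed
    ultimately show ?thesis by (simp only:)
  qed
  have Qh: "Q s (u t) = (2 * R)\<^sup>2 * (1 - (h s t)\<^sup>2)" for s
  proof -
    have "(2 * R)\<^sup>2 * (h s t)\<^sup>2 = (sgn \<gamma>)\<^sup>2 * (u t * D s - (1 - \<theta> * e))\<^sup>2"
      unfolding h_def' using R2(2) by (simp add: power_divide power_mult_distrib)
    then show ?thesis unfolding Q_def sg(2) by (simp add: algebra_simps R2(1))
  qed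
  have "inj (\<lambda>s. h s t)"
  proof -
    have "h y t < h x t" if "x < y" for x y
    proof (rule DERIV_neg_imp_decreasing[OF that])
      fix s
      have "- (\<bar>\<gamma>\<bar> * u t * S s / (2 * R)) < 0" using gamma u_pos[of t] S_pos[of s] R2(2) by simp
      then show "\<exists>y. ((\<lambda>s. h s t) has_real_derivative y) (at s) \<and> y < 0" using dh by blast
    qed
    then show ?thesis by (intro linorder_injI) force
  qed
  then have fin: "finite ((\<lambda>s. h s t) -` {1, - 1})" by (intro finite_vimageI) auto
  have "((\<lambda>s. arcsine s t) has_integral (arccos_density (h 1 t) - arccos_density (h 0 t))) {0..1}"
  proof (rule fundamental_theorem_of_calculus_interior_strong[OF fin])
    have "continuous_on {0..1} (\<lambda>s. h s t)" using dh by (intro DERIV_continuous_on) (blast intro: has_field_derivative_at_within)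
    then show "continuous_on {0..1} (\<lambda>s. arccos_density (h s t))"
      by (rule continuous_on_compose2[OF arccos_density_cont]) auto
    fix s assume s: "s \<in> {0<..<1} - (\<lambda>s. h s t) -` {1, - 1}"
    then have ne: "\<bar>h s t\<bar> \<noteq> 1" by auto
    from DERIV_chain2[OF DERIV_arccos_density[OF ne] dh]
    have "((\<lambda>s. arccos_density (h s t)) has_real_derivative
      (if \<bar>h s t\<bar> < 1 then - 1 / (pi * sqrt (1 - (h s t)\<^sup>2)) else 0) * - (\<bar>\<gamma>\<bar> * u t * S s / (2 * R))) (at s)" .
    moreover have "(if \<bar>h s t\<bar> < 1 then - 1 / (pi * sqrt (1 - (h s t)\<^sup>2)) else 0) * - (\<bar>\<gamma>\<bar> * u t * S s / (2 * R)) = arcsine s t"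
    proof (cases "\<bar>h s t\<bar> < 1")
      case True
      then have "0 < 1 - (h s t)\<^sup>2" by (simp add: abs_square_less_1)
      then have "0 < Q s (u t)" "sqrt (Q s (u t)) = 2 * R * sqrt (1 - (h s t)\<^sup>2)"
        unfolding Qh using R2(2) by (auto simp: real_sqrt_mult)
      then show ?thesis using True by (simp add: arcsine_def)
    next
      case False
      then have "1 - (h s t)\<^sup>2 \<le> 0" by (metis abs_square_less_1 diff_le_0_iff_le linorder_not_le)
      then have "\<not> 0 < Q s (u t)" unfolding Qh by (simp add: mult_le_0_iff not_less)
      then show ?thesis using False by (simp add: arcsine_def)
    qed
    ultimately show "((\<lambda>s. arccos_density (h s t)) has_vector_derivative arcsine s t) (at s)"
      by (simp add: has_real_derivative_iff_has_vector_derivative)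
  qed simp
  moreover have "1 \<le> h 0 t"
  proof -
    define a where "a = sgn \<gamma> * (1 - u t)"
    define b where "b = \<theta> * (sgn \<gamma> * (u t - e))"
    have "a * b = (sgn \<gamma>)\<^sup>2 * (\<theta> * ((1 - u t) * (u t - e)))"
      by (simp add: a_def b_def power2_eq_square)
    then have ab: "a * b = R\<^sup>2" unfolding sg(2) R2 by simp
    have "0 \<le> a"
    proof (cases "0 < \<gamma>")
      case False
      then have "\<gamma> < 0" using gamma by simp
      then have "0 \<le> - (\<gamma> * t)" using t by (simp add: mult_nonpos_nonneg)
      then show ?thesis using \<open>\<gamma> < 0\<close> by (simp add: a_def u_def)
    qed (use t in \<open>simp add: a_def u_def\<close>)
    moreover have "0 < a * b" using ab R2(2) by simp
    ultimately have "0 < a" "0 < b" by (auto simp: zero_less_mult_iff)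
    then have "2 * sqrt (a * b) \<le> a + b" using arith_geo_mean_sqrt[of a b] by simp
    then have "2 * R \<le> a + b" unfolding ab using R2(2) by simp
    moreover have "- sgn \<gamma> * (u t * D 0 - (1 - \<theta> * e)) = a + b" by (simp add: a_def b_def D_def algebra_simps)
    ultimately show ?thesis unfolding h_def' using R2(2) by simp
  qed
  then have "arccos_density (h 0 t) = 0" by (auto simp: arccos_density_def)
  ultimately have "((\<lambda>s. arcsine s t) has_integral rho t) {0..1}" by (simp add: rho_def)
  from nn_integral_has_integral_lebesgue'[OF arcsine_nonneg this] show ?thesis .
qed

lemma continuous_on_rho: "continuous_on {0<..<T} rho"
proof -
  have "continuous_on {0<..<T} (\<lambda>t. h 1 t)" unfolding h_def u_def
  proof (intro continuous_intros ballI)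
    fix t assume "t \<in> {0<..<T}"
    then have "0 < (1 - u t) * (u t - e)" by (intro inside_pos) auto
    then have "0 < \<theta> * ((1 - exp (- \<gamma> * t)) * (exp (- \<gamma> * t) - e))"
      unfolding u_def by (rule mult_pos_pos[OF theta])
    from real_sqrt_gt_zero[OF this]
    show "2 * sqrt (\<theta> * ((1 - exp (- \<gamma> * t)) * (exp (- \<gamma> * t) - e))) \<noteq> 0" by linarith
  qed
  then show ?thesis unfolding rho_def
    by (rule continuous_on_compose2[OF arccos_density_cont]) auto
qed

text \<open>
  Tonelli's theorem for the mixture: moments of the density are integrals over \<open>s\<close> of moments of
  arcsine laws. For \<open>t\<close> outside \<open>(0, T)\<close> every \<open>Q s (u t)\<close> is at most zero, so the inner integral
  may be taken over the whole line.
\<close>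

lemma nn_integral_rho_moment:
  assumes I: "(arcsine_moment m has_integral I) {0..1}"
  shows "(\<integral>\<^sup>+t. ennreal (u t ^ m * rho t) * indicator {0<..<T} t \<partial>lborel) = ennreal I" and "0 \<le> I"
proof -
  have nonneg: "0 \<le> arcsine_moment m s" if "s \<in> {0<..1}" for s
    using arcsine_moment_nonneg[of s m] that T by simp
  have I': "(arcsine_moment m has_integral I) {0<..1}"
    using I by (subst has_integral_spike_set_eq[of _ "{0..1}"]) (auto intro: negligible_subset[of "{0}"])
  show "0 \<le> I" by (rule has_integral_nonneg[OF I' nonneg])
  have meas: "(\<lambda>(s, t). ennreal (u t ^ m * arcsine s t) * indicator {0..1} s) \<in> borel_measurable (lborel \<Otimes>\<^sub>M lborel)"
    unfolding arcsine_def Q_def u_def S_def D_def by measurable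
  have "(\<integral>\<^sup>+t. ennreal (u t ^ m * rho t) * indicator {0<..<T} t \<partial>lborel)
     = (\<integral>\<^sup>+t. (\<integral>\<^sup>+s. ennreal (u t ^ m * arcsine s t) * indicator {0..1} s \<partial>lborel) \<partial>lborel)"
  proof (rule nn_integral_cong)
    fix t
    have *: "(\<integral>\<^sup>+s. ennreal (u t ^ m * arcsine s t) * indicator {0..1} s \<partial>lborel)
        = ennreal (u t ^ m) * (\<integral>\<^sup>+s. ennreal (arcsine s t) * indicator {0..1} s \<partial>lborel)"
    proof -
      have [measurable]: "(\<lambda>s. ennreal (arcsine s t) * indicator {0..1} s) \<in> borel_measurable lborel"
        unfolding arcsine_def Q_def u_def S_def D_def by measurable
      have "(\<integral>\<^sup>+s. ennreal (u t ^ m * arcsine s t) * indicator {0..1} s \<partial>lborel)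
          = (\<integral>\<^sup>+s. ennreal (u t ^ m) * (ennreal (arcsine s t) * indicator {0..1} s) \<partial>lborel)"
        using u_pos[of t] arcsine_nonneg by (simp add: ennreal_mult less_imp_le mult.assoc)
      also have "\<dots> = ennreal (u t ^ m) * (\<integral>\<^sup>+s. ennreal (arcsine s t) * indicator {0..1} s \<partial>lborel)"
        by (rule nn_integral_cmult) measurable
      finally show ?thesis .
    qed
    show "ennreal (u t ^ m * rho t) * indicator {0<..<T} t
       = (\<integral>\<^sup>+s. ennreal (u t ^ m * arcsine s t) * indicator {0..1} s \<partial>lborel)"
    proof (cases "t \<in> {0<..<T}")
      case True
      then show ?thesis unfolding * using nn_integral_arcsine_parameter[of t] u_pos[of t]
        arccos_density_bounds by (simp add: ennreal_mult rho_def less_imp_le)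
    next
      case False
      then have out: "\<theta> * ((1 - u t) * (u t - e)) \<le> 0"
        using outside_nonpos[of t] theta by (auto simp: mult_le_0_iff[of \<theta>] not_less)
      have Qeq: "Q s (u t) = 4 * (\<theta> * ((1 - u t) * (u t - e))) - (u t * D s - (1 - \<theta> * e))\<^sup>2" for s
        by (simp add: Q_def)
      have "Q s (u t) \<le> 0" for s
        using out Qeq[of s] zero_le_power2[of "u t * D s - (1 - \<theta> * e)"] by linarith
      then have "arcsine s t = 0" for s by (simp add: arcsine_def leD)
      then show ?thesis using False by simp
    qed
  qed
  also have "\<dots> = (\<integral>\<^sup>+s. (\<integral>\<^sup>+t. ennreal (u t ^ m * arcsine s t) * indicator {0..1} s \<partial>lborel) \<partial>lborel)"
    by (rule lborel_pair.Fubini'[OF meas])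
  also have "\<dots> = (\<integral>\<^sup>+s. ennreal (arcsine_moment m s) * indicator {0<..1} s \<partial>lborel)"
  proof (rule nn_integral_cong_AE)
    have "AE s in lborel. s \<noteq> (0 :: real)" by (rule AE_lborel_singleton)
    then show "AE s in lborel. (\<integral>\<^sup>+t. ennreal (u t ^ m * arcsine s t) * indicator {0..1} s \<partial>lborel)
        = ennreal (arcsine_moment m s) * indicator {0<..1} s"
    proof eventually_elim
      case (elim s)
      show ?case
      proof (cases "s \<in> {0<..1}")
        case True
        then show ?thesis using nn_integral_arcsine[of s m] T by simp
      next
        case False
        then have "s \<notin> {0..1}" using elim by auto
        then show ?thesis by simp
      qed
    qed
  qed
  also have "\<dots> = ennreal I"
    by (rule nn_integral_has_integral_lebesgue'[OF nonneg I'])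
  finally show "(\<integral>\<^sup>+t. ennreal (u t ^ m * rho t) * indicator {0<..<T} t \<partial>lborel) = ennreal I" .
qed

text \<open>
  Summing the geometric series under the integral turns the generating function of the moments into
  the Poisson integral. Its radicand, multiplied by \<open>(S s)\<^sup>2\<close>, simplifies to a polynomial in \<open>v\<close> and
  \<open>D s\<close>.
\<close>

lemma arcsine_moment_generating:
  assumes s: "0 < s" "s < T"
  shows "\<exists>\<delta>>0. \<forall>v. \<bar>v\<bar> < \<delta> \<longrightarrow>
    (\<lambda>m. arcsine_moment m s * v ^ m) sums (S s / sqrt ((D s - v * (1 - \<theta> * e))\<^sup>2 - 4 * \<theta> * ((v - 1) * (1 - v * e))))"
proof -
  define b where "b = centre s"
  define r where "r = radius s"
  define X where "X x = b + sgn \<gamma> * r * cos x" for x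
  have br: "0 < r" "0 < b - r" using centre_bounds[OF s] by (auto simp: b_def r_def)
  have X: "\<bar>X x\<bar> \<le> b + r" for x
  proof -
    have "\<bar>sgn \<gamma> * cos x\<bar> \<le> 1" using gamma by (simp add: abs_mult sgn_if)
    then have "r * (sgn \<gamma> * cos x) \<le> r * 1" using br by (intro mult_left_mono) auto
    moreover have "0 < X x" using arcsine_node_pos[OF s, of x] by (simp add: X_def b_def r_def)
    ultimately show ?thesis by (simp add: X_def mult_ac)
  qed
  define \<delta> where "\<delta> = 1 / (2 * (b + r))"
  have "0 < \<delta>" using br by (simp add: \<delta>_def)
  moreover have "(\<lambda>m. arcsine_moment m s * v ^ m) sums (S s / sqrt ((D s - v * (1 - \<theta> * e))\<^sup>2 - 4 * \<theta> * ((v - 1) * (1 - v * e))))"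
    if v: "\<bar>v\<bar> < \<delta>" for v
  proof -
    have vbr: "\<bar>v\<bar> * (b + r) \<le> 1 / 2"
      using v br by (simp add: \<delta>_def field_simps)
    have vX: "\<bar>v * X x\<bar> \<le> 1 / 2" for x
      using mult_left_mono[OF X[of x], of "\<bar>v\<bar>"] vbr by (simp add: abs_mult)
    define A where "A = 1 - v * b"
    define B where "B = v * sgn \<gamma> * r"
    have B: "\<bar>B\<bar> = \<bar>v\<bar> * r" using gamma br by (simp add: B_def abs_mult sgn_if)
    have "\<bar>v\<bar> * b + \<bar>v\<bar> * r \<le> 1 / 2" using vbr by (simp add: algebra_simps)
    moreover have "v * b \<le> \<bar>v\<bar> * b" using br by (intro mult_right_mono) auto
    ultimately have AB: "\<bar>B\<bar> < A" unfolding B A_def by linarith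
    have AX: "A - B * cos x = 1 - v * X x" for x by (simp add: A_def B_def X_def algebra_simps)
    define J where "J = pi / sqrt (A\<^sup>2 - B\<^sup>2)"
    have J: "((\<lambda>x. 1 / (1 - v * X x)) has_integral J) {0..pi}"
      using poisson_integral[OF AB] unfolding AX J_def .
    have Xm: "((\<lambda>x. X x ^ m) has_integral pi * arcsine_moment m s) {0..pi}" for m
    proof -
      have "continuous_on {0..pi} (\<lambda>x. X x ^ m)" unfolding X_def by (intro continuous_intros)
      then show ?thesis unfolding arcsine_moment_def X_def b_def r_def
        by (simp add: integrable_continuous_real integrable_integral)
    qed
    have bound: "\<bar>pi * (\<Sum>m<M. arcsine_moment m s * v ^ m) - J\<bar> \<le> 2 * pi * (1 / 2) ^ M" for M
    proof -
      have "((\<lambda>x. (\<Sum>m<M. v ^ m * X x ^ m) - 1 / (1 - v * X x)) has_integral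
          (\<Sum>m<M. v ^ m * (pi * arcsine_moment m s)) - J) {0..pi}"
        by (intro has_integral_diff has_integral_sum has_integral_mult_right Xm J) auto
      moreover have "norm ((\<Sum>m<M. v ^ m * X x ^ m) - 1 / (1 - v * X x)) \<le> 2 * (1 / 2) ^ M" for x
      proof -
        have ne: "1 - v * X x \<noteq> 0" "1 / 2 \<le> 1 - v * X x" using vX[of x] by auto
        have "(\<Sum>m<M. v ^ m * X x ^ m) = (1 - (v * X x) ^ M) / (1 - v * X x)"
          using ne by (simp add: sum_gp_strict flip: power_mult_distrib)
        then have "(\<Sum>m<M. v ^ m * X x ^ m) - 1 / (1 - v * X x) = - ((v * X x) ^ M) / (1 - v * X x)"
          by (simp add: diff_divide_distrib)
        then have "norm ((\<Sum>m<M. v ^ m * X x ^ m) - 1 / (1 - v * X x)) = (abs (v * X x)) ^ M / (1 - v * X x)"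
          using ne by (simp add: power_abs)
        also have "\<dots> \<le> (1 / 2) ^ M / (1 / 2)"
          using vX[of x] ne by (intro frac_le power_mono) auto
        finally show ?thesis by simp
      qed
      ultimately have "norm ((\<Sum>m<M. v ^ m * (pi * arcsine_moment m s)) - J) \<le> 2 * (1 / 2) ^ M * measure lborel {0..pi}"
        by (intro has_integral_bound_real[where S = "{}"]) auto
      then show ?thesis by (simp add: sum_distrib_left mult_ac)
    qed
    have null: "(\<lambda>M. 2 * pi * (1 / 2) ^ M) \<longlonglongrightarrow> 2 * pi * 0"
      by (intro tendsto_mult_left LIMSEQ_realpow_zero) auto
    have "(\<lambda>M. pi * (\<Sum>m<M. arcsine_moment m s * v ^ m) - J) \<longlonglongrightarrow> 0"
    proof (rule Lim_null_comparison)
      show "(\<lambda>M. 2 * pi * (1 / 2) ^ M) \<longlonglongrightarrow> 0" using null by simp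
      show "eventually (\<lambda>M. norm (pi * (\<Sum>m<M. arcsine_moment m s * v ^ m) - J) \<le> 2 * pi * (1 / 2) ^ M) sequentially"
        unfolding real_norm_def using bound by (rule always_eventually[OF allI])
    qed
    then have "(\<lambda>M. (pi * (\<Sum>m<M. arcsine_moment m s * v ^ m) - J + J) / pi) \<longlonglongrightarrow> (0 + J) / pi"
      by (intro tendsto_intros) auto
    then have "(\<lambda>m. arcsine_moment m s * v ^ m) sums (J / pi)"
      unfolding sums_def by simp
    moreover have "J / pi = S s / sqrt ((D s - v * (1 - \<theta> * e))\<^sup>2 - 4 * \<theta> * ((v - 1) * (1 - v * e)))"
    proof -
      have c: "b * (S s)\<^sup>2 = 2 * \<theta> * (1 + e) + D s * (1 - \<theta> * e)"
        using S_pos[of s] by (simp add: centre_def b_def)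
      have "B\<^sup>2 = v\<^sup>2 * r\<^sup>2" using gamma by (simp add: B_def power_mult_distrib sgn_if)
      then have "(S s)\<^sup>2 * (A\<^sup>2 - B\<^sup>2) = (S s)\<^sup>2 * (1 - 2 * v * b) + v\<^sup>2 * (1 + \<theta> * e)\<^sup>2"
        unfolding A_def r_def centre_bounds(4)[OF s] b_def[symmetric] using S_pos[of s]
        by (simp add: field_simps power2_eq_square)
      also have "\<dots> = (S s)\<^sup>2 - 2 * v * (b * (S s)\<^sup>2) + v\<^sup>2 * (1 + \<theta> * e)\<^sup>2" by (simp add: algebra_simps)
      also have "\<dots> = (D s - v * (1 - \<theta> * e))\<^sup>2 - 4 * \<theta> * ((v - 1) * (1 - v * e))"
        unfolding c unfolding S_D by (simp add: power2_eq_square algebra_simps)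
      finally have disc: "(S s)\<^sup>2 * (A\<^sup>2 - B\<^sup>2) = (D s - v * (1 - \<theta> * e))\<^sup>2 - 4 * \<theta> * ((v - 1) * (1 - v * e))" .
      have "sqrt ((S s)\<^sup>2 * (A\<^sup>2 - B\<^sup>2)) = S s * sqrt (A\<^sup>2 - B\<^sup>2)"
        using S_pos[of s] by (simp add: real_sqrt_mult)
      then show ?thesis unfolding disc[symmetric] using S_pos[of s] by (simp add: J_def)
    qed
    ultimately show ?thesis by simp
  qed
  ultimately show ?thesis by blast
qed

section \<open>Moments of the limit density as contour integrals\<close>

text \<open>
  In the limit the mean of a power sum is given by the integral of a power of \<open>G 1\<close>. The parameter \<open>s\<close>
  moves one root of the denominator: \<open>Den s\<close> has the positive root \<open>u s\<close> and a negative one. The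
  circle is centred at the midpoint \<open>ctr\<close> of \<open>1 = u 0\<close> and \<open>u 1\<close>, and its radius is halfway between
  the half-distance of these points and \<open>ctr\<close>; so it encloses every \<open>u s\<close> with \<open>0 \<le> s \<le> 1\<close> and stays
  in the right half-plane.
\<close>

definition ctr :: real where "ctr = (1 + u 1) / 2"
definition rad :: real where "rad = (\<bar>1 - u 1\<bar> / 2 + ctr) / 2"
definition Num :: "complex \<Rightarrow> complex" where "Num z = (of_real (\<theta> * e) * z + 1) * (z - 1)"
definition Den :: "real \<Rightarrow> complex \<Rightarrow> complex" where "Den s z = of_real \<theta> * z\<^sup>2 + of_real (D s) * z - 1"
definition G :: "real \<Rightarrow> complex \<Rightarrow> complex" where "G s z = Num z / Den s z"
definition circ :: "real \<Rightarrow> complex" where "circ = circlepath (of_real ctr) rad"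

text \<open>
  Up to the factor \<open>- m * \<gamma>\<close>, the function \<open>contour_density m\<close> is the derivative of
  \<open>contour_moment m\<close>.
\<close>

definition contour_moment :: "nat \<Rightarrow> real \<Rightarrow> complex" where
  "contour_moment m s = contour_integral circ (\<lambda>z. G s z ^ m / z) / (2 * pi * \<i>)"
definition contour_density :: "nat \<Rightarrow> real \<Rightarrow> complex" where
  "contour_density m s = contour_integral circ (\<lambda>z. G s z ^ m * of_real (S s) / Den s z) / (2 * pi * \<i>)"

lemma rad_bounds: "\<bar>1 - u 1\<bar> / 2 < rad" "rad < ctr" "0 < rad" "0 < ctr"
proof -
  have lt: "\<bar>1 - u 1\<bar> < 1 + u 1" using u_pos[of 1] by linarith
  have c: "ctr * 2 = 1 + u 1" "rad * 4 = \<bar>1 - u 1\<bar> + ctr * 2" by (simp_all add: ctr_def rad_def)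
  have arith: "a / 2 < R" "R < C" "0 < R" "0 < C"
    if "a < 1 + P" "C * 2 = 1 + P" "R * 4 = a + C * 2" "0 \<le> a" for a P R C :: real
    using that by auto
  note arith[OF lt c abs_ge_zero]
  then show "\<bar>1 - u 1\<bar> / 2 < rad" "rad < ctr" "0 < rad" "0 < ctr" by blast+
qed

lemma u_in_disc:
  assumes "0 \<le> s" "s \<le> 1"
  shows "\<bar>u s - ctr\<bar> < rad"
proof -
  have "min 1 (u 1) \<le> u s \<and> u s \<le> max 1 (u 1)"
  proof (cases "0 < \<gamma>")
    case True
    then show ?thesis using assms by (auto simp: u_def)
  next
    case False
    then have "\<gamma> < 0" using gamma by simp
    then have "0 \<le> - \<gamma> * s" "- \<gamma> * s \<le> - \<gamma>" using assms by (auto simp: mult_nonpos_nonneg)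
    then show ?thesis by (auto simp: u_def)
  qed
  moreover have "ctr * 2 = 1 + u 1" by (simp add: ctr_def)
  ultimately have "\<bar>u s - ctr\<bar> \<le> \<bar>1 - u 1\<bar> / 2"
  proof -
    assume "min 1 (u 1) \<le> u s \<and> u s \<le> max 1 (u 1)" and c: "ctr * 2 = 1 + u 1"
    then have "u 1 \<le> u s \<and> u s \<le> 1 \<or> 1 \<le> u s \<and> u s \<le> u 1"
      by (auto simp: min_def max_def split: if_splits)
    then show ?thesis
    proof
      assume "u 1 \<le> u s \<and> u s \<le> 1"
      moreover from this have "\<bar>1 - u 1\<bar> = 1 - u 1" by simp
      ultimately show ?thesis using c by (simp only: abs_le_iff) auto
    next
      assume "1 \<le> u s \<and> u s \<le> u 1"
      moreover from this have "\<bar>1 - u 1\<bar> = u 1 - 1" by simp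
      ultimately show ?thesis using c by (simp only: abs_le_iff) auto
    qed
  qed
  then show ?thesis using rad_bounds by linarith
qed

lemma Re_pos_cball: "z \<in> cball (of_real ctr) rad \<Longrightarrow> 0 < Re z"
  using abs_Re_le_cmod[of "of_real ctr - z"] rad_bounds by (auto simp: dist_norm)

lemma Re_pos_ball: "z \<in> ball (of_real ctr) ctr \<Longrightarrow> 0 < Re z"
  using abs_Re_le_cmod[of "of_real ctr - z"] by (auto simp: dist_norm)

lemma Den_factor: "Den s z = (z - of_real (u s)) * (of_real \<theta> * z + of_real (1 / u s))"
proof -
  have "D s = 1 / u s - \<theta> * u s" by (simp add: D_def u_def exp_minus field_simps)
  moreover have "complex_of_real (u s) * of_real (1 / u s) = 1"
    using u_pos[of s] by (simp flip: of_real_mult)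
  then show ?thesis unfolding Den_def calculation
    by (simp add: power2_eq_square algebra_simps del: of_real_divide)
qed

lemma second_factor_nz:
  assumes "0 < Re z" "0 < a" "0 \<le> b"
  shows "of_real b * z + of_real a \<noteq> 0"
proof
  assume "of_real b * z + of_real a = 0"
  then have "Re (of_real b * z + of_real a) = 0" by simp
  then have "b * Re z + a = 0" by simp
  moreover have "0 \<le> b * Re z" using assms by simp
  ultimately show False using assms by linarith
qed

lemma Den_nz:
  assumes "0 < Re z" "z \<noteq> of_real (u s)"
  shows "Den s z \<noteq> 0"
  unfolding Den_factor using assms second_factor_nz[of z "1 / u s" \<theta>] u_pos[of s] theta by simp

lemma sphere_props:
  assumes "z \<in> sphere (of_real ctr) rad"
  shows "0 < Re z" "0 \<le> s \<Longrightarrow> s \<le> 1 \<Longrightarrow> z \<noteq> of_real (u s)" "z \<noteq> 0"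
proof -
  show R: "0 < Re z" using Re_pos_cball[of z] assms by auto
  then show "z \<noteq> 0" by auto
  show "z \<noteq> of_real (u s)" if "0 \<le> s" "s \<le> 1"
    using u_in_disc[OF that] assms by (auto simp: dist_norm simp flip: of_real_diff)
qed

lemma Den_nz_sphere:
  assumes "z \<in> sphere (of_real ctr) rad" "0 \<le> s" "s \<le> 1"
  shows "Den s z \<noteq> 0"
  using sphere_props(1)[OF assms(1)] sphere_props(2)[OF assms] by (rule Den_nz)

lemma path_image_circ: "path_image circ = sphere (of_real ctr) rad"
  unfolding circ_def using rad_bounds by (simp add: path_image_circlepath)

lemma contour_integral_circ:
  "contour_integral circ f = integral {0..1} (\<lambda>x. f (circ x) * vector_derivative circ (at x))"
  by (rule contour_integral_integral)

lemma circ_integrable: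
  assumes "continuous_on (sphere (of_real ctr) rad) f"
  shows "f contour_integrable_on circ"
  unfolding circ_def by (rule contour_integrable_continuous_circlepath) (use assms rad_bounds in simp)

lemma cont_circ [continuous_intros]: "continuous_on A circ"
  unfolding circ_def circlepath by (intro continuous_intros)

lemma circ_sphere: "circ x \<in> sphere (of_real ctr) rad"
proof -
  have "circ x = of_real ctr + of_real rad * exp (\<i> * of_real (2 * pi * x))"
    unfolding circ_def circlepath by (simp add: mult_ac)
  then show ?thesis using rad_bounds by (simp add: dist_norm norm_mult)
qed

lemma vector_derivative_circ: "vector_derivative circ (at x) = 2 * pi * \<i> * rad * exp (2 * of_real pi * \<i> * x)"
  unfolding circ_def by (rule vector_derivative_circlepath)

text \<open>
  At \<open>s = 0\<close> the root \<open>u 0 = 1\<close> of the denominator cancels against the numerator, and the integrand is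
  holomorphic in the right half-plane.
\<close>

lemma contour_moment_0: "contour_moment m 0 = 0"
proof -
  have "contour_integral circ (\<lambda>z. G 0 z ^ m / z) = contour_integral circ (\<lambda>z. ((of_real (\<theta> * e) * z + 1) / (of_real \<theta> * z + of_real 1)) ^ m / z)"
  proof (rule contour_integral_cong)
    fix z assume "z \<in> path_image circ"
    then have z: "z \<in> sphere (of_real ctr) rad" by (simp add: path_image_circ)
    then have "z \<noteq> 1" using sphere_props(2)[OF z, of 0] by (simp add: u_def)
    then have "G 0 z = (of_real (\<theta> * e) * z + 1) / (of_real \<theta> * z + of_real 1)"
      unfolding G_def Num_def Den_factor by (simp add: u_def)
    then show "G 0 z ^ m / z = ((of_real (\<theta> * e) * z + 1) / (of_real \<theta> * z + of_real 1)) ^ m / z" by simp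
  qed simp
  also have "\<dots> = 0"
  proof (rule contour_integral_unique, rule Cauchy_theorem_disc_simple[of _ "of_real ctr" ctr])
    have nz: "of_real \<theta> * z + of_real 1 \<noteq> 0" "z \<noteq> 0" if "z \<in> ball (of_real ctr) ctr" for z :: complex
      using second_factor_nz[OF Re_pos_ball[OF that], of 1 \<theta>] theta Re_pos_ball[OF that] by auto
    show "(\<lambda>z. ((of_real (\<theta> * e) * z + 1) / (of_real \<theta> * z + of_real 1)) ^ m / z) holomorphic_on ball (of_real ctr) ctr"
      using nz by (intro holomorphic_intros) auto
    show "valid_path circ" "pathfinish circ = pathstart circ" by (auto simp: circ_def)
    show "path_image circ \<subseteq> ball (of_real ctr) ctr" unfolding path_image_circ using rad_bounds by auto
  qed
  finally show ?thesis by (simp add: contour_moment_def)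
qed

lemma continuous_G_param:
  "continuous_on ({0..1} \<times> {0..1}) (\<lambda>(s, x). G s (circ x) ^ m * of_real (S s) / Den s (circ x) * vector_derivative circ (at x))"
proof -
  have "Den s (circ x) \<noteq> 0" if "s \<in> {0..1}" for s x
    using Den_nz_sphere[OF circ_sphere] that by simp
  then show ?thesis
    unfolding G_def case_prod_unfold vector_derivative_circ Num_def S_def
    unfolding Den_def D_def
    by (intro continuous_intros continuous_on_compose2[OF cont_circ[of UNIV]] ballI)
      (auto simp: Den_def D_def)
qed

lemma DERIV_G_power:
  assumes "0 \<le> s" "s \<le> 1" "z \<in> sphere (of_real ctr) rad"
  shows "((\<lambda>s. G s z ^ m / z) has_vector_derivative - of_real (m * \<gamma>) * (G s z ^ m * of_real (S s) / Den s z)) (at s within A)"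
proof -
  have nz: "Den s z \<noteq> 0" "z \<noteq> 0" using sphere_props(3)[OF assms(3)] Den_nz_sphere[OF assms(3,1,2)] by auto
  have dD: "((\<lambda>s. Den s z) has_vector_derivative of_real (\<gamma> * S s) * z) (at s within A)"
  proof -
    have "((\<lambda>s. complex_of_real (D s)) has_vector_derivative of_real (\<gamma> * S s)) (at s within A)"
      using DERIV_D by (intro has_vector_derivative_of_real) (auto intro: has_field_derivative_at_within)
    then have "((\<lambda>s. (of_real \<theta> * z\<^sup>2 + of_real (D s) * z) - 1) has_vector_derivative (0 + of_real (\<gamma> * S s) * z) - 0) (at s within A)"
      by (intro has_vector_derivative_diff has_vector_derivative_add has_vector_derivative_const has_vector_derivative_mult_left)
    then show ?thesis by (simp add: Den_def)
  qed
  have dg: "((\<lambda>w. (Num z / w) ^ m / z) has_field_derivative (of_nat m * (Num z / Den s z) ^ (m - 1) * (- (Num z / (Den s z * Den s z)))) / z) (at (Den s z))"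
    using nz by (auto intro!: derivative_eq_intros simp: mult_ac)
  have "((\<lambda>w. (Num z / w) ^ m / z) \<circ> (\<lambda>s. Den s z) has_vector_derivative
      (of_real (\<gamma> * S s) * z) * ((of_nat m * (Num z / Den s z) ^ (m - 1) * (- (Num z / (Den s z * Den s z)))) / z)) (at s within A)"
    by (rule field_vector_diff_chain_within[OF dD]) (use dg in \<open>auto intro: has_field_derivative_at_within\<close>)
  moreover have "(of_real (\<gamma> * S s) * z) * ((of_nat m * (Num z / Den s z) ^ (m - 1) * (- (Num z / (Den s z * Den s z)))) / z)
     = - of_real (m * \<gamma>) * (G s z ^ m * of_real (S s) / Den s z)"
  proof (cases m)
    case (Suc k)
    then show ?thesis using nz by (simp add: G_def field_simps)
  qed simp
  ultimately show ?thesis by (simp add: G_def o_def)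
qed

text \<open>
  The fundamental theorem of calculus in \<open>s\<close> under the contour integral; the end point \<open>s = 0\<close>
  contributes nothing by \<open>contour_moment_0\<close>.
\<close>

lemma contour_density_integral:
  assumes "0 < m"
  shows "((\<lambda>s. contour_density m s) has_integral - contour_moment m 1 / of_real (m * \<gamma>)) {0..1}"
proof -
  define F where "F s x = G s (circ x) ^ m * of_real (S s) / Den s (circ x) * vector_derivative circ (at x)" for s x
  have cont: "continuous_on (cbox (0, 0) (1, 1)) (\<lambda>(s, x). F s x)"
    using continuous_G_param[of m] unfolding F_def by (simp add: cbox_Pair_eq)
  have swap: "integral {0..1} (\<lambda>s. integral {0..1} (F s)) = integral {0..1} (\<lambda>x. integral {0..1} (\<lambda>s. F s x))"
    using integral_swap_continuous[OF cont] by simp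
  have inner: "integral {0..1} (\<lambda>s. F s x) = (G 0 (circ x) ^ m / circ x * vector_derivative circ (at x)
      - G 1 (circ x) ^ m / circ x * vector_derivative circ (at x)) / of_real (m * \<gamma>)" for x
  proof -
    have "((\<lambda>s. - of_real (m * \<gamma>) * (G s (circ x) ^ m * of_real (S s) / Den s (circ x))) has_integral
       G 1 (circ x) ^ m / circ x - G 0 (circ x) ^ m / circ x) {0..1}"
      by (rule fundamental_theorem_of_calculus) (use DERIV_G_power circ_sphere in auto)
    then have e1: "((\<lambda>s. - of_real (m * \<gamma>) * (G s (circ x) ^ m * of_real (S s) / Den s (circ x)) * (vector_derivative circ (at x) / - of_real (m * \<gamma>))) has_integral
       (G 1 (circ x) ^ m / circ x - G 0 (circ x) ^ m / circ x) * (vector_derivative circ (at x) / - of_real (m * \<gamma>))) {0..1}"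
      by (rule has_integral_mult_left)
    have e2: "- of_real (m * \<gamma>) * y * (v / - of_real (m * \<gamma>)) = y * v" for y v :: complex
      using assms gamma by simp
    have "((\<lambda>s. F s x) has_integral
       (G 1 (circ x) ^ m / circ x - G 0 (circ x) ^ m / circ x) * (vector_derivative circ (at x) / - of_real (m * \<gamma>))) {0..1}"
      using e1 unfolding e2 F_def .
    then show ?thesis by (simp add: integral_unique algebra_simps diff_divide_distrib)
  qed
  have cont2: "continuous_on {0..1} (\<lambda>x. G s (circ x) ^ m / circ x * vector_derivative circ (at x))" if "s \<in> {0..1}" for s
  proof -
    have "Den s (circ x) \<noteq> 0" "circ x \<noteq> 0" for x
      using sphere_props(3)[OF circ_sphere[of x]] Den_nz_sphere[OF circ_sphere] that by auto
    then show ?thesis unfolding G_def vector_derivative_circ Num_def Den_def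
      by (intro continuous_intros) (auto simp: Den_def)
  qed
  have "integral {0..1} (\<lambda>x. integral {0..1} (\<lambda>s. F s x))
     = (contour_integral circ (\<lambda>z. G 0 z ^ m / z) - contour_integral circ (\<lambda>z. G 1 z ^ m / z)) / of_real (m * \<gamma>)"
    unfolding inner contour_integral_circ
    by (subst integral_diff[symmetric]) (use cont2 in \<open>auto intro!: integrable_continuous_real\<close>)
  also have "\<dots> = (2 * pi * \<i>) * (- contour_moment m 1 / of_real (m * \<gamma>))"
    using contour_moment_0[of m] by (simp add: contour_moment_def)
  finally have total: "integral {0..1} (\<lambda>s. integral {0..1} (F s)) = (2 * pi * \<i>) * (- contour_moment m 1 / of_real (m * \<gamma>))"
    unfolding swap .
  have "continuous_on {0..1} (\<lambda>s. integral (cbox 0 1) (F s))"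
    by (rule integral_continuous_on_param) (use cont in \<open>simp add: cbox_Pair_eq\<close>)
  then have "((\<lambda>s. integral {0..1} (F s)) has_integral (2 * pi * \<i>) * (- contour_moment m 1 / of_real (m * \<gamma>))) {0..1}"
    unfolding total[symmetric] by (simp add: integrable_integral integrable_continuous_real)
  from has_integral_divide[OF this, of "2 * pi * \<i>"] show ?thesis
    unfolding contour_density_def contour_integral_circ F_def by simp
qed

text \<open>
  Summing the geometric series under the integral leaves \<open>S s / (Den s z - v * Num z)\<close>, whose
  denominator is quadratic in \<open>z\<close>. For small \<open>v\<close> one root \<open>z1 v\<close> is close to \<open>u s\<close>, inside the circle,
  and the other one is negative, outside it. The residue at \<open>z1 v\<close> is \<open>S s\<close> over the square root of
  the discriminant.
\<close>

lemma contour_density_generating: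
  assumes s: "0 \<le> s" "s \<le> 1"
  shows "\<exists>\<delta>>0. \<forall>v. \<bar>v\<bar> < \<delta> \<longrightarrow>
    (\<lambda>m. Re (contour_density m s) * v ^ m) sums (S s / sqrt ((D s - v * (1 - \<theta> * e))\<^sup>2 - 4 * \<theta> * ((v - 1) * (1 - v * e))))"
proof -
  define K where "K v = contour_integral circ (\<lambda>z. of_real (S s) / (Den s z - of_real v * Num z))" for v :: real
  have contDen: "continuous_on A (Den s)" "continuous_on A Num" for A
    unfolding Den_def Num_def by (intro continuous_intros)+
  have nz: "Den s z \<noteq> 0" if "z \<in> sphere (of_real ctr) rad" for z
    using Den_nz_sphere[OF that s] .
  have contG: "continuous_on (sphere (of_real ctr) rad) (G s)"
    unfolding G_def using nz contDen by (intro continuous_intros) auto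
  have contS: "continuous_on (sphere (of_real ctr) rad) (\<lambda>z. of_real (S s) / Den s z)"
    using nz contDen by (intro continuous_intros) auto
  obtain M where M: "0 < M" "\<And>z. z \<in> sphere (of_real ctr) rad \<Longrightarrow> norm (G s z) \<le> M"
    using compact_imp_bounded[OF compact_continuous_image[OF contG compact_sphere]]
    unfolding bounded_pos by blast
  obtain C where C: "0 < C" "\<And>z. z \<in> sphere (of_real ctr) rad \<Longrightarrow> norm (of_real (S s) / Den s z) \<le> C"
    using compact_imp_bounded[OF compact_continuous_image[OF contS compact_sphere]]
    unfolding bounded_pos by blast
  have series: "(\<lambda>m. Re (contour_density m s) * v ^ m) sums Re (K v / (2 * pi * \<i>))"
    if v: "\<bar>v\<bar> * M \<le> 1 / 2" for v
  proof -
    have vG: "norm (of_real v * G s z) \<le> 1 / 2" if "z \<in> sphere (of_real ctr) rad" for z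
      using mult_left_mono[OF M(2)[OF that], of "\<bar>v\<bar>"] v by (simp add: norm_mult)
    have ne: "1 - of_real v * G s z \<noteq> 0" if "z \<in> sphere (of_real ctr) rad" for z
      using vG[OF that] by (auto simp: norm_one)
    have eq: "of_real (S s) / (Den s z - of_real v * Num z) = of_real (S s) / Den s z / (1 - of_real v * G s z)"
      if "z \<in> sphere (of_real ctr) rad" for z
    proof -
      have "Den s z * (1 - of_real v * G s z) = Den s z - of_real v * Num z"
        using nz[OF that] by (simp add: G_def algebra_simps)
      then show ?thesis by (metis divide_divide_eq_left)
    qed
    have K: "K v = contour_integral circ (\<lambda>z. of_real (S s) / Den s z / (1 - of_real v * G s z))"
      unfolding K_def by (rule contour_integral_cong) (use eq in \<open>auto simp: path_image_circ\<close>)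
    have intK: "(\<lambda>z. of_real (S s) / Den s z / (1 - of_real v * G s z)) contour_integrable_on circ"
      using ne by (intro circ_integrable continuous_on_divide[OF contS] continuous_on_diff
        continuous_on_mult continuous_on_const contG) auto
    have intm: "(\<lambda>z. G s z ^ m * of_real (S s) / Den s z) contour_integrable_on circ" for m
      by (rule circ_integrable) (use contDen contG nz in \<open>auto intro!: continuous_intros\<close>)
    have bound: "norm ((\<Sum>m<N. contour_density m s * of_real v ^ m) * (2 * pi * \<i>) - K v)
        \<le> C * (1 / 2) ^ N / (1 / 2) * (2 * pi * rad)" for N
    proof -
      have "((\<lambda>z. (\<Sum>m<N. of_real v ^ m * (G s z ^ m * of_real (S s) / Den s z)) - of_real (S s) / Den s z / (1 - of_real v * G s z))
         has_contour_integral (\<Sum>m<N. of_real v ^ m * (contour_density m s * (2 * pi * \<i>))) - K v) circ"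
        unfolding K contour_density_def
        by (intro has_contour_integral_diff has_contour_integral_sum has_contour_integral_lmul)
          (use intm intK in \<open>auto intro: has_contour_integral_integral\<close>)
      then have "norm ((\<Sum>m<N. of_real v ^ m * (contour_density m s * (2 * pi * \<i>))) - K v) \<le> C * (1 / 2) ^ N / (1 / 2) * (2 * pi * rad)"
        unfolding circ_def
      proof (rule has_contour_integral_bound_circlepath)
        show "0 \<le> C * (1 / 2) ^ N / (1 / 2)" using C by simp
        show "0 < rad" by (rule rad_bounds)
        fix z :: complex assume "norm (z - of_real ctr) = rad"
        then have z: "z \<in> sphere (of_real ctr) rad" by (simp add: dist_norm norm_minus_commute)
        define y where "y = of_real v * G s z"
        have y: "norm y \<le> 1 / 2" "1 - y \<noteq> 0" using vG[OF z] ne[OF z] by (auto simp: y_def)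
        have "(\<Sum>m<N. of_real v ^ m * (G s z ^ m * of_real (S s) / Den s z)) = of_real (S s) / Den s z * (\<Sum>m<N. y ^ m)"
          by (simp add: y_def sum_distrib_left power_mult_distrib mult_ac)
        also have "(\<Sum>m<N. y ^ m) = (1 - y ^ N) / (1 - y)" using y by (simp add: sum_gp_strict)
        finally have "(\<Sum>m<N. of_real v ^ m * (G s z ^ m * of_real (S s) / Den s z)) - of_real (S s) / Den s z / (1 - y)
           = - (of_real (S s) / Den s z * y ^ N / (1 - y))"
          by (simp add: diff_divide_distrib right_diff_distrib)
        moreover have "norm (of_real (S s) / Den s z * y ^ N / (1 - y)) \<le> C * (1 / 2) ^ N / (1 / 2)"
        proof -
          have "1 / 2 \<le> norm (1 - y)" using norm_triangle_ineq2[of 1 y] y by simp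
          then show ?thesis unfolding norm_mult norm_divide norm_power
            using C(2)[OF z] C(1) y unfolding norm_divide by (intro frac_le mult_mono power_mono) auto
        qed
        ultimately show "norm ((\<Sum>m<N. of_real v ^ m * (G s z ^ m * of_real (S s) / Den s z)) - of_real (S s) / Den s z / (1 - of_real v * G s z))
          \<le> C * (1 / 2) ^ N / (1 / 2)" unfolding y_def[symmetric] by (simp only: norm_minus_cancel)
      qed
      then show ?thesis by (simp add: sum_distrib_left sum_distrib_right mult_ac)
    qed
    have null: "(\<lambda>N. C * (1 / 2) ^ N / (1 / 2) * (2 * pi * rad)) \<longlonglongrightarrow> C * 0 / (1 / 2) * (2 * pi * rad)"
      by (intro tendsto_intros LIMSEQ_realpow_zero) auto
    have "(\<lambda>N. (\<Sum>m<N. contour_density m s * of_real v ^ m) * (2 * pi * \<i>) - K v) \<longlonglongrightarrow> 0"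
    proof (rule Lim_null_comparison)
      show "(\<lambda>N. C * (1 / 2) ^ N / (1 / 2) * (2 * pi * rad)) \<longlonglongrightarrow> 0" using null by simp
      show "eventually (\<lambda>N. norm ((\<Sum>m<N. contour_density m s * of_real v ^ m) * (2 * pi * \<i>) - K v)
        \<le> C * (1 / 2) ^ N / (1 / 2) * (2 * pi * rad)) sequentially"
        using bound by (rule always_eventually[OF allI])
    qed
    then have "(\<lambda>N. Re (((\<Sum>m<N. contour_density m s * of_real v ^ m) * (2 * pi * \<i>) - K v + K v) / (2 * pi * \<i>)))
       \<longlonglongrightarrow> Re ((0 + K v) / (2 * pi * \<i>))"
      by (intro tendsto_intros) auto
    then show ?thesis unfolding sums_def by (simp flip: of_real_power)
  qed
  define A where "A v = \<theta> * (1 - v * e)" for v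
  define B where "B v = D s - v * (1 - \<theta> * e)" for v
  define d where "d v = (B v)\<^sup>2 - 4 * \<theta> * ((v - 1) * (1 - v * e))" for v
  \<comment> \<open>The roots of \<open>Den s z - v * Num z = A v * z\<^sup>2 + B v * z + (v - 1)\<close>.\<close>
  define z1 where "z1 v = (- B v + sqrt (d v)) / (2 * A v)" for v
  define z2 where "z2 v = (- B v - sqrt (d v)) / (2 * A v)" for v
  have "isCont z1 0"
    unfolding z1_def A_def B_def d_def using theta by (intro continuous_intros) auto
  moreover have "z1 0 = u s"
  proof -
    have "d 0 = (S s)\<^sup>2" unfolding d_def B_def S_D by simp
    then have "z1 0 = (S s - D s) / (2 * \<theta>)" using S_pos[of s] by (simp add: z1_def A_def B_def)
    then show ?thesis using theta by (simp add: S_def D_def u_def)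
  qed
  ultimately have "(z1 \<longlongrightarrow> u s) (at 0)" by (simp add: isCont_def)
  moreover have "0 < rad - \<bar>u s - ctr\<bar>" using u_in_disc[OF s] by simp
  ultimately have "eventually (\<lambda>v. dist (z1 v) (u s) < rad - \<bar>u s - ctr\<bar>) (at 0)" by (rule tendstoD)
  then obtain d0 where d0: "0 < d0" "\<And>v. v \<noteq> 0 \<Longrightarrow> \<bar>v\<bar> < d0 \<Longrightarrow> dist (z1 v) (u s) < rad - \<bar>u s - ctr\<bar>"
    unfolding eventually_at by (auto simp: dist_real_def)
  define \<delta> where "\<delta> = min d0 (min (1 / (2 * M)) (min 1 (1 / e)))"
  have "0 < \<delta>" using d0 M e_pos by (simp add: \<delta>_def)
  moreover have "(\<lambda>m. Re (contour_density m s) * v ^ m) sums (S s / sqrt ((D s - v * (1 - \<theta> * e))\<^sup>2 - 4 * \<theta> * ((v - 1) * (1 - v * e))))"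
    if v: "\<bar>v\<bar> < \<delta>" for v
  proof -
    have vM: "\<bar>v\<bar> * M \<le> 1 / 2" using v M by (simp add: \<delta>_def field_simps)
    have v1: "\<bar>v\<bar> < 1" using v by (simp add: \<delta>_def)
    have "\<bar>v\<bar> * e < 1" using v e_pos by (simp add: \<delta>_def field_simps)
    moreover have "v * e \<le> \<bar>v\<bar> * e" using e_pos by (intro mult_right_mono) auto
    ultimately have ve: "0 < 1 - v * e" by linarith
    then have A: "0 < A v" using theta by (simp add: A_def)
    have "(v - 1) * (1 - v * e) < 0" using v1 ve by (intro mult_neg_pos) auto
    then have dB: "(B v)\<^sup>2 < d v" unfolding d_def using theta by (simp add: mult_less_0_iff)
    then have d: "0 < d v" "\<bar>B v\<bar> < sqrt (d v)"
    proof -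
      show "0 < d v" using dB zero_le_power2[of "B v"] by linarith
      show "\<bar>B v\<bar> < sqrt (d v)" using dB by (simp add: real_less_rsqrt)
    qed
    have z2: "z2 v < 0" unfolding z2_def using d A by (intro divide_neg_pos) auto
    have z1: "\<bar>z1 v - ctr\<bar> < rad"
    proof (cases "v = 0")
      case True
      then show ?thesis using \<open>z1 0 = u s\<close> u_in_disc[OF s] by simp
    next
      case False
      then show ?thesis using d0(2)[of v] v by (simp add: \<delta>_def dist_real_def)
    qed
    have z12: "A v * (z1 v - z2 v) = sqrt (d v)" using A by (simp add: z1_def z2_def field_simps)
    have factor: "Den s z - of_real v * Num z = of_real (A v) * (z - of_real (z1 v)) * (z - of_real (z2 v))" for z
    proof -
      have sum: "A v * (z1 v + z2 v) = - B v" using A by (simp add: z1_def z2_def field_simps)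
      have "A v * (z1 v * z2 v) = ((B v)\<^sup>2 - (sqrt (d v))\<^sup>2) / (4 * A v)"
        using A by (simp add: z1_def z2_def field_simps power2_eq_square)
      also have "\<dots> = v - 1" using A d ve theta by (simp add: d_def A_def field_simps)
      finally have prod: "A v * (z1 v * z2 v) = v - 1" .
      have "of_real (A v) * (z - of_real (z1 v)) * (z - of_real (z2 v))
         = of_real (A v) * z\<^sup>2 - of_real (A v * (z1 v + z2 v)) * z + of_real (A v * (z1 v * z2 v))"
        by (simp add: algebra_simps power2_eq_square)
      then show ?thesis unfolding sum prod
        by (simp add: Den_def Num_def A_def B_def algebra_simps power2_eq_square)
    qed
    define f where "f z = of_real (S s) / (of_real (A v) * (z - of_real (z2 v)))" for z :: complex
    have fnz: "z - of_real (z2 v) \<noteq> 0" if "z \<in> cball (of_real ctr) rad" for z :: complex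
      using Re_pos_cball[OF that] z2 by auto
    have "((\<lambda>z. f z / (z - of_real (z1 v))) has_contour_integral (2 * of_real pi * \<i> * f (of_real (z1 v)))) circ"
      unfolding circ_def
    proof (rule Cauchy_integral_circlepath)
      show "continuous_on (cball (of_real ctr) rad) f" unfolding f_def using fnz A by (intro continuous_intros) auto
      show "f holomorphic_on ball (of_real ctr) rad" unfolding f_def using fnz A by (intro holomorphic_intros) auto
      show "norm (of_real (z1 v) - complex_of_real ctr) < rad" using z1 by (simp flip: of_real_diff)
    qed
    moreover have "f z / (z - of_real (z1 v)) = of_real (S s) / (Den s z - of_real v * Num z)" for z
      unfolding factor f_def by (simp add: mult_ac)
    ultimately have "K v = 2 * of_real pi * \<i> * f (of_real (z1 v))"
      unfolding K_def by (simp add: contour_integral_unique)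
    moreover have "f (of_real (z1 v)) = of_real (S s / sqrt (d v))"
      unfolding f_def z12[symmetric] by simp
    ultimately have "Re (K v / (2 * pi * \<i>)) = S s / sqrt (d v)" by simp
    then show ?thesis using series[OF vM] by (simp add: d_def B_def)
  qed
  ultimately show ?thesis by blast
qed

text \<open>
  Both sequences have the same generating function.
\<close>

lemma contour_density_eq_arcsine:
  assumes s: "0 < s" "s \<le> 1"
  shows "Re (contour_density m s) = arcsine_moment m s"
proof -
  let ?f = "\<lambda>v. S s / sqrt ((D s - v * (1 - \<theta> * e))\<^sup>2 - 4 * \<theta> * ((v - 1) * (1 - v * e)))"
  obtain d1 where d1: "0 < d1" "\<And>v. \<bar>v\<bar> < d1 \<Longrightarrow> (\<lambda>m. Re (contour_density m s) * v ^ m) sums ?f v"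
    using contour_density_generating[of s] s by auto
  obtain d2 where d2: "0 < d2" "\<And>v. \<bar>v\<bar> < d2 \<Longrightarrow> (\<lambda>m. arcsine_moment m s * v ^ m) sums ?f v"
    using arcsine_moment_generating[of s] s T by auto
  show ?thesis
    by (rule powser_coeff_unique[of "min d1 d2" _ ?f]) (use d1 d2 in auto)
qed

text \<open>
  The moments of the density are the contour integrals that arise as limits of power sums: both are
  integrals over \<open>s\<close> of the same arcsine moments.
\<close>

theorem rho_moment:
  assumes "0 < m"
  shows "has_bochner_integral lborel (\<lambda>t. indicator {0<..<T} t * (u t ^ m * rho t))
     (Re (- contour_moment m 1 / of_real (m * \<gamma>)))"
proof -
  have "((\<lambda>s. Re (contour_density m s)) has_integral Re (- contour_moment m 1 / of_real (m * \<gamma>))) {0..1}"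
    using has_integral_Re[OF contour_density_integral[OF assms]] .
  then have I: "(arcsine_moment m has_integral Re (- contour_moment m 1 / of_real (m * \<gamma>))) {0..1}"
    by (rule has_integral_spike[of "{0}", rotated 2]) (auto simp: contour_density_eq_arcsine)
  show ?thesis
  proof (rule has_bochner_integral_nn_integral)
    have "continuous_on {0<..<T} (\<lambda>t. u t ^ m * rho t)"
      unfolding u_def by (intro continuous_intros continuous_on_rho)
    from borel_measurable_continuous_on_indicator[OF _ this]
    show "(\<lambda>t. indicator {0<..<T} t * (u t ^ m * rho t)) \<in> borel_measurable lborel" by simp
    show "AE t in lborel. 0 \<le> indicator {0<..<T} t * (u t ^ m * rho t)"
      using u_pos arccos_density_bounds(1) by (auto simp: rho_def less_imp_le intro!: AE_I2 mult_nonneg_nonneg)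
    show "0 \<le> Re (- contour_moment m 1 / of_real (m * \<gamma>))" by (rule nn_integral_rho_moment(2)[OF I])
    show "(\<integral>\<^sup>+t. ennreal (indicator {0<..<T} t * (u t ^ m * rho t)) \<partial>lborel)
       = ennreal (Re (- contour_moment m 1 / of_real (m * \<gamma>)))"
      unfolding nn_integral_rho_moment(1)[OF I, symmetric]
      by (intro nn_integral_cong) (auto simp: indicator_def)
  qed
qed

end

section \<open>Asymptotics of the means\<close>

lemma partial_fractions_one:
  fixes x :: "nat \<Rightarrow> 'a :: field"
  assumes x: "inj_on x {..<n}" and n: "0 < n"
  shows "(\<Sum>i<n. \<Prod>j\<in>{..<n} - {i}. (z - x j) / (x i - x j)) = 1"
proof -
  have "poly (1 :: 'a poly) z = (\<Sum>i<n. \<Prod>j\<in>{..<n} - {i}. (z - x j) / (x i - x j))"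
    using n by (subst lagrange_interpolation[OF x]) (simp_all add: poly_sum poly_prod prod_dividef)
  then show ?thesis by simp
qed

text \<open>
  The residue theorem for simple poles on a disc, from partial fractions and Cauchy's formula.
\<close>

lemma contour_integral_simple_poles:
  fixes x :: "nat \<Rightarrow> complex"
  assumes x: "inj_on x {..<n}" "\<And>j. j < n \<Longrightarrow> norm (x j - c) < r" and n: "0 < n"
    and f: "continuous_on (cball c r) f" "f holomorphic_on ball c r"
  shows "((\<lambda>z. f z / (\<Prod>j<n. z - x j)) has_contour_integral
    2 * of_real pi * \<i> * (\<Sum>i<n. f (x i) / (\<Prod>j\<in>{..<n} - {i}. x i - x j))) (circlepath c r)"
proof -
  have r: "0 < r" using x(2)[of 0] n norm_ge_zero[of "x 0 - c"] by linarith
  have "((\<lambda>z. \<Sum>i<n. (f z / (z - x i)) * (1 / (\<Prod>j\<in>{..<n} - {i}. x i - x j))) has_contour_integral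
     (\<Sum>i<n. (2 * of_real pi * \<i> * f (x i)) * (1 / (\<Prod>j\<in>{..<n} - {i}. x i - x j)))) (circlepath c r)"
    by (intro has_contour_integral_sum has_contour_integral_rmul Cauchy_integral_circlepath f x) auto
  also have "?this \<longleftrightarrow> ((\<lambda>z. f z / (\<Prod>j<n. z - x j)) has_contour_integral
    2 * of_real pi * \<i> * (\<Sum>i<n. f (x i) / (\<Prod>j\<in>{..<n} - {i}. x i - x j))) (circlepath c r)"
  proof (rule has_contour_integral_cong)
    fix z assume "z \<in> path_image (circlepath c r)"
    then have "norm (z - c) = r" using r by (simp add: path_image_circlepath dist_norm norm_minus_commute)
    then have ne: "z - x i \<noteq> 0" if "i < n" for i using x(2)[OF that] by auto
    have "(\<Sum>i<n. (f z / (z - x i)) * (1 / (\<Prod>j\<in>{..<n} - {i}. x i - x j)))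
        = (\<Sum>i<n. f z / (\<Prod>j<n. z - x j) * (\<Prod>j\<in>{..<n} - {i}. (z - x j) / (x i - x j)))"
    proof (rule sum.cong[OF refl])
      fix i assume "i \<in> {..<n}"
      then have i: "i < n" by simp
      have "(\<Prod>j<n. z - x j) = (z - x i) * (\<Prod>j\<in>{..<n} - {i}. z - x j)"
        using i by (subst prod.remove[of _ i]) auto
      moreover have "(\<Prod>j\<in>{..<n} - {i}. z - x j) \<noteq> 0" using ne by auto
      ultimately show "(f z / (z - x i)) * (1 / (\<Prod>j\<in>{..<n} - {i}. x i - x j))
        = f z / (\<Prod>j<n. z - x j) * (\<Prod>j\<in>{..<n} - {i}. (z - x j) / (x i - x j))"
        by (simp add: prod_dividef)
    qed
    also have "\<dots> = f z / (\<Prod>j<n. z - x j)"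
      unfolding sum_distrib_left[symmetric] partial_fractions_one[OF x(1) n] by simp
    finally show "(\<Sum>i<n. (f z / (z - x i)) * (1 / (\<Prod>j\<in>{..<n} - {i}. x i - x j))) = f z / (\<Prod>j<n. z - x j)" .
  qed (simp_all add: sum_distrib_left)
  finally show ?thesis .
qed

text \<open>
  The summands of the exact mean of the \<open>m\<close>-th power sum are, up to the factor \<open>q ^ m - 1\<close>, the
  residues of \<open>phi (q ^ m * z) / (phi z * z)\<close> at the points \<open>q ^ i\<close>, \<open>i < n\<close>.
\<close>

definition phi :: "real \<Rightarrow> real \<Rightarrow> nat \<Rightarrow> nat \<Rightarrow> complex \<Rightarrow> complex" where
  "phi q \<eta> n k z = (\<Prod>j<n. z - of_real (q ^ j)) * (\<Prod>e<k. 1 + of_real (\<eta> / q ^ e) * z)"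

text \<open>
  The quotient \<open>phi (q * z) / phi z\<close>, in which all but the extreme factors cancel.
\<close>

definition phi_ratio :: "real \<Rightarrow> real \<Rightarrow> nat \<Rightarrow> nat \<Rightarrow> complex \<Rightarrow> complex" where
  "phi_ratio q \<eta> n k z = of_real (q ^ n) * (z - of_real (1 / q)) * (1 + of_real (\<eta> * q) * z)
     / ((z - of_real (q ^ n / q)) * (1 + of_real (\<eta> * q / q ^ k) * z))"

lemma phi_shift:
  assumes q: "0 < q"
  shows "phi q \<eta> n k (of_real q * z) * ((z - of_real (q ^ n / q)) * (1 + of_real (\<eta> * q / q ^ k) * z))
    = of_real (q ^ n) * (z - of_real (1 / q)) * (1 + of_real (\<eta> * q) * z) * phi q \<eta> n k z"
proof -
  have 1: "(\<Prod>j<n. of_real q * z - of_real (q ^ j)) * (z - of_real (q ^ n / q))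
      = of_real (q ^ n) * (z - of_real (1 / q)) * (\<Prod>j<n. z - of_real (q ^ j))"
  proof (induction n)
    case (Suc n)
    have "of_real q * z - of_real (q ^ n) = of_real q * (z - of_real (q ^ n / q))"
      using q by (simp add: field_simps)
    then have "(\<Prod>j<Suc n. of_real q * z - of_real (q ^ j)) * (z - of_real (q ^ Suc n / q))
      = ((\<Prod>j<n. of_real q * z - of_real (q ^ j)) * (z - of_real (q ^ n / q))) * of_real q * (z - of_real (q ^ n))"
      using q by simp
    then show ?case unfolding Suc by simp
  qed simp
  have 2: "(\<Prod>e<k. 1 + of_real (\<eta> / q ^ e) * (of_real q * z)) * (1 + of_real (\<eta> * q / q ^ k) * z)
      = (1 + of_real (\<eta> * q) * z) * (\<Prod>e<k. 1 + of_real (\<eta> / q ^ e) * z)"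
  proof (induction k)
    case (Suc k)
    have "of_real (\<eta> / q ^ k) * (of_real q * z) = of_real (\<eta> * q / q ^ k) * z" by simp
    then have "(\<Prod>e<Suc k. 1 + of_real (\<eta> / q ^ e) * (of_real q * z)) * (1 + of_real (\<eta> * q / q ^ Suc k) * z)
      = ((\<Prod>e<k. 1 + of_real (\<eta> / q ^ e) * (of_real q * z)) * (1 + of_real (\<eta> * q / q ^ k) * z)) * (1 + of_real (\<eta> / q ^ k) * z)"
      using q by (simp add: mult_ac)
    then show ?case unfolding Suc by simp
  qed simp
  have "phi q \<eta> n k (of_real q * z) * ((z - of_real (q ^ n / q)) * (1 + of_real (\<eta> * q / q ^ k) * z))
     = ((\<Prod>j<n. of_real q * z - of_real (q ^ j)) * (z - of_real (q ^ n / q)))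
      * ((\<Prod>e<k. 1 + of_real (\<eta> / q ^ e) * (of_real q * z)) * (1 + of_real (\<eta> * q / q ^ k) * z))"
    unfolding phi_def by (simp only: mult_ac)
  also have "\<dots> = of_real (q ^ n) * (z - of_real (1 / q)) * (1 + of_real (\<eta> * q) * z) * phi q \<eta> n k z"
    unfolding 1 2 phi_def by (simp only: mult_ac)
  finally show ?thesis .
qed

lemma phi_iterated_ratio:
  assumes q: "0 < q"
    and nz: "phi q \<eta> n k z \<noteq> 0"
    and nz2: "\<And>s. s < m \<Longrightarrow> of_real (q ^ s) * z - of_real (q ^ n / q) \<noteq> 0"
    and nz3: "\<And>s. s < m \<Longrightarrow> 1 + of_real (\<eta> * q / q ^ k) * (of_real (q ^ s) * z) \<noteq> 0"
  shows "phi q \<eta> n k (of_real (q ^ m) * z) / phi q \<eta> n k z = (\<Prod>s<m. phi_ratio q \<eta> n k (of_real (q ^ s) * z))"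
  using nz2 nz3
proof (induction m)
  case 0
  then show ?case using nz by simp
next
  case (Suc m)
  let ?w = "of_real (q ^ m) * z"
  have "phi q \<eta> n k (of_real q * ?w) = phi_ratio q \<eta> n k ?w * phi q \<eta> n k ?w"
  proof -
    have gen: "a = b / d * w" if "a * d = b * w" "d \<noteq> 0" for a b d w :: complex
      using that by (simp add: field_simps)
    show ?thesis unfolding phi_ratio_def
      by (rule gen[OF phi_shift[OF q]]) (use Suc.prems(1,2)[of m] in simp)
  qed
  then have "phi q \<eta> n k (of_real (q ^ Suc m) * z) / phi q \<eta> n k z
     = phi_ratio q \<eta> n k ?w * (phi q \<eta> n k ?w / phi q \<eta> n k z)" by (simp add: mult_ac)
  also have "phi q \<eta> n k ?w / phi q \<eta> n k z = (\<Prod>s<m. phi_ratio q \<eta> n k (of_real (q ^ s) * z))"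
    by (rule Suc.IH) (use Suc.prems in auto)
  finally show ?case by simp
qed

lemma uniform_limit_affine:
  fixes a b :: "nat \<Rightarrow> complex"
  assumes "a \<longlonglongrightarrow> a0" "b \<longlonglongrightarrow> b0" "bounded X"
  shows "uniform_limit X (\<lambda>n z. a n * z + b n) (\<lambda>z. a0 * z + b0) sequentially"
proof (rule uniform_limitI)
  fix \<epsilon> :: real assume "0 < \<epsilon>"
  obtain R where R: "0 < R" "\<And>z. z \<in> X \<Longrightarrow> norm z \<le> R" using assms(3) unfolding bounded_pos by blast
  have "eventually (\<lambda>n. dist (a n) a0 < \<epsilon> / (2 * R)) sequentially"
    using assms(1) R \<open>0 < \<epsilon>\<close> by (intro tendstoD) auto
  moreover have "eventually (\<lambda>n. dist (b n) b0 < \<epsilon> / 2) sequentially"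
    using assms(2) \<open>0 < \<epsilon>\<close> by (intro tendstoD) auto
  ultimately show "eventually (\<lambda>n. \<forall>z\<in>X. dist (a n * z + b n) (a0 * z + b0) < \<epsilon>) sequentially"
  proof eventually_elim
    case (elim n)
    show ?case
    proof
      fix z assume "z \<in> X"
      have "dist (a n * z + b n) (a0 * z + b0) = norm ((a n - a0) * z + (b n - b0))"
        by (simp add: dist_norm algebra_simps)
      also have "\<dots> \<le> norm (a n - a0) * norm z + norm (b n - b0)"
        by (metis norm_triangle_ineq norm_mult)
      also have "norm (a n - a0) * norm z \<le> \<epsilon> / (2 * R) * R"
        using elim R(2)[OF \<open>z \<in> X\<close>] R(1) \<open>0 < \<epsilon>\<close> by (intro mult_mono) (auto simp: dist_norm)
      also have "\<dots> + norm (b n - b0) < \<epsilon>" using elim R by (simp add: dist_norm)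
      finally show "dist (a n * z + b n) (a0 * z + b0) < \<epsilon>" by simp
    qed
  qed
qed

text \<open>
  The one-point weight of the ensemble contains \<open>\<eta> n ^ a\<close>; the limit \<open>\<theta> * e\<close> of \<open>\<eta> n\<close> is the only
  trace that the choice of the measure leaves in the limit.
\<close>

locale limit_curve_sequence = limit_curve \<gamma> T \<theta> for \<gamma> T \<theta> :: real +
  fixes c :: real and k :: "nat \<Rightarrow> nat" and \<eta> :: "nat \<Rightarrow> real"
  assumes Tc: "T = c + 1" and k_top: "filterlim k at_top sequentially"
    and kn: "(\<lambda>n. real (k n) / real n) \<longlonglongrightarrow> c"
    and eta: "\<eta> \<longlonglongrightarrow> \<theta> * e" "eventually (\<lambda>n. 0 < \<eta> n) sequentially"
begin

definition q :: "nat \<Rightarrow> real" where "q n = 1 - \<gamma> / real n"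

lemma q_limit: "q \<longlonglongrightarrow> 1"
proof -
  have "(\<lambda>n. 1 - \<gamma> / real n) \<longlonglongrightarrow> 1 - 0" by (intro tendsto_intros lim_const_over_n)
  then show ?thesis by (simp add: q_def[abs_def])
qed

lemma q_eventually: "eventually (\<lambda>n. 0 < q n \<and> q n \<noteq> 1 \<and> 0 < n \<and> 0 < k n) sequentially"
proof -
  have "eventually (\<lambda>n. 0 < q n) sequentially" using q_limit by (rule order_tendstoD) simp
  moreover have "eventually (\<lambda>n. 0 < n) sequentially" by (rule eventually_gt_at_top)
  moreover have "eventually (\<lambda>n. 0 < k n) sequentially" using k_top eventually_gt_at_top[of 0] unfolding filterlim_iff by blast
  ultimately show ?thesis by eventually_elim (use gamma in \<open>auto simp: q_def\<close>)
qed

lemma q_power_n: "(\<lambda>n. q n ^ n) \<longlonglongrightarrow> exp (- \<gamma>)"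
  using tendsto_exp_limit_sequentially[of "- \<gamma>"] by (simp add: q_def[abs_def])

lemma q_power_ratio:
  assumes "(\<lambda>n. real (j n) / real n) \<longlonglongrightarrow> a"
  shows "(\<lambda>n. q n ^ j n) \<longlonglongrightarrow> exp (- \<gamma> * a)"
proof -
  have ln: "(\<lambda>n. ln (q n ^ n)) \<longlonglongrightarrow> ln (exp (- \<gamma>))" by (intro tendsto_ln q_power_n) simp
  have "(\<lambda>n. exp (ln (q n ^ n) * (real (j n) / real n))) \<longlonglongrightarrow> exp (ln (exp (- \<gamma>)) * a)"
    by (rule tendsto_exp[OF tendsto_mult[OF ln assms]])
  moreover have "eventually (\<lambda>n. exp (ln (q n ^ n) * (real (j n) / real n)) = q n ^ j n) sequentially"
    using q_eventually
  proof eventually_elim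
    case (elim n)
    then have "ln (q n ^ n) * (real (j n) / real n) = ln (q n ^ j n)"
      by (simp add: ln_realpow)
    then show ?case using elim by simp
  qed
  ultimately show ?thesis using tendsto_cong by fastforce
qed

lemma q_power_difference: "(\<lambda>n. real n * (q n ^ m - 1)) \<longlonglongrightarrow> - (real m * \<gamma>)"
proof -
  have "(\<lambda>n. (- \<gamma>) * (\<Sum>s<m. q n ^ s)) \<longlonglongrightarrow> (- \<gamma>) * (\<Sum>s<m. 1 ^ s)"
    by (intro tendsto_intros q_limit)
  moreover have "eventually (\<lambda>n. (- \<gamma>) * (\<Sum>s<m. q n ^ s) = real n * (q n ^ m - 1)) sequentially"
    using eventually_gt_at_top[of 0]
  proof eventually_elim
    case (elim n)
    have "q n ^ m - 1 = (q n - 1) * (\<Sum>s<m. q n ^ s)" by (rule power_diff_1_eq)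
    moreover have "real n * (q n - 1) = - \<gamma>" using elim by (simp add: q_def)
    ultimately show ?case by (metis mult.assoc)
  qed
  ultimately have "(\<lambda>n. real n * (q n ^ m - 1)) \<longlonglongrightarrow> (- \<gamma>) * (\<Sum>s<m. 1 ^ s)"
    by (rule Lim_transform_eventually)
  then show ?thesis by (simp add: mult.commute)
qed

text \<open>
  The mean of the \<open>m\<close>-th power sum, in the form given by \<open>ensemble_moments\<close>.
\<close>

definition moment :: "nat \<Rightarrow> nat \<Rightarrow> real" where
  "moment m n = (\<Sum>i<n. omega (q n) (\<eta> n) (k n) (q n ^ m * q n ^ i) / omega (q n) (\<eta> n) (k n) (q n ^ i) *
     (\<Prod>j\<in>{..<n} - {i}. (q n ^ m * q n ^ i - q n ^ j) / (q n ^ i - q n ^ j)))"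

text \<open>
  All these quotients lie between \<open>q n ^ n\<close> and \<open>1 / q n ^ m\<close>, which tend to \<open>u 1\<close> and \<open>1\<close>. Hence the
  zeros of \<open>phi (q ^ s * z)\<close> that are positive stay inside the circle.
\<close>

lemma nodes_inside: "eventually (\<lambda>n. \<forall>s\<le>m. \<forall>j\<le>n. \<bar>q n ^ j / q n ^ s - ctr\<bar> < rad) sequentially"
proof -
  have lim1: "(\<lambda>n. 1 / q n ^ m) \<longlonglongrightarrow> 1 / 1 ^ m" by (intro tendsto_intros q_limit) auto
  have lim2: "(\<lambda>n. q n ^ n) \<longlonglongrightarrow> u 1" using q_power_n by (simp add: u_def)
  have "eventually (\<lambda>n. dist (1 / q n ^ m) 1 < rad - \<bar>1 - ctr\<bar>) sequentially"
    using tendstoD[OF lim1, of "rad - \<bar>1 - ctr\<bar>"] u_in_disc[of 0] by (simp add: u_def)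
  moreover have "eventually (\<lambda>n. dist (q n ^ n) (u 1) < rad - \<bar>u 1 - ctr\<bar>) sequentially"
    using tendstoD[OF lim2, of "rad - \<bar>u 1 - ctr\<bar>"] u_in_disc[of 1] by simp
  ultimately show ?thesis using q_eventually
  proof eventually_elim
    case (elim n)
    have ends: "\<bar>1 / q n ^ m - ctr\<bar> < rad" "\<bar>q n ^ n - ctr\<bar> < rad" using elim by (auto simp: dist_real_def)
    show ?case
    proof (intro allI impI)
      fix s j assume s: "s \<le> m" and j: "j \<le> n"
      have eq: "q n ^ j / q n ^ s = q n ^ (j + (m - s)) / q n ^ m" "q n ^ n = q n ^ (n + m) / q n ^ m"
        using s elim by (simp_all add: field_simps flip: power_add)
      have l: "j + (m - s) \<le> n + m" using j by simp
      have "min (1 / q n ^ m) (q n ^ n) \<le> q n ^ j / q n ^ s \<and> q n ^ j / q n ^ s \<le> max (1 / q n ^ m) (q n ^ n)"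
      proof (cases "q n \<le> 1")
        case True
        then have "q n ^ (n + m) \<le> q n ^ (j + (m - s))" "q n ^ (j + (m - s)) \<le> 1"
          using elim l by (auto intro: power_decreasing power_le_one)
        then show ?thesis unfolding eq using elim by (auto simp: min_le_iff_disj le_max_iff_disj divide_right_mono)
      next
        case False
        then have "q n ^ (j + (m - s)) \<le> q n ^ (n + m)" "1 \<le> q n ^ (j + (m - s))"
          using elim l by (auto intro: power_increasing one_le_power)
        then show ?thesis unfolding eq using elim by (auto simp: min_le_iff_disj le_max_iff_disj divide_right_mono)
      qed
      then show "\<bar>q n ^ j / q n ^ s - ctr\<bar> < rad" using ends by (auto simp: min_def max_def abs_less_iff split: if_splits)
    qed
  qed
qed

lemma phi_nonzero:
  assumes "0 < q n" "0 < \<eta> n" "\<forall>s\<le>m. \<forall>j\<le>n. \<bar>q n ^ j / q n ^ s - ctr\<bar> < rad" "s \<le> m" "0 < n"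
    and z: "z \<in> sphere (of_real ctr) rad"
  shows "phi (q n) (\<eta> n) n (k n) (of_real (q n ^ s) * z) \<noteq> 0"
    and "of_real (q n ^ s) * z - of_real (q n ^ n / q n) \<noteq> 0"
    and "1 + of_real (\<eta> n * q n / q n ^ k n) * (of_real (q n ^ s) * z) \<noteq> 0"
proof -
  have Re: "0 < Re z" by (rule sphere_props(1)[OF z])
  have 1: "of_real (q n ^ s) * z - of_real (q n ^ j) \<noteq> 0" if "j \<le> n" for j
  proof
    assume "of_real (q n ^ s) * z - of_real (q n ^ j) = 0"
    then have "z = of_real (q n ^ j / q n ^ s)" using assms(1) by (simp add: field_simps)
    moreover have "\<bar>q n ^ j / q n ^ s - ctr\<bar> < rad" using assms(3,4) that by blast
    moreover have "norm (z - of_real ctr) = rad" using z by (simp add: dist_norm norm_minus_commute)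
    ultimately show False by (simp only: of_real_diff[symmetric] norm_of_real)
  qed
  have 2: "1 + of_real a * (of_real (q n ^ s) * z) \<noteq> 0" if "0 < a" for a
    using second_factor_nz[OF Re, of 1 "a * q n ^ s"] that assms(1) by (simp add: mult_ac add.commute)
  show "phi (q n) (\<eta> n) n (k n) (of_real (q n ^ s) * z) \<noteq> 0"
  proof -
    have "1 + of_real (\<eta> n / q n ^ e) * (of_real (q n ^ s) * z) \<noteq> 0" for e
      using assms(1,2) by (intro 2) simp
    then show ?thesis unfolding phi_def using 1 by (simp add: less_imp_le del: of_real_divide of_real_power)
  qed
  have "q n ^ n / q n = q n ^ (n - 1)" using assms(1,5) by (cases n) auto
  then show "of_real (q n ^ s) * z - of_real (q n ^ n / q n) \<noteq> 0" using 1[of "n - 1"] by simp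
  show "1 + of_real (\<eta> n * q n / q n ^ k n) * (of_real (q n ^ s) * z) \<noteq> 0"
    using assms(1,2) by (intro 2) simp
qed

lemma moment_contour:
  assumes m: "0 < m"
  shows "eventually (\<lambda>n. of_real (moment m n) = contour_integral circ
      (\<lambda>z. (\<Prod>s<m. phi_ratio (q n) (\<eta> n) n (k n) (of_real (q n ^ s) * z)) / z) / (2 * pi * \<i>) / of_real (q n ^ m - 1)) sequentially"
  using nodes_inside[of m] q_eventually eta(2)
proof eventually_elim
  case (elim n)
  then have q: "0 < q n" "q n \<noteq> 1" and eta: "0 < \<eta> n" and n: "0 < n" "0 < k n"
    and nodes: "\<forall>s\<le>m. \<forall>j\<le>n. \<bar>q n ^ j / q n ^ s - ctr\<bar> < rad" by auto
  define x where "x j = complex_of_real (q n ^ j)" for j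
  define Om where "Om z = (\<Prod>e<k n. 1 + complex_of_real (\<eta> n / q n ^ e) * z)" for z
  define f where "f z = (\<Prod>j<n. of_real (q n ^ m) * z - x j) * Om (of_real (q n ^ m) * z) / (Om z * z)" for z
  have Omz: "Om z \<noteq> 0" "z \<noteq> 0" if "z \<in> cball (of_real ctr) rad" for z
  proof -
    have "0 < Re z" by (rule Re_pos_cball[OF that])
    then have "1 + complex_of_real (\<eta> n / q n ^ e) * z \<noteq> 0" for e
      using second_factor_nz[of z 1 "\<eta> n / q n ^ e"] q eta by (simp add: add.commute del: of_real_divide)
    then show "Om z \<noteq> 0" by (simp add: Om_def del: of_real_divide)
    show "z \<noteq> 0" using \<open>0 < Re z\<close> by auto
  qed
  have q1: "q n ^ m \<noteq> 1" using inj_power[OF q] m by (metis injD power_0 less_irrefl)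
  have inj: "inj_on x {..<n}" unfolding x_def using inj_power[OF q] by (auto simp: inj_on_def inj_def simp del: of_real_power)
  have near: "norm (x j - of_real ctr) < rad" if "j < n" for j
    using nodes[rule_format, of 0 j] that unfolding x_def by (simp flip: of_real_diff of_real_power)
  have "((\<lambda>z. f z / (\<Prod>j<n. z - x j)) has_contour_integral
    2 * of_real pi * \<i> * (\<Sum>i<n. f (x i) / (\<Prod>j\<in>{..<n} - {i}. x i - x j))) circ"
    unfolding circ_def
  proof (rule contour_integral_simple_poles[OF inj near n(1)])
    show "continuous_on (cball (of_real ctr) rad) f" unfolding f_def Om_def
      using Omz unfolding Om_def by (intro continuous_intros) auto
    show "f holomorphic_on ball (of_real ctr) rad" unfolding f_def Om_def
      using Omz unfolding Om_def by (intro holomorphic_intros) auto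
  qed
  then have "contour_integral circ (\<lambda>z. f z / (\<Prod>j<n. z - x j)) / (2 * pi * \<i>)
     = (\<Sum>i<n. f (x i) / (\<Prod>j\<in>{..<n} - {i}. x i - x j))"
    by (simp add: contour_integral_unique)
  also have "\<dots> = of_real (q n ^ m - 1) * of_real (moment m n)"
    unfolding moment_def of_real_sum sum_distrib_left
  proof (rule sum.cong[OF refl])
    fix i assume "i \<in> {..<n}"
    then have i: "i < n" by simp
    have "(\<Prod>j<n. of_real (q n ^ m) * x i - x j)
        = (of_real (q n ^ m) * x i - x i) * (\<Prod>j\<in>{..<n} - {i}. of_real (q n ^ m) * x i - x j)"
      using i by (subst prod.remove[of _ i]) auto
    moreover have "of_real (q n ^ m) * x i - x i = of_real (q n ^ m - 1) * x i" by (simp add: algebra_simps)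
    moreover have "x i \<noteq> 0" using q by (simp add: x_def)
    ultimately have "f (x i) / (\<Prod>j\<in>{..<n} - {i}. x i - x j) = of_real (q n ^ m - 1) *
       (Om (of_real (q n ^ m) * x i) / Om (x i) * (\<Prod>j\<in>{..<n} - {i}. (of_real (q n ^ m) * x i - x j) / (x i - x j)))"
      unfolding f_def by (simp add: prod_dividef)
    moreover have "Om (of_real y) = of_real (omega (q n) (\<eta> n) (k n) y)" for y
      unfolding Om_def omega_def by simp
    note this[of "q n ^ m * q n ^ i"] this[of "q n ^ i"]
    ultimately show "f (x i) / (\<Prod>j\<in>{..<n} - {i}. x i - x j) = of_real (q n ^ m - 1) * of_real
        (omega (q n) (\<eta> n) (k n) (q n ^ m * q n ^ i) / omega (q n) (\<eta> n) (k n) (q n ^ i) *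
         (\<Prod>j\<in>{..<n} - {i}. (q n ^ m * q n ^ i - q n ^ j) / (q n ^ i - q n ^ j)))"
      unfolding x_def by simp
  qed
  finally have eq: "contour_integral circ (\<lambda>z. f z / (\<Prod>j<n. z - x j)) / (2 * pi * \<i>)
    = of_real (q n ^ m - 1) * of_real (moment m n)" .
  have "complex_of_real (q n ^ m - 1) \<noteq> 0" using q1 by (simp only: of_real_eq_0_iff)
  then have main: "of_real (moment m n) = contour_integral circ (\<lambda>z. f z / (\<Prod>j<n. z - x j)) / (2 * pi * \<i>) / of_real (q n ^ m - 1)"
    unfolding eq by (simp del: of_real_diff)
  have "contour_integral circ (\<lambda>z. f z / (\<Prod>j<n. z - x j))
     = contour_integral circ (\<lambda>z. (\<Prod>s<m. phi_ratio (q n) (\<eta> n) n (k n) (of_real (q n ^ s) * z)) / z)"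
  proof (rule contour_integral_cong)
    fix z assume "z \<in> path_image circ"
    then have z: "z \<in> sphere (of_real ctr) rad" by (simp add: path_image_circ)
    have "phi (q n) (\<eta> n) n (k n) (of_real (q n ^ m) * z) / phi (q n) (\<eta> n) n (k n) z
       = (\<Prod>s<m. phi_ratio (q n) (\<eta> n) n (k n) (of_real (q n ^ s) * z))"
      using phi_nonzero[OF q(1) eta nodes _ n(1) z] phi_nonzero(1)[OF q(1) eta nodes _ n(1) z, of 0]
      by (intro phi_iterated_ratio[OF q(1)]) auto
    moreover have "f z / (\<Prod>j<n. z - x j) = phi (q n) (\<eta> n) n (k n) (of_real (q n ^ m) * z) / phi (q n) (\<eta> n) n (k n) z / z"
      unfolding f_def phi_def Om_def x_def by (simp add: mult_ac)
    ultimately show "f z / (\<Prod>j<n. z - x j) = (\<Prod>s<m. phi_ratio (q n) (\<eta> n) n (k n) (of_real (q n ^ s) * z)) / z" by simp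
  qed simp
  then show ?case using main by simp
qed

lemma bounded_circle: "bounded (sphere (of_real ctr) rad :: complex set)"
  using compact_imp_bounded[OF compact_sphere] .

lemma phi_ratio_limit:
  "uniform_limit (sphere (of_real ctr) rad) (\<lambda>n z. phi_ratio (q n) (\<eta> n) n (k n) (of_real (q n ^ s) * z)) (G 1) sequentially"
proof -
  let ?X = "sphere (complex_of_real ctr) rad"
  define b1 where "b1 z = (1 * z + (- 1)) * (of_real (\<theta> * e) * z + 1)" for z :: complex
  define b2 where "b2 z = (1 * z + (- of_real (u 1))) * (of_real (\<theta> * u 1) * z + 1)" for z :: complex
  have qs: "(\<lambda>n. q n ^ s) \<longlonglongrightarrow> 1" using tendsto_power[OF q_limit, of s] by simp
  have qk: "(\<lambda>n. q n ^ k n) \<longlonglongrightarrow> exp (- \<gamma> * c)" by (rule q_power_ratio[OF kn])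
  have qn: "(\<lambda>n. q n ^ n) \<longlonglongrightarrow> u 1" using q_power_n by (simp add: u_def)
  have lim1: "(\<lambda>n. complex_of_real (q n ^ s)) \<longlonglongrightarrow> 1" using tendsto_of_real[OF qs, where 'a = complex] by simp
  have "(\<lambda>n. 1 / q n) \<longlonglongrightarrow> 1 / 1" by (intro tendsto_intros q_limit) simp
  then have lim2: "(\<lambda>n. - complex_of_real (1 / q n)) \<longlonglongrightarrow> - 1" using tendsto_minus[OF tendsto_of_real[where 'a = complex]] by fastforce
  have "(\<lambda>n. \<eta> n * q n * q n ^ s) \<longlonglongrightarrow> (\<theta> * e) * 1 * 1" by (intro tendsto_intros eta q_limit qs)
  then have lim3: "(\<lambda>n. complex_of_real (\<eta> n * q n * q n ^ s)) \<longlonglongrightarrow> of_real (\<theta> * e)" using tendsto_of_real[where 'a = complex] by fastforce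
  have "(\<lambda>n. q n ^ n / q n) \<longlonglongrightarrow> u 1 / 1" by (intro tendsto_intros q_limit qn) simp
  then have lim4: "(\<lambda>n. - complex_of_real (q n ^ n / q n)) \<longlonglongrightarrow> - of_real (u 1)" using tendsto_minus[OF tendsto_of_real[where 'a = complex]] by fastforce
  have "(\<lambda>n. \<eta> n * q n / q n ^ k n * q n ^ s) \<longlonglongrightarrow> (\<theta> * e) * 1 / exp (- \<gamma> * c) * 1" by (intro tendsto_intros eta q_limit qs qk) simp
  moreover have "(\<theta> * e) * 1 / exp (- \<gamma> * c) * 1 = \<theta> * u 1"
  proof -
    have "e = u 1 * exp (- \<gamma> * c)" unfolding e_def u_def unfolding Tc by (simp add: algebra_simps flip: exp_add)
    then show ?thesis by simp
  qed
  ultimately have lim5: "(\<lambda>n. complex_of_real (\<eta> n * q n / q n ^ k n * q n ^ s)) \<longlonglongrightarrow> of_real (\<theta> * u 1)" using tendsto_of_real[where 'a = complex] by fastforce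
  note aff = uniform_limit_affine[OF _ _ bounded_circle]
  have bdd: "bounded ((\<lambda>z. a * z + b) ` ?X)" for a b :: complex
    by (intro compact_imp_bounded compact_continuous_image continuous_intros compact_sphere)
  have num: "uniform_limit ?X (\<lambda>n z. (of_real (q n ^ s) * z + - of_real (1 / q n)) * (of_real (\<eta> n * q n * q n ^ s) * z + 1)) b1 sequentially"
    unfolding b1_def by (intro uniform_lim_mult aff lim1 lim2 lim3 tendsto_const bdd)
  have den: "uniform_limit ?X (\<lambda>n z. (of_real (q n ^ s) * z + - of_real (q n ^ n / q n)) * (of_real (\<eta> n * q n / q n ^ k n * q n ^ s) * z + 1)) b2 sequentially"
    unfolding b2_def by (intro uniform_lim_mult aff lim1 lim4 lim5 tendsto_const bdd)
  have b2: "b2 z \<noteq> 0" if "z \<in> ?X" for z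
    using sphere_props(1)[OF that] sphere_props(2)[OF that, of 1] second_factor_nz[of z 1 "\<theta> * u 1"] theta u_pos[of 1]
    unfolding b2_def by (simp add: less_imp_le)
  have cb: "continuous_on ?X b1" "continuous_on ?X b2" unfolding b1_def b2_def by (intro continuous_intros)+
  have "?X \<noteq> {}" using circ_sphere by blast
  obtain z0 where z0: "z0 \<in> ?X" "\<And>z. z \<in> ?X \<Longrightarrow> norm (b2 z0) \<le> norm (b2 z)"
    using continuous_attains_inf[OF compact_sphere \<open>?X \<noteq> {}\<close> continuous_on_norm[OF cb(2)]] by blast
  have quot: "uniform_limit ?X (\<lambda>n z. ((of_real (q n ^ s) * z + - of_real (1 / q n)) * (of_real (\<eta> n * q n * q n ^ s) * z + 1))
      / ((of_real (q n ^ s) * z + - of_real (q n ^ n / q n)) * (of_real (\<eta> n * q n / q n ^ k n * q n ^ s) * z + 1))) (\<lambda>z. b1 z / b2 z) sequentially"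
    by (rule uniform_lim_divide[OF num den _ z0(2)])
      (use b2[OF z0(1)] in \<open>auto intro!: compact_imp_bounded compact_continuous_image cb compact_sphere\<close>)
  have bdd2: "bounded ((\<lambda>z. b1 z / b2 z) ` ?X)"
    by (intro compact_imp_bounded compact_continuous_image continuous_intros cb compact_sphere) (use b2 in auto)
  have "uniform_limit ?X (\<lambda>n (z::complex). complex_of_real (q n ^ n)) (\<lambda>z. of_real (u 1)) sequentially"
    using aff[OF tendsto_const[of 0] tendsto_of_real[OF qn, where 'a = complex]] by simp
  from uniform_lim_mult[OF this quot _ bdd2]
  have "uniform_limit ?X (\<lambda>n z. of_real (q n ^ n) * (((of_real (q n ^ s) * z + - of_real (1 / q n)) * (of_real (\<eta> n * q n * q n ^ s) * z + 1))
      / ((of_real (q n ^ s) * z + - of_real (q n ^ n / q n)) * (of_real (\<eta> n * q n / q n ^ k n * q n ^ s) * z + 1))))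
      (\<lambda>z. of_real (u 1) * (b1 z / b2 z)) sequentially"
    by (simp add: image_constant_conv)
  moreover have "of_real (u 1) * (b1 z / b2 z) = G 1 z" for z
  proof -
    have "b2 z = of_real (u 1) * Den 1 z" unfolding b2_def Den_factor using u_pos[of 1] by (simp add: field_simps)
    moreover have "b1 z = Num z" by (simp add: b1_def Num_def)
    ultimately show ?thesis using u_pos[of 1] by (simp add: G_def)
  qed
  ultimately show ?thesis
    unfolding phi_ratio_def by (simp add: mult_ac add.commute)
qed

text \<open>
  On the circle each of the \<open>m\<close> factors of the integrand tends uniformly to \<open>G 1\<close>, and
  \<open>n * (q n ^ m - 1)\<close> tends to \<open>- m * \<gamma>\<close>.
\<close>

theorem moment_limit:
  assumes m: "0 < m"
  shows "(\<lambda>n. moment m n / real n) \<longlonglongrightarrow> Re (- contour_moment m 1 / of_real (m * \<gamma>))"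
proof -
  let ?X = "sphere (complex_of_real ctr) rad"
  have nzD: "Den 1 z \<noteq> 0" if "z \<in> ?X" for z using Den_nz_sphere[OF that] by simp
  have contG: "continuous_on ?X (G 1)"
    unfolding G_def Num_def Den_def using nzD unfolding Den_def by (intro continuous_intros) auto
  have prod: "uniform_limit ?X (\<lambda>n z. \<Prod>s<m. phi_ratio (q n) (\<eta> n) n (k n) (of_real (q n ^ s) * z)) (\<lambda>z. G 1 z ^ m) sequentially"
  proof (induction m)
    case 0
    then show ?case by (simp add: uniform_limit_const)
  next
    case (Suc m)
    have "bounded ((\<lambda>z. G 1 z ^ m) ` ?X)" "bounded (G 1 ` ?X)"
      by (intro compact_imp_bounded compact_continuous_image continuous_intros contG compact_sphere)+
    from uniform_lim_mult[OF Suc phi_ratio_limit this] show ?case by (simp add: mult.commute)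
  qed
  have inv: "bounded ((\<lambda>z::complex. 1 / z) ` ?X)"
    by (intro compact_imp_bounded compact_continuous_image continuous_intros compact_sphere) (use sphere_props(3) in blast)
  have lim: "uniform_limit ?X (\<lambda>n z. (\<Prod>s<m. phi_ratio (q n) (\<eta> n) n (k n) (of_real (q n ^ s) * z)) * (1 / z)) (\<lambda>z. G 1 z ^ m * (1 / z)) sequentially"
    by (rule uniform_lim_mult[OF prod uniform_limit_const _ inv])
      (intro compact_imp_bounded compact_continuous_image continuous_intros contG compact_sphere)
  have intg: "eventually (\<lambda>n. (\<lambda>z. (\<Prod>s<m. phi_ratio (q n) (\<eta> n) n (k n) (of_real (q n ^ s) * z)) * (1 / z)) contour_integrable_on circ) sequentially"
    using nodes_inside[of m] q_eventually eta(2)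
  proof eventually_elim
    case (elim n)
    show ?case
    proof (rule circ_integrable, intro continuous_intros)
      fix s assume "s \<in> {..<m}"
      then have nz: "of_real (q n ^ s) * z - of_real (q n ^ n / q n) \<noteq> 0"
        "1 + of_real (\<eta> n * q n / q n ^ k n) * (of_real (q n ^ s) * z) \<noteq> 0" if "z \<in> ?X" for z
        using phi_nonzero(2,3)[of n m s z] elim that by auto
      show "continuous_on ?X (\<lambda>z. phi_ratio (q n) (\<eta> n) n (k n) (of_real (q n ^ s) * z))"
        unfolding phi_ratio_def using nz by (intro continuous_intros) auto
    qed (use sphere_props(3) in blast)
  qed
  have "(\<lambda>n. contour_integral circ (\<lambda>z. (\<Prod>s<m. phi_ratio (q n) (\<eta> n) n (k n) (of_real (q n ^ s) * z)) * (1 / z)))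
      \<longlonglongrightarrow> contour_integral circ (\<lambda>z. G 1 z ^ m * (1 / z))"
    using contour_integral_uniform_limit_circlepath(2)[OF intg[unfolded circ_def] lim _ rad_bounds(3)]
    by (simp add: circ_def)
  then have "(\<lambda>n. contour_integral circ (\<lambda>z. (\<Prod>s<m. phi_ratio (q n) (\<eta> n) n (k n) (of_real (q n ^ s) * z)) * (1 / z))
      / (2 * pi * \<i>) / of_real (real n * (q n ^ m - 1))) \<longlonglongrightarrow> contour_integral circ (\<lambda>z. G 1 z ^ m * (1 / z)) / (2 * pi * \<i>) / of_real (- (real m * \<gamma>))"
    using m gamma by (intro tendsto_intros q_power_difference) auto
  moreover have "eventually (\<lambda>n. contour_integral circ (\<lambda>z. (\<Prod>s<m. phi_ratio (q n) (\<eta> n) n (k n) (of_real (q n ^ s) * z)) * (1 / z))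
      / (2 * pi * \<i>) / of_real (real n * (q n ^ m - 1)) = of_real (moment m n / real n)) sequentially"
    using moment_contour[OF m] by eventually_elim (simp add: mult_ac)
  ultimately have "(\<lambda>n. of_real (moment m n / real n)) \<longlonglongrightarrow> contour_integral circ (\<lambda>z. G 1 z ^ m * (1 / z)) / (2 * pi * \<i>) / of_real (- (real m * \<gamma>))"
    by (rule Lim_transform_eventually)
  then have "(\<lambda>n. Re (of_real (moment m n / real n))) \<longlonglongrightarrow> Re (contour_integral circ (\<lambda>z. G 1 z ^ m * (1 / z)) / (2 * pi * \<i>) / of_real (- (real m * \<gamma>)))"
    by (rule tendsto_Re)
  then show ?thesis by (simp add: contour_moment_def)
qed

end

context limit_curve
begin

text \<open>
  Multiply numerator and denominator by suitable powers of \<open>exp \<gamma>\<close> to pass to the coordinate \<open>u t\<close>;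
  here \<open>D 1 = exp \<gamma> * (1 - exp (\<gamma> * (c - 1)))\<close>, and \<open>1 - \<theta> * e\<close> vanishes.
\<close>

lemma rho_A_eq:
  assumes T: "T = c + 1" and \<theta>: "\<theta> * e = 1" and t: "0 < t" "t < T"
  shows "rho_A c \<gamma> t = rho t"
proof -
  define X where "X = (1 - u t) * (u t - e)"
  have X: "0 < X" unfolding X_def by (rule inside_pos[OF t])
  have e: "e = exp (- \<gamma> * (c + 1))" unfolding e_def by (simp add: T)
  have "e * exp (\<gamma> * (c + 1)) = 1" by (simp add: e flip: exp_add)
  then have th: "\<theta> = exp (\<gamma> * (c + 1))" using \<theta> by (metis mult.assoc mult_1 mult.right_neutral)
  have prod: "(1 - exp (\<gamma> * t)) * (1 - exp (\<gamma> * (c + 1 - t))) = X / (u t * e)"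
  proof -
    have f: "exp (\<gamma> * t) = 1 / u t" "exp (\<gamma> * (c + 1 - t)) = u t / e"
      by (simp_all add: u_def e exp_minus field_simps flip: exp_add)
    show ?thesis unfolding f using u_pos[of t] e_pos by (simp add: X_def field_simps)
  qed
  have D1: "D 1 = exp \<gamma> * (1 - exp (\<gamma> * (c - 1)))"
    unfolding D_def by (simp add: th algebra_simps flip: exp_add)
  have half: "exp (\<gamma> - \<gamma> * t / 2) = exp \<gamma> * sqrt (u t)"
  proof -
    have "sqrt (u t) = exp (- (\<gamma> * t / 2))" by (rule real_sqrt_unique) (simp_all add: u_def flip: exp_double)
    then show ?thesis by (simp flip: exp_add)
  qed
  have "sgn (- \<gamma>) * (exp (\<gamma> - \<gamma> * t / 2) / 2) * ((1 - exp (\<gamma> * (c - 1))) / sqrt (X / (u t * e))) = h 1 t"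
  proof -
    have 1: "sqrt (X / (u t * e)) = sqrt X / (sqrt (u t) * sqrt e)" by (simp add: real_sqrt_divide real_sqrt_mult)
    have "\<theta> = 1 / e" using \<theta> e_pos by (simp add: field_simps)
    then have 2: "sqrt (\<theta> * X) = sqrt X / sqrt e" by (simp add: real_sqrt_divide)
    have 3: "sqrt (u t) * sqrt (u t) = u t" using u_pos[of t] by simp
    define w where "w = 1 - exp (\<gamma> * (c - 1))"
    have "sgn (- \<gamma>) * (exp \<gamma> * sqrt (u t) / 2) * (w / sqrt (X / (u t * e)))
       = - sgn \<gamma> * ((sqrt (u t) * sqrt (u t)) * (exp \<gamma> * w)) / (2 * (sqrt X / sqrt e))"
      unfolding 1 sgn_minus by (simp add: mult_ac)
    also have "\<dots> = h 1 t" unfolding 3 h_def D1 \<theta> X_def[symmetric] 2 w_def by simp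
    finally show ?thesis unfolding half w_def .
  qed
  then show ?thesis unfolding rho_A_def rho_def prod by simp
qed

text \<open>
  The same change of coordinate, with \<open>D 1 = exp \<gamma> - 1\<close> and \<open>\<theta> * e = exp (- \<gamma> * c)\<close>.
\<close>

lemma rho_B_eq:
  assumes T: "T = c + 1" and \<theta>: "\<theta> = exp \<gamma>" and t: "0 < t" "t < T"
  shows "rho_B c \<gamma> t = rho t"
proof -
  define X where "X = (1 - u t) * (u t - e)"
  have X: "0 < X" unfolding X_def by (rule inside_pos[OF t])
  have e: "e = exp (- \<gamma> * (c + 1))" unfolding e_def by (simp add: T)
  have prod: "(1 - exp (\<gamma> * t)) * (1 - exp (\<gamma> * (c + 1 - t))) = X / (u t * e)"
  proof -
    have f: "exp (\<gamma> * t) = 1 / u t" "exp (\<gamma> * (c + 1 - t)) = u t / e"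
      by (simp_all add: u_def e exp_minus field_simps flip: exp_add)
    show ?thesis unfolding f using u_pos[of t] e_pos by (simp add: X_def field_simps)
  qed
  have D1: "D 1 = exp \<gamma> - 1" unfolding D_def by (simp add: \<theta> flip: exp_add)
  have \<theta>e: "\<theta> * e = exp (- (\<gamma> * c))" by (simp add: \<theta> e algebra_simps flip: exp_add)
  have num: "1 - exp (\<gamma> * c) - exp (\<gamma> * (c - t)) + exp (\<gamma> * (c + 1 - t))
     = exp (\<gamma> * c) * (u t * (exp \<gamma> - 1) - (1 - exp (- (\<gamma> * c))))"
    by (simp add: u_def algebra_simps flip: exp_add)
  have half: "exp (\<gamma> / 2 * (t - c)) * exp (\<gamma> * c) * (sqrt (u t) * sqrt e) = 1 / sqrt \<theta>"
  proof -
    have "sqrt (u t) = exp (- (\<gamma> * t / 2))" by (rule real_sqrt_unique) (simp_all add: u_def flip: exp_double)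
    moreover have "sqrt e = exp (- (\<gamma> * (c + 1) / 2))" by (rule real_sqrt_unique) (simp_all add: e flip: exp_double)
    moreover have "sqrt \<theta> = exp (\<gamma> / 2)" by (rule real_sqrt_unique) (simp_all add: \<theta> flip: exp_double)
    moreover have "1 / exp (\<gamma> / 2) = exp (- (\<gamma> / 2))" by (simp add: exp_minus field_simps)
    ultimately show ?thesis by (simp add: field_simps flip: exp_add)
  qed
  have "sgn (- \<gamma>) * (exp (\<gamma> / 2 * (t - c)) / 2) * (exp (\<gamma> * c) * (u t * (exp \<gamma> - 1) - (1 - exp (- (\<gamma> * c)))) / sqrt (X / (u t * e))) = h 1 t"
  proof -
    have 1: "sqrt (X / (u t * e)) = sqrt X / (sqrt (u t) * sqrt e)" by (simp add: real_sqrt_divide real_sqrt_mult)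
    have 2: "sqrt (\<theta> * X) = sqrt \<theta> * sqrt X" by (rule real_sqrt_mult)
    define w where "w = u t * (exp \<gamma> - 1) - (1 - exp (- (\<gamma> * c)))"
    have "sgn (- \<gamma>) * (exp (\<gamma> / 2 * (t - c)) / 2) * (exp (\<gamma> * c) * w / sqrt (X / (u t * e)))
       = - sgn \<gamma> * w / (2 * sqrt X) * (exp (\<gamma> / 2 * (t - c)) * exp (\<gamma> * c) * (sqrt (u t) * sqrt e))"
      unfolding 1 sgn_minus by (simp add: mult_ac)
    also have "\<dots> = - sgn \<gamma> * w / (2 * (sqrt \<theta> * sqrt X))" unfolding half by (simp add: mult_ac)
    also have "\<dots> = h 1 t" unfolding h_def D1 \<theta>e X_def[symmetric] 2 w_def ..
    finally show ?thesis unfolding w_def .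
  qed
  then show ?thesis unfolding rho_B_def rho_def prod num by simp
qed

end

section \<open>From positions to the boundary of the diagram\<close>

lemma random_diagram_measure:
  assumes rd: "random_diagram M L n k pr" and pos: "\<And>l. l \<in> diagrams n k \<Longrightarrow> 0 \<le> pr l"
  shows "measure M {\<omega> \<in> space M. P (L \<omega>)} = (\<Sum>l\<in>{l \<in> diagrams n k. P l}. pr l)"
    and "(\<Sum>l\<in>diagrams n k. pr l) = 1"
proof -
  interpret prob_space M using rd by (simp add: random_diagram_def)
  have L: "L \<in> measurable M (count_space (diagrams n k))"
    and d: "distr M (count_space (diagrams n k)) L = point_measure (diagrams n k) (\<lambda>l. ennreal (pr l))"
    using rd by (auto simp: random_diagram_def)
  have inD: "L \<omega> \<in> diagrams n k" if "\<omega> \<in> space M" for \<omega> using measurable_space[OF L that] by simp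
  have m: "measure M {\<omega> \<in> space M. P (L \<omega>)} = (\<Sum>l\<in>{l \<in> diagrams n k. P l}. pr l)" for P
  proof -
    let ?A = "{l \<in> diagrams n k. P l}"
    have "{\<omega> \<in> space M. P (L \<omega>)} = L -` ?A \<inter> space M" using inD by auto
    then have "measure M {\<omega> \<in> space M. P (L \<omega>)} = measure (distr M (count_space (diagrams n k)) L) ?A"
      using L by (subst measure_distr) auto
    also have "\<dots> = measure (point_measure (diagrams n k) (\<lambda>l. ennreal (pr l))) ?A" unfolding d ..
    also have "\<dots> = (\<Sum>l\<in>?A. pr l)"
    proof -
      have "emeasure (point_measure (diagrams n k) (\<lambda>l. ennreal (pr l))) ?A = (\<Sum>l\<in>?A. ennreal (pr l))"
        by (rule emeasure_point_measure_finite) (auto simp: finite_diagrams)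
      also have "\<dots> = ennreal (\<Sum>l\<in>?A. pr l)" using pos by (intro sum_ennreal) auto
      finally have "emeasure (point_measure (diagrams n k) (\<lambda>l. ennreal (pr l))) ?A = ennreal (\<Sum>l\<in>?A. pr l)" .
      moreover have "0 \<le> (\<Sum>l\<in>?A. pr l)" using pos by (intro sum_nonneg) auto
      ultimately show ?thesis unfolding measure_def by (simp only: enn2real_ennreal)
    qed
    finally show ?thesis .
  qed
  show "measure M {\<omega> \<in> space M. P (L \<omega>)} = (\<Sum>l\<in>{l \<in> diagrams n k. P l}. pr l)" by (rule m)
  show "(\<Sum>l\<in>diagrams n k. pr l) = 1" using m[of "\<lambda>_. True"] prob_space by simp
qed

lemma chebyshev_finite:
  fixes pr X :: "'a \<Rightarrow> real"
  assumes "finite A" and pos: "\<And>l. l \<in> A \<Longrightarrow> 0 \<le> pr l" and total: "(\<Sum>l\<in>A. pr l) = 1"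
    and var: "(\<Sum>l\<in>A. pr l * (X l)\<^sup>2) \<le> (\<Sum>l\<in>A. pr l * X l)\<^sup>2 + v" and "0 < \<epsilon>"
  shows "(\<Sum>l\<in>{l \<in> A. \<bar>X l - (\<Sum>l\<in>A. pr l * X l)\<bar> > \<epsilon>}. pr l) \<le> v / \<epsilon>\<^sup>2"
proof -
  define m where "m = (\<Sum>l\<in>A. pr l * X l)"
  have "(\<Sum>l\<in>{l \<in> A. \<bar>X l - m\<bar> > \<epsilon>}. pr l) * \<epsilon>\<^sup>2 \<le> (\<Sum>l\<in>{l \<in> A. \<bar>X l - m\<bar> > \<epsilon>}. pr l * (X l - m)\<^sup>2)"
    unfolding sum_distrib_right
  proof (rule sum_mono)
    fix l assume l: "l \<in> {l \<in> A. \<bar>X l - m\<bar> > \<epsilon>}"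
    then have "\<epsilon>\<^sup>2 \<le> \<bar>X l - m\<bar>\<^sup>2" using \<open>0 < \<epsilon>\<close> by (intro power_mono) auto
    then show "pr l * \<epsilon>\<^sup>2 \<le> pr l * (X l - m)\<^sup>2" using l pos by (intro mult_left_mono) auto
  qed
  also have "\<dots> \<le> (\<Sum>l\<in>A. pr l * (X l - m)\<^sup>2)"
    using \<open>finite A\<close> pos by (intro sum_mono2) auto
  also have "\<dots> = (\<Sum>l\<in>A. pr l * (X l)\<^sup>2) - 2 * m * (\<Sum>l\<in>A. pr l * X l) + m\<^sup>2 * (\<Sum>l\<in>A. pr l)"
    by (simp add: power2_eq_square algebra_simps sum.distrib sum_subtractf sum_distrib_left)
  also have "\<dots> \<le> v" using var unfolding total m_def[symmetric] by (simp add: power2_eq_square)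
  finally show ?thesis using \<open>0 < \<epsilon>\<close> by (simp add: m_def field_simps)
qed

lemma deriv_upper_boundary:
  assumes n: "0 < n" and j: "j < n + k" and x: "real j / real n < x" "x < (real j + 1) / real n"
  shows "deriv (upper_boundary n k l) x = boundary_slope n l j"
proof (rule DERIV_imp_deriv)
  let ?f = "\<lambda>y. upper_boundary n k l (real j / real n) + boundary_slope n l j * (y - real j / real n)"
  have "(?f has_real_derivative boundary_slope n l j) (at x)"
    by (auto intro!: derivative_eq_intros)
  moreover have "eventually (\<lambda>y. y \<in> {real j / real n<..<(real j + 1) / real n}) (nhds x)"
    using x by (intro eventually_nhds_in_open) auto
  then have "eventually (\<lambda>y. upper_boundary n k l y = ?f y) (nhds x)"
    by eventually_elim (rule upper_boundary_slope[OF n j], auto)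
  ultimately show "(upper_boundary n k l has_real_derivative boundary_slope n l j) (at x)"
    by (subst DERIV_cong_ev[OF refl _ refl]) auto
qed

lemma set_integrable_continuous:
  fixes f :: "real \<Rightarrow> real"
  assumes "continuous_on UNIV f"
  shows "set_integrable lborel {a..b} f"
  by (rule borel_integrable_atLeastAtMost') (rule continuous_on_subset[OF assms], simp)

text \<open>
  The extension \<open>g0\<close> of the test function by zero is integrated over whole cells of length \<open>1 / n\<close>, so
  that the end point \<open>b\<close>, which need not be a multiple of \<open>1 / n\<close>, never cuts a cell. Between the end
  points of the cells, a null set, both integrands agree.
\<close>

lemma LBINT_step_function:
  fixes g g0 H \<sigma> :: "_ \<Rightarrow> real"
  assumes n: "0 < n" and g0: "continuous_on UNIV g0"
    and inside: "\<And>x. x \<in> {0<..<b} \<Longrightarrow> g0 x = g x" and outside: "\<And>x. x \<notin> {0<..<b} \<Longrightarrow> g0 x = 0"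
    and far: "\<And>x. real N / real n \<le> x \<Longrightarrow> g0 x = 0"
    and H: "\<And>j x. j < N \<Longrightarrow> real j / real n < x \<Longrightarrow> x < (real j + 1) / real n \<Longrightarrow> H x = \<sigma> j"
  shows "(LBINT x:{0<..<b}. g x * H x) = (\<Sum>j<N. \<sigma> j * (LBINT x:{real j / real n..(real j + 1) / real n}. g0 x))"
proof -
  let ?I = "\<lambda>j. {real j / real n..(real j + 1) / real n}"
  let ?X = "(\<lambda>j. real j / real n) ` {..N}"
  have "(LBINT x:{0<..<b}. g x * H x) = (LINT x|lborel. (\<Sum>j<N. \<sigma> j * (indicator (?I j) x * g0 x)))"
    unfolding set_lebesgue_integral_def
  proof (rule integral_discrete_difference[of ?X])
    fix x :: real assume x: "x \<notin> ?X"
    show "indicator {0<..<b} x *\<^sub>R (g x * H x) = (\<Sum>j<N. \<sigma> j * (indicator (?I j) x * g0 x))"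
    proof (cases "g0 x = 0")
      case True
      then show ?thesis using inside[of x] by (auto simp: indicator_def)
    next
      case False
      then have xb: "x \<in> {0<..<b}" using outside by blast
      have xN: "x < real N / real n" using False far[of x] by (meson linorder_not_le)
      define i where "i = nat \<lfloor>x * real n\<rfloor>"
      have "0 \<le> x * real n" using xb by simp
      then have i: "real i \<le> x * real n" "x * real n < real i + 1"
        unfolding i_def using of_int_floor_le[of "x * real n"] floor_correct[of "x * real n"] by auto
      have "x * real n < real N" using xN n by (simp add: field_simps)
      then have iN: "i < N" using i by linarith
      have "x \<noteq> real i / real n" using x iN by auto
      then have ix: "real i / real n < x" "x < (real i + 1) / real n" using i n by (auto simp: field_simps)
      have "indicator (?I j) x = (if j = i then 1 else 0 :: real)" if "j < N" for j
      proof -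
        have "x \<in> ?I j \<longleftrightarrow> j = i"
        proof
          assume "x \<in> ?I j"
          then have "real j \<le> x * real n" "x * real n \<le> real j + 1" using n by (auto simp: field_simps)
          moreover have "x * real n \<noteq> real j + 1"
          proof
            assume "x * real n = real j + 1"
            then have "x = real (Suc j) / real n" using n by (simp add: field_simps)
            then show False using x that by (auto simp del: of_nat_Suc)
          qed
          ultimately show "j = i" using i by linarith
        qed (use ix in auto)
        then show ?thesis by (simp add: indicator_def)
      qed
      then have "(\<Sum>j<N. \<sigma> j * (indicator (?I j) x * g0 x)) = (\<Sum>j<N. if j = i then \<sigma> i * g0 x else 0)"
        by (intro sum.cong) auto
      also have "\<dots> = \<sigma> i * g0 x" using iN by simp
      finally show ?thesis using xb inside[OF xb] H[OF iN ix] by simp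
    qed
  qed auto
  also have "\<dots> = (\<Sum>j<N. LINT x|lborel. \<sigma> j * (indicator (?I j) x * g0 x))"
    by (rule Bochner_Integration.integral_sum)
      (use set_integrable_continuous[OF g0] in \<open>auto simp: set_integrable_def\<close>)
  also have "\<dots> = (\<Sum>j<N. \<sigma> j * (LBINT x:?I j. g0 x))"
    by (simp add: set_lebesgue_integral_def)
  finally show ?thesis .
qed

lemma LBINT_near_constant:
  fixes f :: "real \<Rightarrow> real"
  assumes f: "continuous_on UNIV f" and "a \<le> b" and near: "\<And>x. x \<in> {a..b} \<Longrightarrow> \<bar>f x - y\<bar> \<le> \<delta>"
  shows "\<bar>(LBINT x:{a..b}. f x) - y * (b - a)\<bar> \<le> \<delta> * (b - a)"
proof -
  have c: "continuous_on {a..b} f" by (rule continuous_on_subset[OF f]) simp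
  have "(LBINT x:{a..b}. f x) = integral {a..b} f"
    by (rule set_borel_integral_eq_integral(2)[OF set_integrable_continuous[OF f]])
  moreover have "integral {a..b} (\<lambda>x. f x - y) = integral {a..b} f - y * (b - a)"
    using c \<open>a \<le> b\<close> by (subst integral_diff) (auto intro: integrable_continuous_real)
  moreover have "norm (integral {a..b} (\<lambda>x. f x - y)) \<le> \<delta> * (b - a)"
    by (rule integral_bound) (use near c \<open>a \<le> b\<close> in \<open>auto intro!: continuous_intros\<close>)
  ultimately show ?thesis by simp
qed

lemma deriv_limit_shape:
  assumes meas: "\<rho> \<in> borel_measurable borel" and bd: "\<And>t. 0 \<le> \<rho> t" "\<And>t. \<rho> t \<le> 1"
    and cont: "continuous_on {0<..<b} \<rho>" and x: "x \<in> {0<..<b}"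
  shows "deriv (limit_shape \<rho>) x = 1 - 2 * \<rho> x"
proof (rule DERIV_imp_deriv)
  let ?f = "\<lambda>t. 1 - 2 * \<rho> t"
  have int: "set_integrable lborel {0..y} ?f" for y
    unfolding set_integrable_def
  proof (rule Bochner_Integration.integrable_bound)
    show "integrable lborel (\<lambda>t. indicator {0..y} t *\<^sub>R (1 :: real))"
      using set_integrable_continuous[of "\<lambda>_. 1" 0 y] by (simp add: set_integrable_def)
    show "(\<lambda>t. indicator {0..y} t *\<^sub>R ?f t) \<in> borel_measurable lborel" using meas by simp
    show "AE t in lborel. norm (indicator {0..y} t *\<^sub>R ?f t) \<le> norm (indicator {0..y} t *\<^sub>R (1 :: real))"
      using bd by (auto intro!: AE_I2 simp: indicator_def abs_le_iff)
  qed
  have eq: "(LBINT t:{0..y}. ?f t) = integral {0..y} ?f" and "?f integrable_on {0..y}" for y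
    using set_borel_integral_eq_integral[OF int[of y]] by auto
  have "isCont \<rho> x" using cont x by (simp add: continuous_on_eq_continuous_at)
  then have "continuous (at x within {0..b}) ?f"
    by (intro continuous_intros) (simp add: continuous_at_imp_continuous_at_within)
  then have "((\<lambda>y. integral {0..y} ?f) has_vector_derivative ?f x) (at x within {0..b})"
    using integral_has_vector_derivative_continuous_at[of ?f 0 b x "{}"] x \<open>\<And>y. ?f integrable_on {0..y}\<close> by auto
  moreover have "at x within {0..b} = at x" using x by (intro at_within_interior) (simp add: interior_atLeastAtMost_real)
  ultimately have "((\<lambda>y. integral {0..y} ?f) has_real_derivative ?f x) (at x)"
    by (simp add: has_real_derivative_iff_has_vector_derivative)
  then have "((\<lambda>y. 1 + integral {0..y} ?f) has_real_derivative 0 + ?f x) (at x)"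
    by (intro DERIV_add DERIV_const)
  then show "(limit_shape \<rho> has_real_derivative ?f x) (at x)"
    unfolding limit_shape_def[abs_def] eq by simp
qed

context limit_curve_sequence
begin

text \<open>
  The mean converges by \<open>moment_limit\<close> and \<open>rho_moment\<close>. The variance of the sum is at most \<open>n * B\<^sup>2\<close>,
  which Chebyshev's inequality turns into a probability of order \<open>1 / n\<close>. The polynomial \<open>P\<close> has no
  constant term, since the limits are identified with moments for positive exponents.
\<close>

lemma polynomial_statistic_limit:
  fixes a :: "nat \<Rightarrow> real" and d :: nat and pr :: "nat \<Rightarrow> nat list \<Rightarrow> real"
  defines "P \<equiv> \<lambda>y. \<Sum>i\<le>d. a i * y ^ Suc i"
  assumes pr: "eventually (\<lambda>n. (\<exists>C. \<forall>l\<in>diagrams n (k n). pr n l = vandermonde_weight C (q n) (\<eta> n) n (k n) l) \<and>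
      (\<forall>l\<in>diagrams n (k n). 0 \<le> pr n l) \<and> (\<Sum>l\<in>diagrams n (k n). pr n l) = 1) sequentially"
    and bdd: "eventually (\<lambda>n. \<forall>b<n + k n. \<bar>P (q n ^ b)\<bar> \<le> B) sequentially"
    and "0 < \<epsilon>"
  shows "(\<lambda>n. \<Sum>l\<in>{l \<in> diagrams n (k n).
      \<bar>(\<Sum>j<n. P (q n ^ row_positions n l j)) / real n - (LBINT t:{0<..<T}. P (u t) * rho t)\<bar> > \<epsilon>}. pr n l) \<longlonglongrightarrow> 0"
proof -
  define I where "I = (LBINT t:{0<..<T}. P (u t) * rho t)"
  define Lm where "Lm m = Re (- contour_moment m 1 / of_real (m * \<gamma>))" for m
  have I: "I = (\<Sum>i\<le>d. a i * Lm (Suc i))"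
  proof -
    have "has_bochner_integral lborel (\<lambda>t. \<Sum>i\<le>d. a i * (indicator {0<..<T} t * (u t ^ Suc i * rho t))) (\<Sum>i\<le>d. a i * Lm (Suc i))"
      unfolding Lm_def by (intro has_bochner_integral_sum has_bochner_integral_mult_right rho_moment) auto
    moreover have "(\<Sum>i\<le>d. a i * (indicator {0<..<T} t * (u t ^ Suc i * rho t))) = indicator {0<..<T} t *\<^sub>R (P (u t) * rho t)" for t
      unfolding P_def by (simp add: sum_distrib_left sum_distrib_right mult_ac)
    ultimately show ?thesis unfolding I_def set_lebesgue_integral_def by (simp add: has_bochner_integral_integral_eq)
  qed
  define E where "E n = (\<Sum>l\<in>diagrams n (k n). pr n l * (\<Sum>j<n. P (q n ^ row_positions n l j)))" for n
  define U where "U n l = (\<Sum>j<n. P (q n ^ row_positions n l j))" for n l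
  have Eeq: "eventually (\<lambda>n. E n / real n = (\<Sum>i\<le>d. a i * (moment (Suc i) n / real n))) sequentially"
    using pr q_eventually eta(2)
  proof eventually_elim
    case (elim n)
    then obtain C where C: "\<And>l. l \<in> diagrams n (k n) \<Longrightarrow> pr n l = vandermonde_weight C (q n) (\<eta> n) n (k n) l" by blast
    have params: "0 < q n" "q n \<noteq> 1" "0 < n" "0 < k n" "0 < \<eta> n"
      and total: "(\<Sum>l\<in>diagrams n (k n). pr n l) = 1" using elim by blast+
    have "E n = (\<Sum>i\<le>d. a i * (\<Sum>l\<in>diagrams n (k n). pr n l * (\<Sum>j<n. (q n ^ Suc i) ^ row_positions n l j)))"
    proof -
      have "pr n l * (\<Sum>j<n. P (q n ^ row_positions n l j)) = (\<Sum>i\<le>d. a i * (pr n l * (\<Sum>j<n. (q n ^ Suc i) ^ row_positions n l j)))" for l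
      proof -
        have "(\<Sum>j<n. P (q n ^ row_positions n l j)) = (\<Sum>i\<le>d. a i * (\<Sum>j<n. (q n ^ Suc i) ^ row_positions n l j))"
          unfolding P_def sum_distrib_left
          by (subst sum.swap) (simp only: power_mult[symmetric] mult.commute)
        then show ?thesis by (simp add: sum_distrib_left mult_ac)
      qed
      then show ?thesis unfolding E_def sum_distrib_left[of "a _"] by (subst sum.swap) simp
    qed
    also have "\<dots> = (\<Sum>i\<le>d. a i * moment (Suc i) n)"
    proof (intro sum.cong refl arg_cong2[where f = "(*)"])
      fix i
      show "(\<Sum>l\<in>diagrams n (k n). pr n l * (\<Sum>j<n. (q n ^ Suc i) ^ row_positions n l j)) = moment (Suc i) n"
        unfolding moment_def by (rule ensemble_moments(1)[OF params C total])
    qed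
    finally show ?case by (simp add: sum_divide_distrib)
  qed
  have "(\<lambda>n. \<Sum>i\<le>d. a i * (moment (Suc i) n / real n)) \<longlonglongrightarrow> (\<Sum>i\<le>d. a i * Lm (Suc i))"
    unfolding Lm_def by (intro tendsto_intros moment_limit) auto
  then have "(\<lambda>n. E n / real n) \<longlonglongrightarrow> I"
    unfolding I using Eeq by (simp add: tendsto_cong)
  then have near: "eventually (\<lambda>n. dist (E n / real n) I < \<epsilon> / 2) sequentially"
    using \<open>0 < \<epsilon>\<close> by (intro tendstoD) auto
  have ub: "eventually (\<lambda>n. (\<Sum>l\<in>{l \<in> diagrams n (k n). \<bar>U n l / real n - I\<bar> > \<epsilon>}. pr n l) \<le> (4 * B\<^sup>2 / \<epsilon>\<^sup>2) / real n) sequentially"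
    using pr bdd near q_eventually eta(2)
  proof eventually_elim
    case (elim n)
    then obtain C where C: "\<And>l. l \<in> diagrams n (k n) \<Longrightarrow> pr n l = vandermonde_weight C (q n) (\<eta> n) n (k n) l" by blast
    have params: "0 < q n" "q n \<noteq> 1" "0 < n" "0 < k n" "0 < \<eta> n"
      and total: "(\<Sum>l\<in>diagrams n (k n). pr n l) = 1" using elim by blast+
    have n: "0 < n" and pos: "\<And>l. l \<in> diagrams n (k n) \<Longrightarrow> 0 \<le> pr n l" using elim by blast+
    have Pb: "\<bar>P (q n ^ b)\<bar> \<le> B" if "b < n + k n" for b using elim that by blast
    have var: "(\<Sum>l\<in>diagrams n (k n). pr n l * (U n l)\<^sup>2) \<le> (\<Sum>l\<in>diagrams n (k n). pr n l * U n l)\<^sup>2 + real n * B\<^sup>2"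
      unfolding U_def
      by (rule ensemble_moments(2)[OF params C total, where h = "\<lambda>b. P (q n ^ b)"], assumption, rule Pb)
    have "(\<Sum>l\<in>{l \<in> diagrams n (k n). \<bar>U n l / real n - I\<bar> > \<epsilon>}. pr n l)
       \<le> (\<Sum>l\<in>{l \<in> diagrams n (k n). \<bar>U n l - (\<Sum>l\<in>diagrams n (k n). pr n l * U n l)\<bar> > \<epsilon> * real n / 2}. pr n l)"
    proof (rule sum_mono2)
      show "{l \<in> diagrams n (k n). \<bar>U n l / real n - I\<bar> > \<epsilon>}
         \<subseteq> {l \<in> diagrams n (k n). \<bar>U n l - (\<Sum>l\<in>diagrams n (k n). pr n l * U n l)\<bar> > \<epsilon> * real n / 2}"
      proof
        fix l assume l: "l \<in> {l \<in> diagrams n (k n). \<bar>U n l / real n - I\<bar> > \<epsilon>}"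
        have "\<bar>E n / real n - I\<bar> < \<epsilon> / 2" using elim by (simp add: dist_real_def)
        moreover have "\<bar>U n l / real n - I\<bar> > \<epsilon>" using l by simp
        ultimately have "\<bar>U n l / real n - E n / real n\<bar> > \<epsilon> / 2" by arith
        then have "\<bar>(U n l - E n) / real n\<bar> > \<epsilon> / 2" by (simp add: diff_divide_distrib)
        then have "\<bar>U n l - E n\<bar> > \<epsilon> * real n / 2" using n by (simp add: field_simps)
        then show "l \<in> {l \<in> diagrams n (k n). \<bar>U n l - (\<Sum>l\<in>diagrams n (k n). pr n l * U n l)\<bar> > \<epsilon> * real n / 2}"
          using l by (simp add: E_def U_def)
      qed
    qed (use pos finite_diagrams in auto)
    also have "\<dots> \<le> real n * B\<^sup>2 / (\<epsilon> * real n / 2)\<^sup>2"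
      by (rule chebyshev_finite[OF finite_diagrams pos total var]) (use n \<open>0 < \<epsilon>\<close> in auto)
    also have "\<dots> = (4 * B\<^sup>2 / \<epsilon>\<^sup>2) / real n" using n \<open>0 < \<epsilon>\<close> by (simp add: field_simps power2_eq_square)
    finally show ?case .
  qed
  have ge: "eventually (\<lambda>n. 0 \<le> (\<Sum>l\<in>{l \<in> diagrams n (k n). \<bar>U n l / real n - I\<bar> > \<epsilon>}. pr n l)) sequentially"
    using pr by eventually_elim (auto intro!: sum_nonneg)
  have "(\<lambda>n. \<Sum>l\<in>{l \<in> diagrams n (k n). \<bar>U n l / real n - I\<bar> > \<epsilon>}. pr n l) \<longlonglongrightarrow> 0"
    by (rule tendsto_sandwich[OF ge ub tendsto_const lim_const_over_n])
  then show ?thesis unfolding U_def I_def .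
qed

section \<open>Convergence to the limit shape\<close>

lemma size_ratio: "(\<lambda>n. real (n + k n) / real n) \<longlonglongrightarrow> T"
proof -
  have "(\<lambda>n. 1 + real (k n) / real n) \<longlonglongrightarrow> 1 + c" by (intro tendsto_intros kn)
  moreover have "eventually (\<lambda>n. 1 + real (k n) / real n = real (n + k n) / real n) sequentially"
    using eventually_gt_at_top[of 0] by eventually_elim (simp add: field_simps)
  ultimately show ?thesis unfolding Tc by (subst add.commute) (rule Lim_transform_eventually)
qed

lemma q_power_pred: "(\<lambda>n. q n ^ (k n - 1)) \<longlonglongrightarrow> exp (- \<gamma> * c)"
proof -
  have "(\<lambda>n. q n ^ k n / q n) \<longlonglongrightarrow> exp (- \<gamma> * c) / 1"
    by (intro tendsto_divide q_power_ratio kn q_limit) simp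
  moreover have "eventually (\<lambda>n. q n ^ k n / q n = q n ^ (k n - 1)) sequentially"
    using q_eventually
  proof eventually_elim
    case (elim n)
    then show ?case by (cases "k n") auto
  qed
  ultimately show ?thesis by (auto intro: Lim_transform_eventually)
qed

lemma nodes_bounded:
  "eventually (\<lambda>n. \<forall>b\<le>n + k n. min 1 e / 2 \<le> q n ^ b \<and> q n ^ b \<le> 2 * max 1 e) sequentially"
proof -
  have lim: "(\<lambda>n. q n ^ (n + k n)) \<longlonglongrightarrow> e"
    using q_power_ratio[OF size_ratio] by (simp add: e_def)
  have "min 1 e / 2 < e" "e < 2 * max 1 e" using e_pos by (auto simp: min_def max_def)
  note order_tendstoD(1)[OF lim this(1)] order_tendstoD(2)[OF lim this(2)]
  then show ?thesis using q_eventually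
  proof eventually_elim
    case (elim n)
    have one: "min 1 e / 2 \<le> 1" "1 \<le> 2 * max 1 e" using e_pos by (auto simp: min_def max_def)
    show ?case
    proof (intro allI impI)
      fix b assume b: "b \<le> n + k n"
      show "min 1 e / 2 \<le> q n ^ b \<and> q n ^ b \<le> 2 * max 1 e"
      proof (cases "q n \<le> 1")
        case True
        then have "q n ^ (n + k n) \<le> q n ^ b" "q n ^ b \<le> 1"
          using elim b by (auto intro: power_decreasing power_le_one)
        then show ?thesis using elim one by linarith
      next
        case False
        then have "q n ^ b \<le> q n ^ (n + k n)" "1 \<le> q n ^ b"
          using elim b by (auto intro: power_increasing one_le_power)
        then show ?thesis using elim one by linarith
      qed
    qed
  qed
qed

text \<open>
  The number \<open>- ln (q n ^ a) / \<gamma>\<close> is the coordinate \<open>t\<close> with \<open>u t = q n ^ a\<close>. It is \<open>a / n\<close> times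
  \<open>- ln (q n ^ n) / \<gamma>\<close>, a factor that tends to \<open>1\<close>, while \<open>a / n\<close> stays bounded.
\<close>

lemma node_positions_uniform:
  fixes g :: "real \<Rightarrow> real"
  assumes g: "continuous_on UNIV g" and \<delta>: "0 < \<delta>"
  shows "eventually (\<lambda>n. \<forall>a<n + k n. \<forall>x\<in>{real a / real n..(real a + 1) / real n}.
    \<bar>g x - g (- ln (q n ^ a) / \<gamma>)\<bar> \<le> \<delta>) sequentially"
proof -
  have "uniformly_continuous_on {- 1..T + 2} g"
    by (intro compact_uniformly_continuous continuous_on_subset[OF g]) auto
  then obtain d where d: "0 < d" "\<And>x y. x \<in> {- 1..T + 2} \<Longrightarrow> y \<in> {- 1..T + 2} \<Longrightarrow> dist y x < d \<Longrightarrow> dist (g y) (g x) < \<delta>"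
    unfolding uniformly_continuous_on_def using \<delta> by metis
  define d' where "d' = min d 1 / 2"
  have d': "0 < d'" "2 * d' \<le> d" "d' \<le> 1 / 2" using d(1) by (auto simp: d'_def)
  have r: "(\<lambda>n. - ln (q n ^ n) / \<gamma>) \<longlonglongrightarrow> - ln (exp (- \<gamma>)) / \<gamma>"
    by (intro tendsto_divide tendsto_minus tendsto_ln q_power_n tendsto_const) (use gamma in auto)
  have "0 < d' / (T + 1)" using d' T by simp
  from tendstoD[OF r this] have "eventually (\<lambda>n. \<bar>- ln (q n ^ n) / \<gamma> - 1\<bar> < d' / (T + 1)) sequentially"
    using gamma by (simp add: dist_real_def)
  moreover have "eventually (\<lambda>n. 1 / real n < d') sequentially"
    by (rule order_tendstoD(2)[OF lim_1_over_n d'(1)])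
  moreover have "eventually (\<lambda>n. real (n + k n) / real n < T + 1) sequentially"
    using size_ratio by (rule order_tendstoD) simp
  ultimately show ?thesis using q_eventually
  proof eventually_elim
    case (elim n)
    show ?case
    proof (intro allI impI ballI)
      fix a x assume a: "a < n + k n" and x: "x \<in> {real a / real n..(real a + 1) / real n}"
      have n: "0 < real n" using elim by simp
      define r where "r = - ln (q n ^ n) / \<gamma>"
      define y where "y = - ln (q n ^ a) / \<gamma>"
      have y: "y = real a / real n * r" using elim n by (simp add: y_def r_def ln_realpow)
      have "(real a + 1) / real n \<le> real (n + k n) / real n" using a n by (intro divide_right_mono) auto
      then have aT: "(real a + 1) / real n < T + 1" using elim by linarith
      have step: "(real a + 1) / real n = real a / real n + 1 / real n" by (simp add: add_divide_distrib)
      have a0: "0 \<le> real a / real n" using n by simp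
      have "\<bar>y - real a / real n\<bar> = real a / real n * \<bar>r - 1\<bar>"
      proof -
        have "y - real a / real n = real a / real n * (r - 1)" by (simp add: y right_diff_distrib)
        then show ?thesis using a0 by (simp only: abs_mult abs_of_nonneg)
      qed
      also have "\<dots> \<le> (T + 1) * (d' / (T + 1))"
      proof (rule mult_mono)
        have "0 < 1 / real n" using n by simp
        then show "real a / real n \<le> T + 1" using aT step by linarith
        show "\<bar>r - 1\<bar> \<le> d' / (T + 1)" using elim by (simp add: r_def)
      qed (use T in auto)
      also have "\<dots> = d'" using T by simp
      finally have yd: "\<bar>y - real a / real n\<bar> \<le> d'" .
      have xd: "real a / real n \<le> x" "x \<le> real a / real n + 1 / real n" using x step by auto
      then have "\<bar>x - y\<bar> < 2 * d'" using yd elim by linarith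
      then have "dist x y < d" using d' by (simp add: dist_real_def)
      moreover have "x \<in> {- 1..T + 2}" "y \<in> {- 1..T + 2}"
        using xd yd aT step a0 elim d'(3) unfolding atLeastAtMost_iff by linarith+
      ultimately have "dist (g x) (g y) < \<delta>" by (intro d(2))
      then show "\<bar>g x - g (- ln (q n ^ a) / \<gamma>)\<bar> \<le> \<delta>" by (simp add: y_def dist_real_def)
    qed
  qed
qed

text \<open>
  The slope of the boundary is \<open>1\<close>, except for \<open>-1\<close> on the cells at the positions of the diagram. Hence
  the integral of \<open>g\<close> against it is \<open>\<integral>g\<close> minus twice the sum of the integrals of \<open>g\<close> over these cells.
  Such a cell integral is close to \<open>g t / n\<close> with \<open>u t = q n ^ a\<close>. By Weierstrass \<open>g t\<close> is close to a
  polynomial \<open>P\<close> in \<open>u t\<close>, so the sum is close to the statistic of \<open>polynomial_statistic_limit\<close>.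
\<close>

theorem limit_shape_convergence:
  fixes M :: "nat \<Rightarrow> 'w measure" and L :: "nat \<Rightarrow> 'w \<Rightarrow> nat list" and pr :: "nat \<Rightarrow> nat list \<Rightarrow> real"
  assumes rd: "eventually (\<lambda>n. random_diagram (M n) (L n) n (k n) (pr n)) sequentially"
    and dens: "eventually (\<lambda>n. \<exists>C>0. \<forall>l\<in>diagrams n (k n). pr n l = vandermonde_weight C (q n) (\<eta> n) n (k n) l) sequentially"
    and meas: "\<rho> \<in> borel_measurable borel" and bd: "\<And>t. 0 \<le> \<rho> t" "\<And>t. \<rho> t \<le> 1"
    and \<rho>: "\<And>t. 0 < t \<Longrightarrow> t < T \<Longrightarrow> \<rho> t = rho t"
  shows "has_limit_shape T M (\<lambda>n \<omega>. upper_boundary n (k n) (L n \<omega>)) (limit_shape \<rho>)"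
  unfolding has_limit_shape_def tendsto_in_prob_def
proof (intro allI impI)
  fix g :: "real \<Rightarrow> real" and \<epsilon> :: real
  assume g: "continuous_on {0<..<T} g" and \<epsilon>: "0 < \<epsilon>"
    and "\<exists>K. compact K \<and> K \<subseteq> {0<..<T} \<and> (\<forall>x\<in>{0<..<T} - K. g x = 0)"
  then obtain K where K: "compact K" "K \<subseteq> {0<..<T}" "\<And>x. x \<in> {0<..<T} - K \<Longrightarrow> g x = 0" by blast
  define g0 where "g0 x = (if x \<in> {0<..<T} then g x else 0)" for x
  have g0K: "g0 x = 0" if "x \<notin> K" for x using K(3) that by (auto simp: g0_def)
  have cg0: "continuous_on UNIV g0"
  proof -
    have "continuous_on {0<..<T} g0" using g by (rule continuous_on_eq) (simp add: g0_def)
    moreover have "continuous_on (- K) g0" by (rule continuous_on_eq[OF continuous_on_const]) (simp add: g0K)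
    ultimately have "continuous_on ({0<..<T} \<union> - K) g0"
      using K(1) by (intro continuous_on_open_Un) (auto simp: compact_imp_closed open_Compl)
    moreover have "{0<..<T} \<union> - K = UNIV" using K(2) by auto
    ultimately show ?thesis by simp
  qed
  obtain x2 where x2: "x2 < T" "\<And>x. x \<in> K \<Longrightarrow> x \<le> x2"
  proof (cases "K = {}")
    case True
    then show ?thesis using that[of 0] T by auto
  next
    case False
    from compact_attains_sup[OF K(1) this] obtain s where "s \<in> K" "\<forall>t\<in>K. t \<le> s" by blast
    then show ?thesis using that[of s] K(2) by auto
  qed
  \<comment> \<open>The approximation of \<open>g\<close> costs \<open>\<delta>\<close> in each of two steps for the sum over positions, and \<open>\<delta> * T\<close> for
     the limit integral; all errors count twice.\<close>
  define \<delta> where "\<delta> = \<epsilon> / (4 * (2 + T))"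
  have \<delta>: "0 < \<delta>" "2 * (2 * \<delta> + \<delta> * T) \<le> \<epsilon> / 2"
  proof -
    show "0 < \<delta>" using \<epsilon> T by (simp add: \<delta>_def)
    have "2 * (2 * \<delta> + \<delta> * T) = 2 * (\<delta> * (2 + T))" by (simp add: algebra_simps)
    also have "\<delta> * (2 + T) = \<epsilon> / 4" using T by (simp add: \<delta>_def divide_simps)
    finally show "2 * (2 * \<delta> + \<delta> * T) \<le> \<epsilon> / 2" by simp
  qed
  define lo where "lo = min 1 e / 2"
  define hi where "hi = 2 * max 1 e"
  have lohi: "0 < lo" "0 < hi" using e_pos by (auto simp: lo_def hi_def min_def max_def)
  \<comment> \<open>Dividing by \<open>y\<close> before approximating yields a polynomial \<open>P\<close> without constant term.\<close>
  have "continuous_on {lo..hi} (\<lambda>y. g0 (- ln y / \<gamma>) / y)"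
    using lohi gamma by (intro continuous_intros continuous_on_compose2[OF cg0]) auto
  from Stone_Weierstrass_real_polynomial_function[OF compact_Icc this, of "\<delta> / hi"]
  obtain w where w: "real_polynomial_function w" "\<And>y. y \<in> {lo..hi} \<Longrightarrow> \<bar>g0 (- ln y / \<gamma>) / y - w y\<bar> < \<delta> / hi"
    using divide_pos_pos[OF \<delta>(1) lohi(2)] by blast
  obtain a d where ad: "w = (\<lambda>y. \<Sum>i\<le>d. a i * y ^ i)" using w(1) unfolding real_polynomial_function_iff_sum by blast
  define P where "P y = (\<Sum>i\<le>d. a i * y ^ Suc i)" for y
  have Pw: "P y = y * w y" for y by (simp add: P_def ad sum_distrib_left mult_ac)
  have approx: "\<bar>g0 (- ln y / \<gamma>) - P y\<bar> \<le> \<delta>" if "y \<in> {lo..hi}" for y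
  proof -
    have y: "0 < y" "y \<le> hi" using that lohi by auto
    have "\<bar>g0 (- ln y / \<gamma>) - P y\<bar> = y * \<bar>g0 (- ln y / \<gamma>) / y - w y\<bar>"
    proof -
      have "g0 (- ln y / \<gamma>) - P y = y * (g0 (- ln y / \<gamma>) / y - w y)" using y by (simp add: Pw right_diff_distrib)
      then show ?thesis using y by (simp add: abs_mult)
    qed
    also have "\<dots> \<le> hi * (\<delta> / hi)" using w(2)[OF that] y by (intro mult_mono) auto
    also have "\<dots> = \<delta>" using lohi by simp
    finally show ?thesis .
  qed
  have "continuous_on {lo..hi} P" unfolding P_def by (intro continuous_intros)
  from compact_imp_bounded[OF compact_continuous_image[OF this compact_Icc]]
  obtain B where B: "\<And>y. y \<in> {lo..hi} \<Longrightarrow> \<bar>P y\<bar> \<le> B" unfolding bounded_iff by (metis imageI real_norm_def)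
  have nodes: "eventually (\<lambda>n. \<forall>b\<le>n + k n. q n ^ b \<in> {lo..hi}) sequentially"
    using nodes_bounded by (simp add: lo_def hi_def)
  define I where "I = (LBINT t:{0<..<T}. P (u t) * rho t)"
  define R where "R = (LBINT x:{0<..<T}. g x * rho x)"
  define Gi where "Gi = (LBINT x:{0<..<T}. g x)"
  define \<Lambda> where "\<Lambda> = (LBINT x:{0<..<T}. g x * deriv (limit_shape \<rho>) x)"
  have ind: "indicator {0<..<T} x *\<^sub>R (g x * y) = g0 x * y" for x y by (simp add: g0_def indicator_def)
  have int0: "integrable lborel g0"
  proof -
    have "g0 = (\<lambda>x. indicator {0..T} x *\<^sub>R g0 x)" by (auto simp: fun_eq_iff g0_def indicator_def)
    then show ?thesis using set_integrable_continuous[OF cg0, of 0 T] unfolding set_integrable_def by simp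
  qed
  have mrho: "(\<lambda>t. indicator {0<..<T} t *\<^sub>R rho t) \<in> borel_measurable borel"
    by (rule borel_measurable_continuous_on_indicator[OF _ continuous_on_rho]) simp
  have rho01: "0 \<le> rho t" "rho t \<le> 1" for t unfolding rho_def by (rule arccos_density_bounds)+
  have intr: "integrable lborel (\<lambda>x. g0 x * rho x)"
  proof (rule Bochner_Integration.integrable_bound[OF int0])
    have "(\<lambda>x. g0 x * rho x) = (\<lambda>x. g0 x * (indicator {0<..<T} x *\<^sub>R rho x))" by (auto simp: fun_eq_iff g0_def indicator_def)
    also have "\<dots> \<in> borel_measurable lborel"
      using mrho borel_measurable_integrable[OF int0] by (intro borel_measurable_times) auto
    finally show "(\<lambda>x. g0 x * rho x) \<in> borel_measurable lborel" .
    show "AE x in lborel. norm (g0 x * rho x) \<le> norm (g0 x)"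
      using rho01 by (auto intro!: AE_I2 mult_left_le simp: abs_mult)
  qed
  have \<Lambda>: "\<Lambda> = Gi - 2 * R"
  proof -
    have cr: "continuous_on {0<..<T} \<rho>" by (rule continuous_on_eq[OF continuous_on_rho]) (simp add: \<rho>)
    have "\<Lambda> = (LBINT x:{0<..<T}. g x * (1 - 2 * rho x))"
      unfolding \<Lambda>_def using deriv_limit_shape[OF meas bd cr] \<rho> by (intro set_lebesgue_integral_cong) auto
    also have "\<dots> = (LINT x|lborel. g0 x - 2 * (g0 x * rho x))"
      unfolding set_lebesgue_integral_def ind by (simp add: algebra_simps)
    also have "\<dots> = (LINT x|lborel. g0 x) - 2 * (LINT x|lborel. g0 x * rho x)"
      using int0 intr by (simp add: Bochner_Integration.integral_diff)
    also have "(LINT x|lborel. g0 x * rho x) = R" unfolding R_def set_lebesgue_integral_def ind ..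
    also have "(LINT x|lborel. g0 x) = Gi" unfolding Gi_def set_lebesgue_integral_def using ind[of _ 1] by simp
    finally show ?thesis .
  qed
  have RI: "\<bar>R - I\<bar> \<le> \<delta> * T"
  proof -
    have "integrable lborel (\<lambda>t. indicator {0<..<T} t *\<^sub>R (P (u t) * rho t))"
    proof -
      have integrable_rho: "integrable lborel (\<lambda>t. indicator {0<..<T} t * (u t ^ Suc i * rho t))" for i
        using rho_moment[of "Suc i"] unfolding has_bochner_integral_iff by blast
      have "integrable lborel (\<lambda>t. \<Sum>i\<le>d. a i * (indicator {0<..<T} t * (u t ^ Suc i * rho t)))"
        by (intro Bochner_Integration.integrable_sum integrable_mult_right integrable_rho)
      then show ?thesis unfolding P_def by (simp add: sum_distrib_left sum_distrib_right mult_ac)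
    qed
    then have diff: "R - I = (LINT x|lborel. g0 x * rho x - indicator {0<..<T} x *\<^sub>R (P (u x) * rho x))"
      unfolding R_def I_def set_lebesgue_integral_def ind using intr by (simp add: Bochner_Integration.integral_diff)
    have "\<bar>R - I\<bar> \<le> (LINT x|lborel. \<bar>g0 x * rho x - indicator {0<..<T} x *\<^sub>R (P (u x) * rho x)\<bar>)"
      unfolding diff
      using integral_norm_bound[of lborel "\<lambda>x. g0 x * rho x - indicator {0<..<T} x *\<^sub>R (P (u x) * rho x)"]
      unfolding real_norm_def .
    also have "\<dots> \<le> (LINT x|lborel. indicator {0<..<T} x *\<^sub>R \<delta>)"
    proof (rule integral_mono_AE')
      show "integrable lborel (\<lambda>x. indicator {0<..<T} x *\<^sub>R \<delta>)"
        by (rule integrable_scaleR_left, rule integrable_real_indicator) (use T in simp_all)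
      show "AE x in lborel. \<bar>g0 x * rho x - indicator {0<..<T} x *\<^sub>R (P (u x) * rho x)\<bar> \<le> indicator {0<..<T} x *\<^sub>R \<delta>"
      proof (rule AE_I2)
        fix x
        show "\<bar>g0 x * rho x - indicator {0<..<T} x *\<^sub>R (P (u x) * rho x)\<bar> \<le> indicator {0<..<T} x *\<^sub>R \<delta>"
        proof (cases "x \<in> {0<..<T}")
          case True
          have "u x \<in> {lo..hi}"
          proof -
            have x: "0 < x" "x < T" using True by simp_all
            have "min 1 e \<le> u x \<and> u x \<le> max 1 e"
            proof (cases "0 < \<gamma>")
              case True
              then have "e \<le> u x" "u x \<le> 1" using x by (simp_all add: u_def e_def)
              then show ?thesis by linarith
            next
              case False
              then have "\<gamma> < 0" using gamma by simp
              then have "1 \<le> u x" "u x \<le> e" using x by (simp_all add: u_def e_def mult_nonpos_nonneg)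
              then show ?thesis by linarith
            qed
            then show ?thesis using e_pos unfolding lo_def hi_def atLeastAtMost_iff by linarith
          qed
          moreover have "- ln (u x) / \<gamma> = x" using gamma by (simp add: u_def)
          ultimately have "\<bar>g0 x - P (u x)\<bar> \<le> \<delta>" using approx[of "u x"] by simp
          then have "\<bar>g0 x - P (u x)\<bar> * rho x \<le> \<delta> * 1" using rho01[of x] by (intro mult_mono) auto
          moreover have "g0 x * rho x - P (u x) * rho x = (g0 x - P (u x)) * rho x" by (simp add: left_diff_distrib)
          ultimately show ?thesis using True rho01[of x] by (simp add: abs_mult)
        qed (auto simp: g0_def)
      qed
    qed (use \<delta> in auto)
    also have "\<dots> = \<delta> * T" using T by (simp add: mult.commute)
    finally show ?thesis .
  qed
  define X where "X n l = (LBINT x:{0<..<T}. g x * deriv (upper_boundary n (k n) l) x)" for n l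
  define Y where "Y n l = (\<Sum>j<n. P (q n ^ row_positions n l j)) / real n" for n l
  have close: "eventually (\<lambda>n. \<forall>l\<in>diagrams n (k n). \<bar>X n l - \<Lambda>\<bar> > \<epsilon> \<longrightarrow> \<bar>Y n l - I\<bar> > \<epsilon> / 4) sequentially"
    using nodes node_positions_uniform[OF cg0 \<delta>(1)] order_tendstoD(1)[OF size_ratio x2(1)] eventually_gt_at_top[of 0]
  proof eventually_elim
    case (elim n)
    define N where "N = n + k n"
    define J where "J j = (LBINT x:{real j / real n..(real j + 1) / real n}. g0 x)" for j
    have n: "0 < n" using elim by simp
    have far: "g0 x = 0" if "real N / real n \<le> x" for x
      using g0K[of x] x2(2)[of x] that elim by (force simp: N_def)
    have Gi: "Gi = (\<Sum>j<N. J j)"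
    proof -
      have "Gi = (LBINT x:{0<..<T}. g x * 1)" by (simp add: Gi_def)
      also have "\<dots> = (\<Sum>j<N. 1 * J j)"
        unfolding J_def by (rule LBINT_step_function[OF n cg0 _ _ far]) (auto simp: g0_def)
      finally show ?thesis by simp
    qed
    show ?case
    proof (intro ballI impI)
      fix l assume l: "l \<in> diagrams n (k n)" and big: "\<bar>X n l - \<Lambda>\<bar> > \<epsilon>"
      let ?A = "row_positions n l ` {..<n}"
      have inN: "row_positions n l j < N" if "j < n" for j using row_positions_tuple[OF l] that by (auto simp: N_def)
      have slope: "boundary_slope n l j = 1 - 2 * indicator ?A j" for j
      proof -
        have "(\<exists>i<n. j = l ! i + (n - Suc i)) \<longleftrightarrow> j \<in> ?A" by (auto simp: row_positions_def)
        then show ?thesis by (simp add: boundary_slope_def)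
      qed
      have "X n l = (\<Sum>j<N. boundary_slope n l j * J j)"
        unfolding X_def J_def
        by (rule LBINT_step_function[OF n cg0 _ _ far]) (auto simp: g0_def N_def intro!: deriv_upper_boundary[OF n])
      also have "\<dots> = Gi - 2 * (\<Sum>j<N. indicator ?A j * J j)"
        unfolding slope Gi by (simp only: left_diff_distrib sum_subtractf sum_distrib_left mult.assoc mult_1)
      also have "(\<Sum>j<N. indicator ?A j * J j) = (\<Sum>j\<in>?A. J j)"
        using inN by (intro sum.mono_neutral_cong_right) (auto simp: indicator_def)
      also have "\<dots> = (\<Sum>j<n. J (row_positions n l j))" by (simp add: sum.reindex[OF row_positions_inj[OF l]])
      finally have Xl: "X n l = Gi - 2 * (\<Sum>j<n. J (row_positions n l j))" .
      have JY: "\<bar>(\<Sum>j<n. J (row_positions n l j)) - Y n l\<bar> \<le> 2 * \<delta>"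
      proof -
        have cell: "\<bar>J b - P (q n ^ b) / real n\<bar> \<le> 2 * \<delta> / real n" if b: "b < N" for b
        proof -
          have len: "(real b + 1) / real n - real b / real n = 1 / real n" by (simp add: add_divide_distrib)
          have le: "real b / real n \<le> (real b + 1) / real n" by (intro divide_right_mono) auto
          have "\<bar>J b - g0 (- ln (q n ^ b) / \<gamma>) * ((real b + 1) / real n - real b / real n)\<bar> \<le> \<delta> * ((real b + 1) / real n - real b / real n)"
            unfolding J_def by (rule LBINT_near_constant[OF cg0 le]) (use elim b in \<open>auto simp: N_def\<close>)
          then have 1: "\<bar>J b - g0 (- ln (q n ^ b) / \<gamma>) / real n\<bar> \<le> \<delta> / real n" unfolding len by simp
          have "q n ^ b \<in> {lo..hi}" using elim b by (auto simp: N_def)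
          then have "\<bar>g0 (- ln (q n ^ b) / \<gamma>) - P (q n ^ b)\<bar> / real n \<le> \<delta> / real n"
            by (intro divide_right_mono approx) auto
          then have 2: "\<bar>g0 (- ln (q n ^ b) / \<gamma>) / real n - P (q n ^ b) / real n\<bar> \<le> \<delta> / real n"
            by (simp add: abs_divide flip: diff_divide_distrib)
          have "2 * \<delta> / real n = \<delta> / real n + \<delta> / real n" by simp
          then show ?thesis using 1 2 by linarith
        qed
        have "(\<Sum>j<n. J (row_positions n l j)) - Y n l = (\<Sum>j<n. J (row_positions n l j) - P (q n ^ row_positions n l j) / real n)"
          by (simp add: Y_def sum_subtractf sum_divide_distrib)
        also have "\<bar>\<dots>\<bar> \<le> (\<Sum>j<n. 2 * \<delta> / real n)"
          by (rule order_trans[OF sum_abs sum_mono]) (use cell inN in auto)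
        also have "\<dots> = 2 * \<delta>" using n by simp
        finally show ?thesis .
      qed
      have "X n l - \<Lambda> = - 2 * ((\<Sum>j<n. J (row_positions n l j)) - R)" unfolding Xl \<Lambda> by simp
      then have "\<bar>X n l - \<Lambda>\<bar> = 2 * \<bar>(\<Sum>j<n. J (row_positions n l j)) - R\<bar>" by (simp only: abs_mult abs_neg_numeral)
      moreover have "\<bar>(\<Sum>j<n. J (row_positions n l j)) - R\<bar> \<le> 2 * \<delta> + \<bar>Y n l - I\<bar> + \<delta> * T"
        using JY RI by linarith
      moreover have "y > \<epsilon> / 4"
        if "x = 2 * s" "s \<le> 2 * \<delta> + y + t" "x > \<epsilon>" "2 * (2 * \<delta> + t) \<le> \<epsilon> / 2" for x y s t :: real
        using that unfolding distrib_left by linarith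
      ultimately show "\<bar>Y n l - I\<bar> > \<epsilon> / 4" using big \<delta>(2) by blast
    qed
  qed
  have good: "eventually (\<lambda>n. (\<exists>C. \<forall>l\<in>diagrams n (k n). pr n l = vandermonde_weight C (q n) (\<eta> n) n (k n) l) \<and>
      (\<forall>l\<in>diagrams n (k n). 0 \<le> pr n l) \<and> (\<Sum>l\<in>diagrams n (k n). pr n l) = 1) sequentially"
    using rd dens q_eventually eta(2)
  proof eventually_elim
    case (elim n)
    then obtain C where C: "0 < C" "\<And>l. l \<in> diagrams n (k n) \<Longrightarrow> pr n l = vandermonde_weight C (q n) (\<eta> n) n (k n) l" by blast
    have pos: "0 \<le> pr n l" if "l \<in> diagrams n (k n)" for l
    proof -
      have "0 < node_dist (q n) (n + k n) b" for b using elim by (intro node_dist_pos) auto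
      then show ?thesis
        unfolding C(2)[OF that] using C(1) elim by (intro mult_nonneg_nonneg prod_nonneg) (simp_all add: less_imp_le)
    qed
    then show ?case using C(2) random_diagram_measure(2)[of "M n" "L n" n "k n" "pr n"] elim by blast
  qed
  have bound: "eventually (\<lambda>n. measure (M n) {\<omega> \<in> space (M n). \<bar>X n (L n \<omega>) - \<Lambda>\<bar> > \<epsilon>}
      \<le> (\<Sum>l\<in>{l \<in> diagrams n (k n). \<bar>Y n l - I\<bar> > \<epsilon> / 4}. pr n l)) sequentially"
    using close good rd
  proof eventually_elim
    case (elim n)
    then have pos: "\<And>l. l \<in> diagrams n (k n) \<Longrightarrow> 0 \<le> pr n l" by blast
    have "measure (M n) {\<omega> \<in> space (M n). \<bar>X n (L n \<omega>) - \<Lambda>\<bar> > \<epsilon>} = (\<Sum>l\<in>{l \<in> diagrams n (k n). \<bar>X n l - \<Lambda>\<bar> > \<epsilon>}. pr n l)"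
      using elim by (intro random_diagram_measure(1) pos) auto
    also have "\<dots> \<le> (\<Sum>l\<in>{l \<in> diagrams n (k n). \<bar>Y n l - I\<bar> > \<epsilon> / 4}. pr n l)"
      using elim pos finite_diagrams by (intro sum_mono2) auto
    finally show ?case .
  qed
  have lim: "(\<lambda>n. \<Sum>l\<in>{l \<in> diagrams n (k n). \<bar>Y n l - I\<bar> > \<epsilon> / 4}. pr n l) \<longlonglongrightarrow> 0"
    unfolding Y_def I_def P_def
  proof (rule polynomial_statistic_limit[OF good])
    show "eventually (\<lambda>n. \<forall>b<n + k n. \<bar>\<Sum>i\<le>d. a i * (q n ^ b) ^ Suc i\<bar> \<le> B) sequentially"
      using nodes by eventually_elim (use B in \<open>auto simp: P_def\<close>)
    show "0 < \<epsilon> / 4" using \<epsilon> by simp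
  qed
  have "eventually (\<lambda>n. 0 \<le> measure (M n) {\<omega> \<in> space (M n). \<bar>X n (L n \<omega>) - \<Lambda>\<bar> > \<epsilon>}) sequentially"
    by simp
  from tendsto_sandwich[OF this bound tendsto_const lim]
  show "(\<lambda>n. measure (M n) {\<omega> \<in> space (M n). \<bar>(LBINT x:{0<..<T}. g x * deriv (upper_boundary n (k n) (L n \<omega>)) x) -
      (LBINT x:{0<..<T}. g x * deriv (limit_shape \<rho>) x)\<bar> > \<epsilon>}) \<longlonglongrightarrow> 0"
    unfolding X_def \<Lambda>_def .
qed

end

theorem corollary1:
  fixes c \<gamma> :: real and k :: "nat \<Rightarrow> nat"
    and M :: "nat \<Rightarrow> 'w measure" and L :: "nat \<Rightarrow> 'w \<Rightarrow> nat list"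
  assumes "c > 0" and "\<gamma> \<noteq> 0"
    and "filterlim k at_top sequentially"
    and "(\<lambda>n. real (k n) / real n) \<longlonglongrightarrow> c"
  shows "((\<forall>\<^sub>F n in sequentially.
             random_diagram (M n) (L n) n (k n) (mu_A n (k n) (1 - \<gamma> / real n))) \<longrightarrow>
          has_limit_shape (c + 1) M (\<lambda>n \<omega>. upper_boundary n (k n) (L n \<omega>))
            (limit_shape (rho_A c \<gamma>))) \<and>
         ((\<forall>\<^sub>F n in sequentially.
             random_diagram (M n) (L n) n (k n) (mu_B n (k n) (1 - \<gamma> / real n))) \<longrightarrow>
          has_limit_shape (c + 1) M (\<lambda>n \<omega>. upper_boundary n (k n) (L n \<omega>))
            (limit_shape (rho_B c \<gamma>)))"
proof -
  have mA: "rho_A c \<gamma> \<in> borel_measurable borel"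
    unfolding rho_A_def by (rule borel_measurable_continuous_on[OF arccos_density_cont]) measurable
  have mB: "rho_B c \<gamma> \<in> borel_measurable borel"
    unfolding rho_B_def by (rule borel_measurable_continuous_on[OF arccos_density_cont]) measurable
  \<comment> \<open>In case (A) \<open>\<eta> n = 1\<close>, so \<open>\<theta> = 1 / e\<close>; in case (B) \<open>\<eta> n = q ^ (k - 1)\<close> tends to \<open>exp (- \<gamma> * c)\<close>, which
     is \<open>exp \<gamma> * e\<close>.\<close>
  define \<theta> where "\<theta> = exp (\<gamma> * (c + 1))"
  interpret A: limit_curve \<gamma> "c + 1" \<theta> by unfold_locales (use assms in \<open>auto simp: \<theta>_def\<close>)
  have \<theta>e: "\<theta> * A.e = 1" unfolding \<theta>_def A.e_def by (simp flip: exp_add)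
  interpret A: limit_curve_sequence \<gamma> "c + 1" \<theta> c k "\<lambda>_. 1"
    by unfold_locales (use assms \<theta>e in auto)
  interpret B: limit_curve \<gamma> "c + 1" "exp \<gamma>" by unfold_locales (use assms in auto)
  have Be: "exp \<gamma> * B.e = exp (- \<gamma> * c)" unfolding B.e_def by (simp add: algebra_simps flip: exp_add)
  interpret B: limit_curve_sequence \<gamma> "c + 1" "exp \<gamma>" c k "\<lambda>n. A.q n ^ (k n - 1)"
  proof unfold_locales
    show "(\<lambda>n. A.q n ^ (k n - 1)) \<longlonglongrightarrow> exp \<gamma> * B.e" unfolding Be by (rule A.q_power_pred)
    show "\<forall>\<^sub>F n in sequentially. 0 < A.q n ^ (k n - 1)"
      using A.q_eventually by eventually_elim simp
  qed (use assms in auto)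
  have q: "A.q n = 1 - \<gamma> / real n" "B.q n = 1 - \<gamma> / real n" for n
    by (simp_all add: A.q_def B.q_def)
  show ?thesis
  proof (intro conjI impI)
    assume rd: "\<forall>\<^sub>F n in sequentially. random_diagram (M n) (L n) n (k n) (mu_A n (k n) (1 - \<gamma> / real n))"
    show "has_limit_shape (c + 1) M (\<lambda>n \<omega>. upper_boundary n (k n) (L n \<omega>)) (limit_shape (rho_A c \<gamma>))"
    proof (rule A.limit_shape_convergence[OF rd _ mA])
      show "\<forall>\<^sub>F n in sequentially. \<exists>C>0. \<forall>l\<in>diagrams n (k n). mu_A n (k n) (1 - \<gamma> / real n) l =
        vandermonde_weight C (A.q n) 1 n (k n) l"
        using A.q_eventually
      proof eventually_elim
        case (elim n)
        then show ?case unfolding q(1)[symmetric] by (intro mu_A_density) auto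
      qed
      show "rho_A c \<gamma> t = A.rho t" if "0 < t" "t < c + 1" for t
        by (rule A.rho_A_eq[OF refl \<theta>e that])
    qed (simp_all add: rho_A_def arccos_density_bounds)
  next
    assume rd: "\<forall>\<^sub>F n in sequentially. random_diagram (M n) (L n) n (k n) (mu_B n (k n) (1 - \<gamma> / real n))"
    show "has_limit_shape (c + 1) M (\<lambda>n \<omega>. upper_boundary n (k n) (L n \<omega>)) (limit_shape (rho_B c \<gamma>))"
    proof (rule B.limit_shape_convergence[OF rd _ mB])
      show "\<forall>\<^sub>F n in sequentially. \<exists>C>0. \<forall>l\<in>diagrams n (k n). mu_B n (k n) (1 - \<gamma> / real n) l =
        vandermonde_weight C (B.q n) (A.q n ^ (k n - 1)) n (k n) l"
        using A.q_eventually
      proof eventually_elim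
        case (elim n)
        then show ?case unfolding q by (intro mu_B_density) auto
      qed
      show "rho_B c \<gamma> t = B.rho t" if "0 < t" "t < c + 1" for t
        by (rule B.rho_B_eq[OF refl refl that])
    qed (simp_all add: rho_B_def arccos_density_bounds)
  qed
qed

end
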